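(* $\overline{\varphi(M)}=V$, where $\overline{\varphi(M)}$ is the closure of the image of $\varphi:M\to\mathbb P^{40-1}$, and $V$ is the subvariety of $\mathbb P^{40-1}$ (with homogeneous coordinates $y_\alpha$, $\alpha\in\mathcal A$) defined by the $G$-orbits of the linear equation $$y_{(124,356)}-y_{(145,236)}+y_{(146,235)}-y_{(134,256)}=0$$ and the cubic equation $$y_{(124,356)}\,y_{(15,23,46)}\,y_{(13,26,45)}-y_{(145,236)}\,y_{(13,56,24)}\,y_{(12,35,46)}=0.$$
   Context: Everything is over $\mathbb C$. **The space $M$.** For $x=(x_1,x_2,x_3,x_4)\in\mathbb C^4$ also write $x$ for the $3\times 6$ matrix $$x=\begin{pmatrix}1&0&0&1&1&1\\0&1&0&1&x_1&x_2\\0&0&1&1&x_3&x_4\end{pmatrix}.$$ Put $D_1=x_1x_4-x_2x_3$, $D_2=x_1x_4-x_4+x_2-x_2x_3+x_3-x_1$, $Q=-x_1x_2x_3-x_2x_3x_4+x_2x_3+x_1x_2x_4+x_1x_3x_4-x_1x_4$, and $$D(x)=x_1x_2x_3x_4(x_1-1)(x_2-1)(x_3-1)(x_4-1)(x_1-x_2)(x_1-x_3)(x_2-x_4)(x_3-x_4)D_1D_2Q.$$ $M=\{x\in\mathbb C^4\mid D(x)\ne0\}$ is the moduli space of marked cubic surfaces: it is the space of $3\times6$ matrices whose columns give six points of $\mathbb P^2$, no three collinear and not all six on a conic, modulo $GL_3$ on the left and $(\mathbb C^\times)^6$ scaling the columns. **Root system and the group $G$.** Let $\varepsilon_1,\dots,\varepsilon_8$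 be an orthonormal basis of Euclidean $8$-space, $\tilde\varepsilon=\varepsilon_6-\varepsilon_7-\varepsilon_8$, and $E$ the span of $\varepsilon_1,\dots,\varepsilon_5,\tilde\varepsilon$. Put $r=-\frac12(\varepsilon_1+\cdots+\varepsilon_5+\tilde\varepsilon)$ and $r_0=\frac12(\varepsilon_1+\cdots+\varepsilon_5-\tilde\varepsilon)$; $r_{1j}=-\varepsilon_{j-1}+r_0$ for $2\le j\le6$; $r_{jk}=\varepsilon_{j-1}-\varepsilon_{k-1}$ and $r_{1jk}=-\varepsilon_{j-1}-\varepsilon_{k-1}$ for $2\le j<k\le6$; $r_{ijk}=-\varepsilon_{i-1}-\varepsilon_{j-1}-\varepsilon_{k-1}+r_0$ for $2\le i<j<k\le6$ (indices of $r_{ij}$, $r_{ijk}$ may be permuted freely). $\Delta=\{\pm r,\pm r_{ij},\pm r_{ijk}\}$ is a root system of type $E_6$. Let $s_{ij},s_{ijk}$ be the reflections of $E$ in $r_{ij},r_{ijk}$, and $G=\langle s_{12},s_{23},s_{34},s_{45},s_{56},s_{123}\rangle\cong W(E_6)$. **Labels.** $\mathcal A$ is the set of $40$ labels consisting of the $10$ labels $(abc,def)$ and the $30$ labels $(ab,cd,ef)$ with $\{a,b,c,d,e,f\}=\{1,\dots,6\}$, with identifications: in $(abc,def)$ the entries inside each triple may be permuted and the two triples interchanged; in $(ab,cd,ef)$ the entries inside each pair may be permuted and the three pairs may be cyclically permuted (but $(ab,cd,ef)\ne(ab,ef,cd)$). Labels correspond bijectively to unordered triples of mutually orthogonal $A_2$-subsystems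 of $\Delta$ spanning $E$: the label $(abc,def)$ corresponds to $$\{\pm r_{ab},\pm r_{bc},\pm r_{ac}\},\ \{\pm r_{de},\pm r_{ef},\pm r_{df}\},\ \{\pm r,\pm r_{abc},\pm r_{def}\},$$ and $(ab,cd,ef)$ corresponds to $$\{\pm r_{ab},\pm r_{acd},\pm r_{bcd}\},\ \{\pm r_{cd},\pm r_{cef},\pm r_{def}\},\ \{\pm r_{ef},\pm r_{abe},\pm r_{abf}\}.$$ Via this bijection $G$ acts on $\mathcal A$. **Action of $G$ on $\mathbb P^{40-1}$ and on equations.** The homogeneous coordinates on $\mathbb P^{40-1}$ are $y_\alpha$ ($\alpha\in\mathcal A$). Each generator $s\in\{s_{12},s_{23},s_{34},s_{45},s_{56},s_{123}\}$ acts linearly on the coordinates by $s(y_\alpha)=y_\alpha$ if $s\alpha=\alpha$, and $s(y_\alpha)=-y_{\beta}$ if $s\alpha=\beta\neq\alpha$. This defines an action of $G$ on $\mathbb P^{40-1}$ and on homogeneous polynomials in the $y_\alpha$; the $G$-orbit of an equation is the set of all equations obtained from it by this action. **The map $\varphi$.** For a $3\times6$ matrix $x=(x_{ij})$ let $D_{ijk}(x)$ be the $3\times3$ minor on the columns $i,j,k$, always taken in increasing order (so $D_{ijk}$ does not depend on the order of the indices), and let $Q(x)$ here denote the determinant of the $6\times6$ matrix with columns $(x_{1j}x_{2j},\,x_{2j}x_{3j},\,x_{3j}x_{1j},\,x_{1j}^2,\,x_{2j}^2,\,x_{3j}^2)$, $j=1,\dots,6$. Define $$y_{(abc,def)}(x)=D_{abc}(x)D_{def}(x)Q(x),$$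 $$y_{(ab,cd,ef)}(x)=D_{acd}(x)D_{bcd}(x)D_{cef}(x)D_{def}(x)D_{eab}(x)D_{fab}(x).$$ The map $\varphi:M\to\mathbb P^{40-1}$ sends $x$ to the point with homogeneous coordinates $(y_\alpha(x))_{\alpha\in\mathcal A}$. *)

theory Defs
  imports "HOL-Analysis.Analysis"
begin

section \<open>The moduli space of marked cubic surfaces\<close>

definition disc :: "complex^4 \<Rightarrow> complex" where
  "disc x =
    (let x1 = x $ 1; x2 = x $ 2; x3 = x $ 3; x4 = x $ 4;
         D1 = x1 * x4 - x2 * x3;
         D2 = x1 * x4 - x4 + x2 - x2 * x3 + x3 - x1;
         Q = - x1 * x2 * x3 - x2 * x3 * x4 + x2 * x3 + x1 * x2 * x4 + x1 * x3 * x4 - x1 * x4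
     in x1 * x2 * x3 * x4 * (x1 - 1) * (x2 - 1) * (x3 - 1) * (x4 - 1) *
        (x1 - x2) * (x1 - x3) * (x2 - x4) * (x3 - x4) * D1 * D2 * Q)"

definition M :: "(complex^4) set" where
  "M = {x. disc x \<noteq> 0}"

definition mat36 :: "complex^4 \<Rightarrow> complex^6^3" where
  "mat36 x = vector
    [vector [1, 0, 0, 1, 1, 1],
     vector [0, 1, 0, 1, x $ 1, x $ 2],
     vector [0, 0, 1, 1, x $ 3, x $ 4]]"


section \<open>Labels\<close>

text \<open>
  The label \<open>(abc,def)\<close> is encoded as the set \<open>{{a,b,c},{d,e,f}}\<close>, and \<open>(ab,cd,ef)\<close> as the graph
  of the cyclic successor map on its three pairs; the required identifications (and no others)
  thus hold by extensionality. Indices are kept in \<^typ>\<open>nat\<close>: in the order of the numeral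
  type \<^typ>\<open>6\<close> the element \<open>6 = 0\<close> would come first, and increasing order matters below.
\<close>

datatype pre_label = Triples "nat set set" | Pairs "(nat set \<times> nat set) set"

definition pre_triples :: "nat \<Rightarrow> nat \<Rightarrow> nat \<Rightarrow> nat \<Rightarrow> nat \<Rightarrow> nat \<Rightarrow> pre_label" where
  "pre_triples a b c d e f = Triples {{a, b, c}, {d, e, f}}"

definition pre_pairs :: "nat \<Rightarrow> nat \<Rightarrow> nat \<Rightarrow> nat \<Rightarrow> nat \<Rightarrow> nat \<Rightarrow> pre_label" where
  "pre_pairs a b c d e f = Pairs {({a, b}, {c, d}), ({c, d}, {e, f}), ({e, f}, {a, b})}"

typedef label =
  "{pre_triples a b c d e f | a b c d e f. {a, b, c, d, e, f} = {1..6}} \<union>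
   {pre_pairs a b c d e f | a b c d e f. {a, b, c, d, e, f} = {1..6}}"
  morphisms rep_label abs_label
proof -
  have "{1, 2, 3, 4, 5, 6} = {1..6::nat}" by auto
  then show ?thesis by blast
qed

definition triples_label :: "nat \<Rightarrow> nat \<Rightarrow> nat \<Rightarrow> nat \<Rightarrow> nat \<Rightarrow> nat \<Rightarrow> label" where
  "triples_label a b c d e f = abs_label (pre_triples a b c d e f)"

definition pairs_label :: "nat \<Rightarrow> nat \<Rightarrow> nat \<Rightarrow> nat \<Rightarrow> nat \<Rightarrow> nat \<Rightarrow> label" where
  "pairs_label a b c d e f = abs_label (pre_pairs a b c d e f)"

instance label :: finite
proof
  define N :: "nat set" where "N = {1..6}"
  define h where "h g = (\<lambda>(a, b, c, d, e, f). g a b c d e f)"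
    for g :: "nat \<Rightarrow> nat \<Rightarrow> nat \<Rightarrow> nat \<Rightarrow> nat \<Rightarrow> nat \<Rightarrow> pre_label"
  have "range rep_label \<subseteq>
      h pre_triples ` (N \<times> N \<times> N \<times> N \<times> N \<times> N) \<union> h pre_pairs ` (N \<times> N \<times> N \<times> N \<times> N \<times> N)"
  proof
    fix p assume "p \<in> range rep_label"
    then obtain l where "p = rep_label l" by blast
    with rep_label[of l] obtain a b c d e f
      where p: "p = pre_triples a b c d e f \<or> p = pre_pairs a b c d e f"
        and eq: "{a, b, c, d, e, f} = {1..6}"
      by blast
    from eq have "(a, b, c, d, e, f) \<in> N \<times> N \<times> N \<times> N \<times> N \<times> N" unfolding N_def by blast
    moreover have "p = h pre_triples (a, b, c, d, e, f) \<or> p = h pre_pairs (a, b, c, d, e, f)"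
      using p by (simp add: h_def)
    ultimately show "p \<in> h pre_triples ` (N \<times> N \<times> N \<times> N \<times> N \<times> N) \<union>
        h pre_pairs ` (N \<times> N \<times> N \<times> N \<times> N \<times> N)"
      by blast
  qed
  moreover have "finite N" by (simp add: N_def)
  ultimately have "finite (range rep_label)"
    by (meson finite_SigmaI finite_UnI finite_imageI finite_subset)
  then show "finite (UNIV :: label set)"
    by (rule finite_imageD) (simp add: inj_on_def rep_label_inject)
qed


section \<open>Roots, the reflection group and its action on labels\<close>

definition eps :: "nat \<Rightarrow> real^8" where
  "eps k = axis (of_nat k) 1"

definition eps_tilde :: "real^8" where
  "eps_tilde = eps 6 - eps 7 - eps 8"

definition root_r :: "real^8" where
  "root_r = (- 1 / 2) *\<^sub>R ((\<Sum>i = 1..5. eps i) + eps_tilde)"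

definition root_r0 :: "real^8" where
  "root_r0 = (1 / 2) *\<^sub>R ((\<Sum>i = 1..5. eps i) - eps_tilde)"

fun sorted_root :: "nat list \<Rightarrow> real^8" where
  "sorted_root [i, j] =
     (if i = 1 then - eps (j - 1) + root_r0 else eps (i - 1) - eps (j - 1))"
| "sorted_root [i, j, k] =
     (if i = 1 then - eps (j - 1) - eps (k - 1)
      else - eps (i - 1) - eps (j - 1) - eps (k - 1) + root_r0)"
| "sorted_root _ = 0"

text \<open>The roots \<open>r\<^sub>i\<^sub>j\<close> and \<open>r\<^sub>i\<^sub>j\<^sub>k\<close>, indexed by the set of their indices.\<close>

definition index_root :: "nat set \<Rightarrow> real^8" where
  "index_root I = sorted_root (sorted_list_of_set I)"

definition pm :: "'a::uminus set \<Rightarrow> 'a set" where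
  "pm A = A \<union> uminus ` A"

text \<open>
  The triple of \<open>A\<^sub>2\<close>-subsystems of a label. In the second case, the element \<open>(P, Q) = ({a,b},{c,d})\<close>
  of the cyclic successor graph contributes \<open>{\<plusminus>r\<^sub>a\<^sub>b, \<plusminus>r\<^sub>a\<^sub>c\<^sub>d, \<plusminus>r\<^sub>b\<^sub>c\<^sub>d}\<close>.
\<close>

fun pre_A2_triple :: "pre_label \<Rightarrow> (real^8) set set" where
  "pre_A2_triple (Triples S) =
     insert (pm (insert root_r (index_root ` S)))
       ((\<lambda>T. pm {index_root {i, j} | i j. i \<in> T \<and> j \<in> T \<and> i \<noteq> j}) ` S)"
| "pre_A2_triple (Pairs C) =
     (\<lambda>(P, Q). pm (insert (index_root P) {index_root (insert i Q) | i. i \<in> P})) ` C"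

definition A2_triple :: "label \<Rightarrow> (real^8) set set" where
  "A2_triple \<alpha> = pre_A2_triple (rep_label \<alpha>)"

text \<open>
  All roots lie in the six-dimensional space \<open>E\<close>; a reflection in a root is written on the ambient
  space, where it fixes the orthogonal complement of \<open>E\<close> pointwise. Hence the group below is
  identified with \<open>G\<close> by restriction to \<open>E\<close>.
\<close>

definition reflection :: "real^8 \<Rightarrow> real^8 \<Rightarrow> real^8" where
  "reflection r v = v - (2 * (r \<bullet> v) / (r \<bullet> r)) *\<^sub>R r"

definition gens :: "(real^8 \<Rightarrow> real^8) set" where
  "gens = (\<lambda>I. reflection (index_root I)) ` {{1, 2}, {2, 3}, {3, 4}, {4, 5}, {5, 6}, {1, 2, 3}}"

text \<open>The generators are involutions, so no inverses are needed.\<close>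

inductive_set G :: "(real^8 \<Rightarrow> real^8) set" where
  one: "id \<in> G"
| mult: "s \<in> gens \<Longrightarrow> g \<in> G \<Longrightarrow> s \<circ> g \<in> G"

definition act_label :: "(real^8 \<Rightarrow> real^8) \<Rightarrow> label \<Rightarrow> label" where
  "act_label g \<alpha> = (THE \<beta>. A2_triple \<beta> = (\<lambda>A. g ` A) ` A2_triple \<alpha>)"


section \<open>Projective space, homogeneous forms and the Zariski closure\<close>

text \<open>A point of projective space is the set of its homogeneous coordinate vectors.\<close>

definition proj_point :: "complex^'n \<Rightarrow> (complex^'n) set" where
  "proj_point v = {c *s v | c. c \<noteq> 0}"

definition proj_space :: "(complex^'n) set set" where
  "proj_space = proj_point ` {v. v \<noteq> 0}"

text \<open>
  Homogeneous polynomials over the infinite field of complex numbers are identified with the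
  functions they define; \<open>m\<close> ranges over the exponent vectors of the monomials of degree \<open>d\<close>.
\<close>

definition homogeneous_poly :: "nat \<Rightarrow> (complex^'n \<Rightarrow> complex) \<Rightarrow> bool" where
  "homogeneous_poly d F \<longleftrightarrow>
    (\<exists>a :: ('n \<Rightarrow> nat) \<Rightarrow> complex.
       F = (\<lambda>v. \<Sum>m | (\<Sum>i\<in>UNIV. m i) = d. a m * (\<Prod>i\<in>UNIV. (v $ i) ^ m i)))"

definition zero_locus :: "(complex^'n \<Rightarrow> complex) set \<Rightarrow> (complex^'n) set set" where
  "zero_locus \<F> = {p \<in> proj_space. \<forall>F\<in>\<F>. \<forall>v\<in>p. F v = 0}"

definition zariski_closed :: "(complex^'n) set set \<Rightarrow> bool" where
  "zariski_closed Z \<longleftrightarrow> (\<exists>\<F>. (\<forall>F\<in>\<F>. \<exists>d. homogeneous_poly d F) \<and> Z = zero_locus \<F>)"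

definition zariski_closure :: "(complex^'n) set set \<Rightarrow> (complex^'n) set set" where
  "zariski_closure S = zariski_closed hull S"


section \<open>The action on equations and the variety \<open>V\<close>\<close>

text \<open>
  A generator \<open>s\<close> substitutes \<open>s(y\<^sub>\<alpha>) \<in> {y\<^sub>\<alpha>, - y\<^bsub>s\<alpha>\<^esub>}\<close> for each variable \<open>y\<^sub>\<alpha>\<close>.
\<close>

definition gen_act :: "(real^8 \<Rightarrow> real^8) \<Rightarrow> (complex^label \<Rightarrow> complex) \<Rightarrow> complex^label \<Rightarrow> complex"
  where
  "gen_act s F =
    (\<lambda>y. F (\<chi> \<alpha>. if act_label s \<alpha> = \<alpha> then y $ \<alpha> else - y $ act_label s \<alpha>))"

text \<open>
  \<open>G_acts g T\<close>: the group element \<open>g\<close> acts on forms by \<open>T\<close>. The rule for the generators determines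
  \<open>T\<close> as a projective transformation; on forms of a given degree it may leave a sign, which
  does not affect the equation.
\<close>

inductive G_acts ::
  "(real^8 \<Rightarrow> real^8) \<Rightarrow> ((complex^label \<Rightarrow> complex) \<Rightarrow> complex^label \<Rightarrow> complex) \<Rightarrow> bool"
  where
  one: "G_acts id id"
| mult: "s \<in> gens \<Longrightarrow> G_acts g T \<Longrightarrow> G_acts (s \<circ> g) (gen_act s \<circ> T)"

definition G_orbit :: "(complex^label \<Rightarrow> complex) \<Rightarrow> (complex^label \<Rightarrow> complex) set" where
  "G_orbit F = {T F | g T. g \<in> G \<and> G_acts g T}"

definition linear_eq :: "complex^label \<Rightarrow> complex" where
  "linear_eq y =
     y $ triples_label 1 2 4 3 5 6 - y $ triples_label 1 4 5 2 3 6
     + y $ triples_label 1 4 6 2 3 5 - y $ triples_label 1 3 4 2 5 6"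

definition cubic_eq :: "complex^label \<Rightarrow> complex" where
  "cubic_eq y =
     y $ triples_label 1 2 4 3 5 6 * y $ pairs_label 1 5 2 3 4 6 * y $ pairs_label 1 3 2 6 4 5
     - y $ triples_label 1 4 5 2 3 6 * y $ pairs_label 1 3 5 6 2 4 * y $ pairs_label 1 2 3 5 4 6"

definition V :: "(complex^label) set set" where
  "V = zero_locus (G_orbit linear_eq \<union> G_orbit cubic_eq)"


section \<open>The map \<open>\<phi>\<close>\<close>

text \<open>
  \<open>minor X {i,j,k}\<close> is \<open>D\<^sub>i\<^sub>j\<^sub>k(X)\<close>, with the columns taken in increasing order. As an element of the type
  \<^typ>\<open>6\<close>, the column index \<open>6\<close> is \<open>0\<close>; this is also how \<^const>\<open>vector\<close> places its last entry.
\<close>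

definition minor :: "complex^6^3 \<Rightarrow> nat set \<Rightarrow> complex" where
  "minor X I =
    det (transpose (vector (map (\<lambda>k. column (of_nat k) X) (sorted_list_of_set I)) :: complex^3^3))"

definition conic_det :: "complex^6^3 \<Rightarrow> complex" where
  "conic_det X =
    det (\<chi> i j. (vector [X$1$j * X$2$j, X$2$j * X$3$j, X$3$j * X$1$j,
                        (X$1$j)\<^sup>2, (X$2$j)\<^sup>2, (X$3$j)\<^sup>2] :: complex^6) $ i)"

fun pre_coord :: "complex^6^3 \<Rightarrow> pre_label \<Rightarrow> complex" where
  "pre_coord X (Triples S) = (\<Prod>T\<in>S. minor X T) * conic_det X"
| "pre_coord X (Pairs C) = (\<Prod>(P, Q)\<in>C. \<Prod>i\<in>P. minor X (insert i Q))"

definition coord :: "complex^6^3 \<Rightarrow> label \<Rightarrow> complex" where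
  "coord X \<alpha> = pre_coord X (rep_label \<alpha>)"

definition \<phi> :: "complex^4 \<Rightarrow> (complex^label) set" where
  "\<phi> x = proj_point (\<chi> \<alpha>. coord (mat36 x) \<alpha>)"


section \<open>The encodings agree with the explicit formulas\<close>

lemma rep_triples_label:
  assumes "{a, b, c, d, e, f} = {1..6}"
  shows "rep_label (triples_label a b c d e f) = Triples {{a, b, c}, {d, e, f}}"
  unfolding triples_label_def pre_triples_def
  by (rule abs_label_inverse) (use assms in \<open>unfold pre_triples_def, blast\<close>)

lemma rep_pairs_label:
  assumes "{a, b, c, d, e, f} = {1..6}"
  shows "rep_label (pairs_label a b c d e f) =
    Pairs {({a, b}, {c, d}), ({c, d}, {e, f}), ({e, f}, {a, b})}"
  unfolding pairs_label_def pre_pairs_def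
  by (rule abs_label_inverse) (use assms in \<open>unfold pre_pairs_def, blast\<close>)

lemma label_indices_distinct:
  assumes "{a, b, c, d, e, f} = {1..6::nat}"
  shows "distinct [a, b, c, d, e, f]"
proof (rule card_distinct)
  have "set [a, b, c, d, e, f] = {1..6}" using assms by simp
  then show "card (set [a, b, c, d, e, f]) = length [a, b, c, d, e, f]" by simp
qed

lemma coord_triples_label:
  assumes "{a, b, c, d, e, f} = {1..6}"
  shows "coord X (triples_label a b c d e f) = minor X {a, b, c} * minor X {d, e, f} * conic_det X"
proof -
  have "{a, b, c} \<noteq> {d, e, f}"
    using label_indices_distinct[OF assms] by auto
  then show ?thesis
    by (simp add: coord_def rep_triples_label[OF assms])
qed

lemma coord_pairs_label:
  assumes "{a, b, c, d, e, f} = {1..6}"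
  shows "coord X (pairs_label a b c d e f) =
    minor X {a, c, d} * minor X {b, c, d} * minor X {c, e, f} * minor X {d, e, f} *
    minor X {e, a, b} * minor X {f, a, b}"
proof -
  have d: "distinct [a, b, c, d, e, f]" by (rule label_indices_distinct[OF assms])
  then have "{a, b} \<noteq> {c, d}" "{c, d} \<noteq> {e, f}" "{a, b} \<noteq> {e, f}"
    by (auto simp: doubleton_eq_iff)
  with d show ?thesis
    by (simp add: coord_def rep_pairs_label[OF assms] mult.assoc)
qed

lemma A2_triple_triples_label:
  assumes "{a, b, c, d, e, f} = {1..6}"
  shows "A2_triple (triples_label a b c d e f) =
    {pm {index_root {a, b}, index_root {b, c}, index_root {a, c}},
     pm {index_root {d, e}, index_root {e, f}, index_root {d, f}},
     pm {root_r, index_root {a, b, c}, index_root {d, e, f}}}"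
proof -
  have d: "distinct [a, b, c, d, e, f]" by (rule label_indices_distinct[OF assms])
  have edges: "{index_root {i, j} | i j. i \<in> {p, q, r} \<and> j \<in> {p, q, r} \<and> i \<noteq> j} =
      {index_root {p, q}, index_root {q, r}, index_root {p, r}}"
    if "distinct [p, q, r]" for p q r
    using that by (auto simp: insert_commute)
  show ?thesis
    using d edges[of a b c] edges[of d e f]
    by (simp add: A2_triple_def rep_triples_label[OF assms] insert_commute)
qed

lemma A2_triple_pairs_label:
  assumes "{a, b, c, d, e, f} = {1..6}"
  shows "A2_triple (pairs_label a b c d e f) =
    {pm {index_root {a, b}, index_root {a, c, d}, index_root {b, c, d}},
     pm {index_root {c, d}, index_root {c, e, f}, index_root {d, e, f}},
     pm {index_root {e, f}, index_root {a, b, e}, index_root {a, b, f}}}"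
proof -
  have two: "{index_root (insert i Q) | i. i \<in> {p, q}} = {index_root (insert p Q), index_root (insert q Q)}" for p q Q
    by auto
  have "{e, a, b} = {a, b, e}" "{f, a, b} = {a, b, f}"
    by auto
  then show ?thesis
    by (simp add: A2_triple_def rep_pairs_label[OF assms] two del: insert_iff)
qed

end

theory Submission
  imports Defs
begin

text \<open>
  The linear action of \<open>G\<close> preserves the cone over \<open>V\<close> by definition, and it preserves the cone over
  \<open>\<phi>(M)\<close> because renumbering two consecutive points, or applying the standard Cremona transformation
  in the first three points, multiplies the coordinate vector of \<open>\<phi>\<close> by a scalar and the signed
  permutation of the corresponding reflection (\<open>phi_vec_move\<close>). Both given equations vanish on
  \<open>\<phi>(M)\<close>, so all of \<open>\<phi>(M)\<close> lies in \<open>V\<close>. For the other inclusion it suffices that every vector of the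
  cone over \<open>V\<close> is a limit, in the Euclidean topology, of vectors over \<open>\<phi>(M)\<close>, since polynomials are
  continuous. As \<open>G\<close> is transitive on labels, only vectors with \<open>\<delta> = y\<^bsub>(123,456)\<^esub> \<noteq> 0\<close> matter.

  In that chart the linear equations say that, up to signs, the coordinates of \<open>y\<close> are
  \<open>\<delta>\<close>, \<open>p\<^sub>a - q\<^sub>b\<close>, \<open>A\<^sub>a - B\<^sub>b\<close>, \<open>\<delta> - (p\<^sub>a - q\<^sub>b) - (A\<^sub>a - B\<^sub>b)\<close>, and \<open>p\<^sub>c - A\<^sub>a\<close>, \<open>q\<^sub>c - B\<^sub>b\<close> with different
  indices, for four vectors \<open>p, q, A, B\<close> of length three with \<open>\<Sum>p - \<Sum>q = \<Sum>A - \<Sum>B = \<delta>\<close>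
  (\<open>cone_trihedral_coordinates\<close>). The four vectors are unique up to adding one constant to all
  entries, which is used to get \<open>p \<cdot> A = q \<cdot> B\<close>. For the image of a marking one may take
  \<open>p\<close> and \<open>q\<close> to be proportional to the two triples of even and odd terms in the expansion of the
  determinant \<open>D\<^sub>4\<^sub>5\<^sub>6\<close>, and then \<open>\<Prod>p = \<Prod>q\<close>; this is the toric cubic fourfold that underlies the
  Cayley--Salmon form of a cubic surface. With \<open>\<pi>\<^sub>i\<close> and \<open>\<kappa>\<^sub>i\<close> the products of two entries of \<open>p\<close> and \<open>q\<close>,
  and \<open>Q = \<Sum>\<pi> - \<Sum>\<kappa>\<close>, the vectors over the image are the multiples of
  \<open>(Q p, Q q, \<delta> \<pi>, \<delta> \<kappa>)\<close> (\<open>toric\<close>, \<open>trihedral_vector_marking\<close>).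

  It remains to solve the \<open>36\<close> cubic equations that involve \<open>\<delta>\<close> (\<open>trihedral\<close>). They imply that all the
  products \<open>p\<^sub>a A\<^sub>a\<close> and \<open>q\<^sub>b B\<^sub>b\<close> agree, that \<open>\<Prod>p = \<Prod>q\<close>, and that \<open>Q A = \<delta> \<pi>\<close> and \<open>Q B = \<delta> \<kappa>\<close>
  (\<open>trihedral_products\<close>, \<open>trihedral_coord_prod\<close>, \<open>trihedral_cofactors_eq\<close>). If \<open>Q \<noteq> 0\<close>, the point is
  therefore in the image of the toric fourfold. Everything is symmetric under
  \<open>(p, q) \<leftrightarrow> (A, B)\<close>, so the analogue \<open>Q'\<close> of \<open>Q\<close> may also be used. If \<open>Q = Q' = 0\<close>, each of the four
  vectors has at most one nonzero entry, and the point is a limit along an explicit curve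
  (\<open>toric_closure_axes\<close>, \<open>trihedral_in_toric_closure\<close>).
\<close>

section \<open>Labels, roots and the action of the simple reflections\<close>

text \<open>
  The names used below for the \<open>40\<close> labels are their positions in this list; \<open>0\<close> is \<open>(123,456)\<close>,
  and the triple labels come first.
\<close>
definition labels :: "label list" where
  "labels =
   [triples_label 1 2 3 4 5 6, triples_label 1 2 4 3 5 6, triples_label 1 2 5 3 4 6,
    triples_label 1 2 6 3 4 5, triples_label 1 3 4 2 5 6, triples_label 1 3 5 2 4 6,
    triples_label 1 3 6 2 4 5, triples_label 1 4 5 2 3 6, triples_label 1 4 6 2 3 5,
    triples_label 1 5 6 2 3 4, pairs_label 1 2 3 4 5 6, pairs_label 1 2 3 5 4 6,
    pairs_label 1 2 3 6 4 5, pairs_label 1 2 4 5 3 6, pairs_label 1 2 4 6 3 5,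
    pairs_label 1 2 5 6 3 4, pairs_label 1 3 2 4 5 6, pairs_label 1 3 2 5 4 6,
    pairs_label 1 3 2 6 4 5, pairs_label 1 3 4 5 2 6, pairs_label 1 3 4 6 2 5,
    pairs_label 1 3 5 6 2 4, pairs_label 1 4 2 3 5 6, pairs_label 1 4 2 5 3 6,
    pairs_label 1 4 2 6 3 5, pairs_label 1 4 3 5 2 6, pairs_label 1 4 3 6 2 5,
    pairs_label 1 4 5 6 2 3, pairs_label 1 5 2 3 4 6, pairs_label 1 5 2 4 3 6,
    pairs_label 1 5 2 6 3 4, pairs_label 1 5 3 4 2 6, pairs_label 1 5 3 6 2 4,
    pairs_label 1 5 4 6 2 3, pairs_label 1 6 2 3 4 5, pairs_label 1 6 2 4 3 5,
    pairs_label 1 6 2 5 3 4, pairs_label 1 6 3 4 2 5, pairs_label 1 6 3 5 2 4,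
    pairs_label 1 6 4 5 2 3]"

definition lab :: "nat \<Rightarrow> label" where "lab i = labels ! i"

definition root_index_sets :: "nat set list" where
  "root_index_sets =
   [{1, 2}, {1, 3}, {1, 4}, {1, 5}, {1, 6}, {2, 3}, {2, 4}, {2, 5},
    {2, 6}, {3, 4}, {3, 5}, {3, 6}, {4, 5}, {4, 6}, {5, 6}, {1, 2, 3},
    {1, 2, 4}, {1, 2, 5}, {1, 2, 6}, {1, 3, 4}, {1, 3, 5}, {1, 3, 6}, {1, 4, 5}, {1, 4, 6},
    {1, 5, 6}, {2, 3, 4}, {2, 3, 5}, {2, 3, 6}, {2, 4, 5}, {2, 4, 6}, {2, 5, 6}, {3, 4, 5},
    {3, 4, 6}, {3, 5, 6}, {4, 5, 6}]"

text \<open>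
  The \<open>36\<close> roots up to sign, as twice their coordinates with respect to \<open>eps 1, \<dots>, eps 8\<close>; the
  doubling makes them integral. The first is \<open>root_r\<close>, the others follow the index sets above.
\<close>
definition root_coeffs :: "int list list" where
  "root_coeffs =
   [[-1, -1, -1, -1, -1, -1, 1, 1], [-1, 1, 1, 1, 1, -1, 1, 1], [1, -1, 1, 1, 1, -1, 1, 1],
    [1, 1, -1, 1, 1, -1, 1, 1], [1, 1, 1, -1, 1, -1, 1, 1], [1, 1, 1, 1, -1, -1, 1, 1],
    [2, -2, 0, 0, 0, 0, 0, 0], [2, 0, -2, 0, 0, 0, 0, 0], [2, 0, 0, -2, 0, 0, 0, 0],
    [2, 0, 0, 0, -2, 0, 0, 0], [0, 2, -2, 0, 0, 0, 0, 0], [0, 2, 0, -2, 0, 0, 0, 0],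
    [0, 2, 0, 0, -2, 0, 0, 0], [0, 0, 2, -2, 0, 0, 0, 0], [0, 0, 2, 0, -2, 0, 0, 0],
    [0, 0, 0, 2, -2, 0, 0, 0], [-2, -2, 0, 0, 0, 0, 0, 0], [-2, 0, -2, 0, 0, 0, 0, 0],
    [-2, 0, 0, -2, 0, 0, 0, 0], [-2, 0, 0, 0, -2, 0, 0, 0], [0, -2, -2, 0, 0, 0, 0, 0],
    [0, -2, 0, -2, 0, 0, 0, 0], [0, -2, 0, 0, -2, 0, 0, 0], [0, 0, -2, -2, 0, 0, 0, 0],
    [0, 0, -2, 0, -2, 0, 0, 0], [0, 0, 0, -2, -2, 0, 0, 0], [-1, -1, -1, 1, 1, -1, 1, 1],
    [-1, -1, 1, -1, 1, -1, 1, 1], [-1, -1, 1, 1, -1, -1, 1, 1], [-1, 1, -1, -1, 1, -1, 1, 1],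
    [-1, 1, -1, 1, -1, -1, 1, 1], [-1, 1, 1, -1, -1, -1, 1, 1], [1, -1, -1, -1, 1, -1, 1, 1],
    [1, -1, -1, 1, -1, -1, 1, 1], [1, -1, 1, -1, -1, -1, 1, 1], [1, 1, -1, -1, -1, -1, 1, 1]]"

text \<open>
  For each label, the positions of the positive roots of its three \<open>A\<^sub>2\<close>-subsystems.
\<close>
definition label_roots :: "nat list list list" where
  "label_roots =
   [[[0, 16, 35], [1, 2, 6], [13, 14, 15]], [[0, 17, 34], [1, 3, 7], [11, 12, 15]], [[0, 18, 33], [1, 4, 8], [10, 12, 14]],
    [[0, 19, 32], [1, 5, 9], [10, 11, 13]], [[0, 20, 31], [2, 3, 10], [8, 9, 15]], [[0, 21, 30], [2, 4, 11], [7, 9, 14]],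
    [[0, 22, 29], [2, 5, 12], [7, 8, 13]], [[0, 23, 28], [3, 4, 13], [6, 9, 12]], [[0, 24, 27], [3, 5, 14], [6, 8, 11]],
    [[0, 25, 26], [4, 5, 15], [6, 7, 10]], [[1, 20, 26], [10, 34, 35], [15, 18, 19]], [[1, 21, 27], [11, 33, 35], [14, 17, 19]],
    [[1, 22, 28], [12, 32, 35], [13, 17, 18]], [[1, 23, 29], [12, 16, 19], [13, 33, 34]], [[1, 24, 30], [11, 16, 18], [14, 32, 34]],
    [[1, 25, 31], [10, 16, 17], [15, 32, 33]], [[2, 17, 26], [7, 31, 35], [15, 21, 22]], [[2, 18, 27], [8, 30, 35], [14, 20, 22]],
    [[2, 19, 28], [9, 29, 35], [13, 20, 21]], [[2, 23, 32], [9, 16, 22], [13, 30, 31]], [[2, 24, 33], [8, 16, 21], [14, 29, 31]],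
    [[2, 25, 34], [7, 16, 20], [15, 29, 30]], [[3, 16, 26], [6, 31, 34], [15, 23, 24]], [[3, 18, 29], [8, 28, 34], [12, 20, 24]],
    [[3, 19, 30], [9, 27, 34], [11, 20, 23]], [[3, 21, 32], [9, 17, 24], [11, 28, 31]], [[3, 22, 33], [8, 17, 23], [12, 27, 31]],
    [[3, 25, 35], [6, 17, 20], [15, 27, 28]], [[4, 16, 27], [6, 30, 33], [14, 23, 25]], [[4, 17, 29], [7, 28, 33], [12, 21, 25]],
    [[4, 19, 31], [9, 26, 33], [10, 21, 23]], [[4, 20, 32], [9, 18, 25], [10, 28, 30]], [[4, 22, 34], [7, 18, 23], [12, 26, 30]],
    [[4, 24, 35], [6, 18, 21], [14, 26, 28]], [[5, 16, 28], [6, 29, 32], [13, 24, 25]], [[5, 17, 30], [7, 27, 32], [11, 22, 25]],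
    [[5, 18, 31], [8, 26, 32], [10, 22, 24]], [[5, 20, 33], [8, 19, 25], [10, 27, 29]], [[5, 21, 34], [7, 19, 24], [11, 26, 29]],
    [[5, 23, 35], [6, 19, 22], [13, 26, 27]]]"

text \<open>
  The action of the six generators on roots up to sign, and below on labels.
\<close>
definition root_perms :: "nat list list" where
  "root_perms =
   [[0, 1, 6, 7, 8, 9, 2, 3, 4, 5, 10, 11, 12, 13, 14, 15, 16, 17, 18, 19, 26, 27, 28, 29, 30, 31, 20, 21, 22, 23, 24, 25, 32, 33, 34, 35],
    [0, 2, 1, 3, 4, 5, 6, 10, 11, 12, 7, 8, 9, 13, 14, 15, 16, 20, 21, 22, 17, 18, 19, 23, 24, 25, 26, 27, 28, 32, 33, 34, 29, 30, 31, 35],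
    [0, 1, 3, 2, 4, 5, 7, 6, 8, 9, 10, 13, 14, 11, 12, 15, 17, 16, 18, 19, 20, 23, 24, 21, 22, 25, 26, 29, 30, 27, 28, 31, 32, 33, 35, 34],
    [0, 1, 2, 4, 3, 5, 6, 8, 7, 9, 11, 10, 12, 13, 15, 14, 16, 18, 17, 19, 21, 20, 22, 23, 25, 24, 27, 26, 28, 29, 31, 30, 32, 34, 33, 35],
    [0, 1, 2, 3, 5, 4, 6, 7, 9, 8, 10, 12, 11, 14, 13, 15, 16, 17, 19, 18, 20, 22, 21, 24, 23, 25, 26, 28, 27, 30, 29, 31, 33, 32, 34, 35],
    [35, 1, 2, 26, 27, 28, 6, 20, 21, 22, 17, 18, 19, 13, 14, 15, 16, 10, 11, 12, 7, 8, 9, 23, 24, 25, 3, 4, 5, 29, 30, 31, 32, 33, 34, 0]]"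

definition label_perms :: "nat list list" where
  "label_perms =
   [[0, 1, 2, 3, 9, 8, 7, 6, 5, 4, 10, 11, 12, 13, 14, 15, 27, 33, 39, 34, 28, 22, 21, 32, 38, 35, 29, 16, 20, 26, 37, 36, 23, 17, 19, 25, 31, 30, 24, 18],
    [0, 4, 5, 6, 1, 2, 3, 7, 8, 9, 16, 17, 18, 19, 20, 21, 10, 11, 12, 13, 14, 15, 22, 25, 26, 23, 24, 27, 28, 31, 32, 29, 30, 33, 34, 37, 38, 35, 36, 39],
    [1, 0, 2, 3, 4, 7, 8, 5, 6, 9, 10, 13, 14, 11, 12, 15, 22, 23, 24, 25, 26, 27, 16, 17, 18, 19, 20, 21, 29, 28, 30, 31, 33, 32, 35, 34, 36, 37, 39, 38],
    [0, 2, 1, 3, 5, 4, 6, 7, 9, 8, 11, 10, 12, 13, 15, 14, 17, 16, 18, 19, 21, 20, 28, 29, 30, 31, 32, 33, 22, 23, 24, 25, 26, 27, 34, 36, 35, 38, 37, 39],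
    [0, 1, 3, 2, 4, 6, 5, 8, 7, 9, 10, 12, 11, 14, 13, 15, 16, 18, 17, 20, 19, 21, 22, 24, 23, 26, 25, 27, 34, 35, 36, 37, 38, 39, 28, 29, 30, 31, 32, 33],
    [0, 10, 11, 12, 16, 17, 18, 39, 33, 27, 1, 2, 3, 13, 14, 15, 4, 5, 6, 19, 20, 21, 22, 38, 32, 36, 30, 9, 28, 37, 26, 35, 24, 8, 34, 31, 25, 29, 23, 7]]"

definition act_roots :: "nat list \<Rightarrow> nat list list \<Rightarrow> nat list list" where
  "act_roots \<sigma> T = sort_key hd (map (\<lambda>t. sort (map ((!) \<sigma>) t)) T)"

text \<open>
  The index \<open>8\<close> is the element \<open>0\<close> of the numeral type, hence the detour through residues.
\<close>
lemma inner_eps: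
  assumes "i \<in> {1..8}" "j \<in> {1..8}"
  shows "eps i \<bullet> eps j = (if i = j then 1 else 0)"
proof -
  have Rep: "Rep_bit0 (of_nat n :: 8) = int n mod 8" for n
    unfolding bit0.of_nat_eq bit0.Rep_Abs_mod by simp
  have "(of_nat i :: 8) = of_nat j \<longleftrightarrow> int i mod 8 = int j mod 8"
    unfolding bit0.Rep_inject_sym Rep ..
  also have "\<dots> \<longleftrightarrow> i = j"
    using assms by (cases "i = 8"; cases "j = 8") simp_all
  finally show ?thesis by (simp add: eps_def inner_axis_axis)
qed

definition root_vector :: "int list \<Rightarrow> real^8" where
  "root_vector c = (1 / 2) *\<^sub>R (\<Sum>i<8. real_of_int (c ! i) *\<^sub>R eps (Suc i))"

definition dot_coeffs :: "int list \<Rightarrow> int list \<Rightarrow> int" where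
  "dot_coeffs c d = sum_list (map2 (*) c d)"

lemma dot_coeffs_sum: "length c = 8 \<Longrightarrow> length d = 8 \<Longrightarrow> dot_coeffs c d = (\<Sum>i<8. c ! i * d ! i)"
  by (simp add: dot_coeffs_def sum_list_sum_nth atLeast0LessThan)

lemma inner_root_vector:
  assumes "length c = 8" "length d = 8"
  shows "root_vector c \<bullet> root_vector d = dot_coeffs c d / 4"
proof -
  let ?c = "\<lambda>i. real_of_int (c ! i)" and ?d = "\<lambda>i. real_of_int (d ! i)"
  have "(\<Sum>i<8. ?c i *\<^sub>R eps (Suc i)) \<bullet> (\<Sum>j<8. ?d j *\<^sub>R eps (Suc j)) =
    (\<Sum>i<8. \<Sum>j<8. ?c i * (?d j * (eps (Suc i) \<bullet> eps (Suc j))))"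
    unfolding inner_sum_left unfolding inner_sum_right by (intro sum.cong refl) (simp add: mult.left_commute)
  also have "\<dots> = (\<Sum>i<8. \<Sum>j<8. if i = j then ?c i * ?d i else 0)"
    by (intro sum.cong refl) (simp add: inner_eps)
  also have "\<dots> = (\<Sum>i<8. ?c i * ?d i)" by (simp add: sum.delta')
  finally show ?thesis using assms by (simp add: root_vector_def dot_coeffs_sum)
qed

lemma reflection_root_vector:
  assumes "dot_coeffs c c = 8" "dot_coeffs c d = 4 * n" "length c = 8" "length d = 8"
  shows "reflection (root_vector c) (root_vector d) = root_vector (map2 (\<lambda>x y. x - n * y) d c)"
proof -
  have "reflection (root_vector c) (root_vector d) = root_vector d - real_of_int n *\<^sub>R root_vector c"
    using assms by (simp add: reflection_def inner_root_vector)
  also have "\<dots> = (1/2) *\<^sub>R (\<Sum>i<8. (real_of_int (d ! i) - real_of_int n * real_of_int (c ! i)) *\<^sub>R eps (Suc i))"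
    by (simp add: root_vector_def scaleR_left_diff_distrib sum_subtractf scaleR_sum_right scaleR_right_diff_distrib mult.commute)
  also have "\<dots> = root_vector (map2 (\<lambda>x y. x - n * y) d c)"
    using assms by (simp add: root_vector_def)
  finally show ?thesis .
qed

lemma minus_root_vector: "length c = 8 \<Longrightarrow> - root_vector c = root_vector (map uminus c)"
  by (simp add: root_vector_def sum_negf)

lemma inj_root_vector:
  assumes "root_vector c = root_vector d" "length c = 8" "length d = 8"
  shows "c = d"
proof (rule nth_equalityI)
  show "length c = length d" using assms by simp
  fix i assume i: "i < length c"
  have "root_vector x \<bullet> eps (Suc i) = real_of_int (x ! i) / 2" if "length x = 8" for x
  proof -
    have "root_vector x \<bullet> eps (Suc i) = (\<Sum>j<8. real_of_int (x ! j) * (eps (Suc j) \<bullet> eps (Suc i))) / 2"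
      by (simp add: root_vector_def inner_sum_left)
    also have "(\<Sum>j<8. real_of_int (x ! j) * (eps (Suc j) \<bullet> eps (Suc i))) = (\<Sum>j<8. if i = j then real_of_int (x ! j) else 0)"
      using i assms by (intro sum.cong refl) (auto simp: inner_eps)
    also have "\<dots> = real_of_int (x ! i)" using i assms by simp
    finally show ?thesis .
  qed
  from this[of c] this[of d] show "c ! i = d ! i" using assms by simp
qed

lemma root_vector_8: "root_vector [a,b,c,d,e,f,g,h] = (1/2) *\<^sub>R (of_int a *\<^sub>R eps 1 + of_int b *\<^sub>R eps 2 + of_int c *\<^sub>R eps 3 + of_int d *\<^sub>R eps 4 + of_int e *\<^sub>R eps 5 + of_int f *\<^sub>R eps 6 + of_int g *\<^sub>R eps 7 + of_int h *\<^sub>R eps 8)"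
proof -
  have eq: "{..<8::nat} = {0,1,2,3,4,5,6,7}" by auto
  show ?thesis unfolding root_vector_def eq by (simp add: add.assoc numeral_eq_Suc)
qed

lemma sum_eps: "(\<Sum>i = 1..5. eps i) = eps 1 + eps 2 + eps 3 + eps 4 + eps 5"
proof -
  have eq: "{1..5::nat} = {1,2,3,4,5}" by auto
  show ?thesis unfolding eq by (simp add: add.assoc)
qed

lemma root_r0: "root_r0 = root_vector [1, 1, 1, 1, 1, -1, 1, 1]"
  unfolding root_r0_def sum_eps eps_tilde_def by (simp add: root_vector_8 algebra_simps)

lemma root_vector_add:
  "length c = 8 \<Longrightarrow> length d = 8 \<Longrightarrow> root_vector c + root_vector d = root_vector (map2 (+) c d)"
  by (simp add: root_vector_def scaleR_left_distrib sum.distrib scaleR_right_distrib)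

lemma root_vector_diff:
  "length c = 8 \<Longrightarrow> length d = 8 \<Longrightarrow> root_vector c - root_vector d = root_vector (map2 (-) c d)"
  by (simp add: root_vector_def scaleR_left_diff_distrib sum_subtractf scaleR_right_diff_distrib)

lemma eps_root_vector:
  "eps (Suc 0) = root_vector [2, 0, 0, 0, 0, 0, 0, 0]"
  "eps 2 = root_vector [0, 2, 0, 0, 0, 0, 0, 0]"
  "eps 3 = root_vector [0, 0, 2, 0, 0, 0, 0, 0]"
  "eps 4 = root_vector [0, 0, 0, 2, 0, 0, 0, 0]"
  "eps 5 = root_vector [0, 0, 0, 0, 2, 0, 0, 0]"
  by (simp_all add: root_vector_8)

text \<open>
  Adding the coefficient lists turns the defining formulas of the roots into computations with integers.
\<close>
lemma index_roots: "map index_root root_index_sets = map root_vector (tl root_coeffs)"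
  by (simp add: root_index_sets_def root_coeffs_def index_root_def root_r0 eps_root_vector root_vector_add root_vector_diff minus_root_vector)

lemma root_r: "root_r = root_vector (root_coeffs ! 0)"
  unfolding root_r_def sum_eps eps_tilde_def by (simp add: root_coeffs_def root_vector_8 algebra_simps)

definition equal_up_to_sign :: "int list \<Rightarrow> int list \<Rightarrow> bool" where
  "equal_up_to_sign c d \<longleftrightarrow> c = d \<or> map uminus c = d"

definition reflects_to :: "int list \<Rightarrow> int list \<Rightarrow> int \<Rightarrow> int list \<Rightarrow> bool" where
  "reflects_to c d m e \<longleftrightarrow> m mod 4 = 0 \<and> equal_up_to_sign (map2 (\<lambda>x y. x - m div 4 * y) d c) e"

definition reflection_checks :: "int list \<Rightarrow> nat list \<Rightarrow> bool" where
  "reflection_checks c \<sigma> \<longleftrightarrow> dot_coeffs c c = 8 \<and>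
    list_all2 (\<lambda>d k. reflects_to c d (dot_coeffs c d) (root_coeffs ! k)) root_coeffs \<sigma>"

lemma refl_check:
  "list_all2 (\<lambda>r \<sigma>. reflection_checks (root_coeffs ! r) \<sigma>) [1, 6, 10, 13, 15, 16] root_perms"
  by (simp add: root_perms_def reflection_checks_def root_coeffs_def dot_coeffs_def reflects_to_def equal_up_to_sign_def)

definition E6_root :: "nat \<Rightarrow> real^8" where
  "E6_root k = root_vector (root_coeffs ! k)"

definition gen_roots :: "nat list" where
  "gen_roots = [1, 6, 10, 13, 15, 16]"

definition gen :: "nat \<Rightarrow> real^8 \<Rightarrow> real^8" where
  "gen j = reflection (E6_root (gen_roots ! j))"

lemma length_root_coeffs: "length root_coeffs = 36"
  by (simp add: root_coeffs_def)

lemma length_root_coeff: "k < 36 \<Longrightarrow> length (root_coeffs ! k) = 8"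
proof -
  have "\<forall>c\<in>set root_coeffs. length c = 8" by (simp add: root_coeffs_def)
  then show "k < 36 \<Longrightarrow> length (root_coeffs ! k) = 8"
    using length_root_coeffs by (metis nth_mem)
qed

lemma index_root_eqs:
  "index_root {1, 2} = E6_root 1"
  "index_root {1, 3} = E6_root 2"
  "index_root {1, 4} = E6_root 3"
  "index_root {1, 5} = E6_root 4"
  "index_root {1, 6} = E6_root 5"
  "index_root {2, 3} = E6_root 6"
  "index_root {2, 4} = E6_root 7"
  "index_root {2, 5} = E6_root 8"
  "index_root {2, 6} = E6_root 9"
  "index_root {3, 4} = E6_root 10"
  "index_root {3, 5} = E6_root 11"
  "index_root {3, 6} = E6_root 12"
  "index_root {4, 5} = E6_root 13"
  "index_root {4, 6} = E6_root 14"
  "index_root {5, 6} = E6_root 15"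
  "index_root {1, 2, 3} = E6_root 16"
  "index_root {1, 2, 4} = E6_root 17"
  "index_root {1, 2, 5} = E6_root 18"
  "index_root {1, 2, 6} = E6_root 19"
  "index_root {1, 3, 4} = E6_root 20"
  "index_root {1, 3, 5} = E6_root 21"
  "index_root {1, 3, 6} = E6_root 22"
  "index_root {1, 4, 5} = E6_root 23"
  "index_root {1, 4, 6} = E6_root 24"
  "index_root {1, 5, 6} = E6_root 25"
  "index_root {2, 3, 4} = E6_root 26"
  "index_root {2, 3, 5} = E6_root 27"
  "index_root {2, 3, 6} = E6_root 28"
  "index_root {2, 4, 5} = E6_root 29"
  "index_root {2, 4, 6} = E6_root 30"
  "index_root {2, 5, 6} = E6_root 31"
  "index_root {3, 4, 5} = E6_root 32"
  "index_root {3, 4, 6} = E6_root 33"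
  "index_root {3, 5, 6} = E6_root 34"
  "index_root {4, 5, 6} = E6_root 35"
  using index_roots by (simp_all add: root_index_sets_def root_coeffs_def E6_root_def)

lemma root_r_eq: "root_r = E6_root 0"
  by (simp add: root_r E6_root_def)

lemma gens_eq: "gens = gen ` {..<6}"
proof -
  have "{..<6::nat} = {0,1,2,3,4,5}" by auto
  then show ?thesis by (simp add: gens_def gen_def index_root_eqs[simplified One_nat_def] gen_roots_def)
qed

text \<open>
  All inner products of roots are integers, so a reflection acts on coefficient lists by integer
  arithmetic; this is what makes the table of root permutations checkable.
\<close>
lemma gen_root:
  assumes "j < 6" "k < 36"
  shows "gen j (E6_root k) = E6_root (root_perms ! j ! k) \<or> gen j (E6_root k) = - E6_root (root_perms ! j ! k)"
proof -
  let ?c = "root_coeffs ! (gen_roots ! j)" and ?d = "root_coeffs ! k"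
  have j: "gen_roots ! j < 36"
  proof -
    have "\<forall>r\<in>set gen_roots. r < 36" by (simp add: gen_roots_def)
    moreover have "j < length gen_roots" using assms by (simp add: gen_roots_def)
    ultimately show ?thesis by (metis nth_mem)
  qed
  have "reflection_checks ?c (root_perms ! j)"
    using refl_check assms(1) by (auto simp: list_all2_conv_all_nth gen_roots_def)
  then have cc: "dot_coeffs ?c ?c = 8"
    and m: "dot_coeffs ?c ?d mod 4 = 0"
    and e: "equal_up_to_sign (map2 (\<lambda>x y. x - dot_coeffs ?c ?d div 4 * y) ?d ?c) (root_coeffs ! (root_perms ! j ! k))"
    using assms(2) by (auto simp: reflection_checks_def reflects_to_def list_all2_conv_all_nth length_root_coeffs)
  have len: "length ?c = 8" "length ?d = 8" using j assms by (auto simp: length_root_coeff)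
  have "gen j (E6_root k) = root_vector (map2 (\<lambda>x y. x - dot_coeffs ?c ?d div 4 * y) ?d ?c)"
    unfolding gen_def E6_root_def using m by (intro reflection_root_vector cc len) auto
  moreover define E where "E = map2 (\<lambda>x y. x - dot_coeffs ?c ?d div 4 * y) ?d ?c"
  ultimately have g: "gen j (E6_root k) = root_vector E" by simp
  have "length E = 8" using len by (simp add: E_def)
  then have "root_vector (map uminus E) = - root_vector E" by (simp add: minus_root_vector)
  moreover have "E = root_coeffs ! (root_perms ! j ! k) \<or> map uminus E = root_coeffs ! (root_perms ! j ! k)"
    using e unfolding E_def equal_up_to_sign_def .
  ultimately show ?thesis unfolding g by (metis E6_root_def minus_minus)
qed

lemma A2_triple_labels:
  "map A2_triple labels = map (\<lambda>T. (\<lambda>t. pm (E6_root ` set t)) ` set T) label_roots"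
proof -
  have six: "{Suc 0..6} = {1,2,3,4,5,6::nat}" by auto
  show ?thesis
    unfolding labels_def label_roots_def
    by (simp add: A2_triple_triples_label A2_triple_pairs_label six insert_commute index_root_eqs[simplified One_nat_def insert_commute] root_r_eq)
qed

lemma label_roots_perm:
  "list_all2 (\<lambda>\<sigma> \<pi>. map (act_roots \<sigma>) label_roots = map ((!) label_roots) \<pi>) root_perms label_perms"
  by code_simp

lemma distinct_label_roots: "distinct (map (\<lambda>T. sort (concat T)) label_roots)"
  by (simp add: label_roots_def)

lemma label_roots_bound: "list_all (list_all (list_all (\<lambda>k. k < 36))) label_roots"
  by (simp add: label_roots_def)

lemma length_label_roots: "length label_roots = 40"
  by (simp add: label_roots_def)

lemma label_perms_bound: "list_all (\<lambda>\<pi>. length \<pi> = 40 \<and> list_all (\<lambda>k. k < 40) \<pi>) label_perms"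
  by (simp add: label_perms_def)

lemma root_eq_iff:
  assumes "j < 36" "k < 36"
  shows "E6_root j = E6_root k \<longleftrightarrow> j = k" and "E6_root j \<noteq> - E6_root k"
proof -
  have dist: "distinct root_coeffs" by (simp add: root_coeffs_def)
  have neq: "list_all (\<lambda>c. list_all (\<lambda>d. c \<noteq> map uminus d) root_coeffs) root_coeffs"
    by (simp add: root_coeffs_def)
  have "root_coeffs ! j \<in> set root_coeffs" "root_coeffs ! k \<in> set root_coeffs"
    using assms by (simp_all add: length_root_coeffs)
  then have d: "root_coeffs ! j \<noteq> map uminus (root_coeffs ! k)"
    using neq by (simp add: list_all_iff)
  have len: "length (root_coeffs ! j) = 8" "length (root_coeffs ! k) = 8"
    using assms by (simp_all add: length_root_coeff)
  show "E6_root j = E6_root k \<longleftrightarrow> j = k"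
    using inj_root_vector[OF _ len] nth_eq_iff_index_eq[OF dist] assms
    by (metis E6_root_def length_root_coeffs)
  show "E6_root j \<noteq> - E6_root k"
    using inj_root_vector[of "root_coeffs ! j" "map uminus (root_coeffs ! k)"] d len
    by (metis E6_root_def minus_root_vector length_map)
qed

lemma length_labels: "length labels = 40"
  by (simp add: labels_def)

lemma A2_triple_lab:
  assumes "i < 40"
  shows "A2_triple (lab i) = (\<lambda>t. pm (E6_root ` set t)) ` set (label_roots ! i)"
proof -
  have "length label_roots = 40" by (simp add: label_roots_def)
  then show ?thesis
    using arg_cong[OF A2_triple_labels, of "\<lambda>l. l ! i"] assms by (simp add: lab_def length_labels)
qed

lemma label_root_less:
  assumes "i < 40" "t \<in> set (label_roots ! i)" "k \<in> set t"
  shows "k < 36"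
proof -
  have "label_roots ! i \<in> set label_roots" using assms(1) by (intro nth_mem) (simp add: label_roots_def)
  then show ?thesis using label_roots_bound assms by (auto simp: list_all_iff)
qed

text \<open>
  The nine roots of the three subsystems already determine the label, so the definite description in
  the action on labels is unique.
\<close>
lemma A2_triple_lab_inj:
  assumes "i < 40" "j < 40" "A2_triple (lab i) = A2_triple (lab j)"
  shows "i = j"
proof -
  have roots: "set (concat (label_roots ! i)) = {k. k < 36 \<and> E6_root k \<in> \<Union> (A2_triple (lab i))}" if "i < 40" for i
  proof -
    have "E6_root k \<in> pm (E6_root ` set t) \<longleftrightarrow> k \<in> set t" if "k < 36" "t \<in> set (label_roots ! i)" for k t
      using label_root_less[OF \<open>i < 40\<close> that(2)] that(1) root_eq_iff[OF that(1)]
      by (auto simp: pm_def)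
    then have "k \<in> set (concat (label_roots ! i)) \<longleftrightarrow> k < 36 \<and> E6_root k \<in> \<Union> (A2_triple (lab i))" for k
      using label_root_less[OF that] unfolding A2_triple_lab[OF that] by (simp, blast)
    then show ?thesis by blast
  qed
  have "set (concat (label_roots ! i)) = set (concat (label_roots ! j))"
    using roots assms by simp
  moreover have "list_all (\<lambda>T. distinct (concat T)) label_roots" by (simp add: label_roots_def)
  then have "distinct (concat (label_roots ! i))" if "i < 40" for i
    using that nth_mem[of i label_roots] unfolding list_all_iff
    by (metis length_label_roots)
  ultimately have "sort (concat (label_roots ! i)) = sort (concat (label_roots ! j))"
    using assms(1,2) by (intro sorted_distinct_set_unique) (simp_all del: set_concat)
  then show ?thesis
    using assms(1,2) nth_eq_iff_index_eq[OF distinct_label_roots, of i j]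
    by (simp add: length_label_roots)
qed

lemma lab_inject: "i < 40 \<Longrightarrow> j < 40 \<Longrightarrow> lab i = lab j \<longleftrightarrow> i = j"
  using A2_triple_lab_inj by metis

definition perm :: "nat \<Rightarrow> nat \<Rightarrow> nat" where
  "perm j i = label_perms ! j ! i"

lemma perm_less: "j < 6 \<Longrightarrow> i < 40 \<Longrightarrow> perm j i < 40"
proof -
  assume j: "j < 6" and i: "i < 40"
  have "label_perms ! j \<in> set label_perms" using j by (intro nth_mem) (simp add: label_perms_def)
  with label_perms_bound i show ?thesis
    unfolding perm_def list_all_iff by (metis nth_mem)
qed

lemma gen_linear: "gen j (- v) = - gen j v"
  by (simp add: gen_def reflection_def)

lemma gen_pm_roots:
  assumes j: "j < 6" and t: "\<forall>k\<in>set t. k < 36"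
  shows "gen j ` pm (E6_root ` set t) = pm (E6_root ` set (map ((!) (root_perms ! j)) t))"
proof -
  have "gen j ` pm X = pm (gen j ` X)" for X
    by (auto simp: pm_def gen_linear image_iff image_Un)
  moreover have "pm (f ` S) = pm (g ` S)" if "\<And>k. k \<in> S \<Longrightarrow> f k = g k \<or> f k = - g k" for S and f g :: "nat \<Rightarrow> real^8"
  proof -
    have 1: "pm (f ` S) = (\<Union>k\<in>S. {f k, - f k})" for f :: "nat \<Rightarrow> real^8" by (auto simp: pm_def)
    show ?thesis unfolding 1 by (intro SUP_cong refl) (use that in fastforce)
  qed
  ultimately have "gen j ` pm (E6_root ` set t) = pm ((\<lambda>k. E6_root (root_perms ! j ! k)) ` set t)"
    using gen_root[OF j] t by (metis (no_types, lifting) image_image)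
  then show ?thesis by (simp add: image_image)
qed

lemma A2_triple_perm:
  assumes j: "j < 6" and i: "i < 40"
  shows "A2_triple (lab (perm j i)) = (\<lambda>A. gen j ` A) ` A2_triple (lab i)"
proof -
  let ?\<sigma> = "root_perms ! j"
  have "map (act_roots ?\<sigma>) label_roots = map ((!) label_roots) (label_perms ! j)"
    using label_roots_perm j by (auto simp: list_all2_conv_all_nth root_perms_def)
  then have "map (act_roots ?\<sigma>) label_roots ! i = map ((!) label_roots) (label_perms ! j) ! i" by simp
  moreover have "label_perms ! j \<in> set label_perms" using j by (intro nth_mem) (simp add: label_perms_def)
  moreover have "length label_roots = 40" by (simp add: label_roots_def)
  ultimately have T: "label_roots ! perm j i = act_roots ?\<sigma> (label_roots ! i)"
    using i label_perms_bound by (simp add: perm_def list_all_iff)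
  have "(\<lambda>A. gen j ` A) ` A2_triple (lab i) = (\<lambda>t. pm (E6_root ` set (map ((!) ?\<sigma>) t))) ` set (label_roots ! i)"
    unfolding A2_triple_lab[OF i] image_image
    by (intro image_cong refl gen_pm_roots[OF j]) (use label_root_less[OF i] in blast)
  also have "\<dots> = (\<lambda>t. pm (E6_root ` set t)) ` set (act_roots ?\<sigma> (label_roots ! i))"
    by (simp add: act_roots_def image_image)
  also have "\<dots> = A2_triple (lab (perm j i))"
    unfolding A2_triple_lab[OF perm_less[OF j i]] T ..
  finally show ?thesis by simp
qed

definition pair_tails :: "(nat \<times> nat \<times> nat \<times> nat \<times> nat) list" where
  "pair_tails =
   [(2, 3, 4, 5, 6), (2, 3, 5, 4, 6), (2, 3, 6, 4, 5), (2, 4, 5, 3, 6), (2, 4, 6, 3, 5),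
    (2, 5, 6, 3, 4), (3, 2, 4, 5, 6), (3, 2, 5, 4, 6), (3, 2, 6, 4, 5), (3, 4, 5, 2, 6),
    (3, 4, 6, 2, 5), (3, 5, 6, 2, 4), (4, 2, 3, 5, 6), (4, 2, 5, 3, 6), (4, 2, 6, 3, 5),
    (4, 3, 5, 2, 6), (4, 3, 6, 2, 5), (4, 5, 6, 2, 3), (5, 2, 3, 4, 6), (5, 2, 4, 3, 6),
    (5, 2, 6, 3, 4), (5, 3, 4, 2, 6), (5, 3, 6, 2, 4), (5, 4, 6, 2, 3), (6, 2, 3, 4, 5),
    (6, 2, 4, 3, 5), (6, 2, 5, 3, 4), (6, 3, 4, 2, 5), (6, 3, 5, 2, 4), (6, 4, 5, 2, 3)]"

definition triple_tails :: "(nat \<times> nat \<times> nat \<times> nat \<times> nat) list" where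
  "triple_tails =
   [(2, 3, 4, 5, 6), (2, 4, 3, 5, 6), (2, 5, 3, 4, 6), (2, 6, 3, 4, 5), (3, 4, 2, 5, 6),
    (3, 5, 2, 4, 6), (3, 6, 2, 4, 5), (4, 5, 2, 3, 6), (4, 6, 2, 3, 5), (5, 6, 2, 3, 4)]"

lemma pair_tails_in_labels: "list_all (\<lambda>(b,c,d,e,f). pairs_label 1 b c d e f \<in> set labels) pair_tails"
  by (simp add: pair_tails_def labels_def)

lemma triple_tails_in_labels: "list_all (\<lambda>(b,c,d,e,f). triples_label 1 b c d e f \<in> set labels) triple_tails"
  by (simp add: triple_tails_def labels_def)

lemma pair_tails_complete:
  "list_all (\<lambda>b. list_all (\<lambda>c. list_all (\<lambda>d. list_all (\<lambda>e. list_all (\<lambda>f.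
    distinct [b,c,d,e,f] \<longrightarrow> c < d \<longrightarrow> e < f \<longrightarrow> (b,c,d,e,f) \<in> set pair_tails) [2..<7]) [2..<7]) [2..<7]) [2..<7]) [2..<7]"
  by code_simp

lemma triple_tails_complete:
  "list_all (\<lambda>b. list_all (\<lambda>c. list_all (\<lambda>d. list_all (\<lambda>e. list_all (\<lambda>f.
    distinct [b,c,d,e,f] \<longrightarrow> b < c \<longrightarrow> d < e \<longrightarrow> e < f \<longrightarrow> (b,c,d,e,f) \<in> set triple_tails) [2..<7]) [2..<7]) [2..<7]) [2..<7]) [2..<7]"
  by code_simp

lemma pairs_label_in_labels:
  assumes eq: "{a,b,c,d,e,f} = {1..6}"
  shows "pairs_label a b c d e f \<in> set labels"
proof -
  let ?S = "set [2..<7::nat]"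
  have sub: "x \<in> ?S" if "x \<in> {1..6}" "x \<noteq> 1" for x :: nat using that by auto
  have swap1: "pairs_label a b c d e f = pairs_label b a c d e f" for a b c d e f
    by (simp add: pairs_label_def pre_pairs_def insert_commute)
  have swap2: "pairs_label a b c d e f = pairs_label a b d c e f" for a b c d e f
    by (simp add: pairs_label_def pre_pairs_def insert_commute)
  have swap3: "pairs_label a b c d e f = pairs_label a b c d f e" for a b c d e f
    by (simp add: pairs_label_def pre_pairs_def insert_commute)
  have rot: "pairs_label a b c d e f = pairs_label c d e f a b" for a b c d e f
    by (simp add: pairs_label_def pre_pairs_def insert_commute)
  have ordered: "pairs_label 1 b c d e f \<in> set labels"
    if eq: "{1,b,c,d,e,f} = {1..6}" and less: "c < d" "e < f" for b c d e f
  proof -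
    have dist: "distinct [1,b,c,d,e,f]" by (rule label_indices_distinct[OF eq])
    have "b \<in> {1..6}" "c \<in> {1..6}" "d \<in> {1..6}" "e \<in> {1..6}" "f \<in> {1..6}"
      unfolding eq[symmetric] by blast+
    then have "b \<in> ?S" "c \<in> ?S" "d \<in> ?S" "e \<in> ?S" "f \<in> ?S"
      using sub dist by (metis distinct_length_2_or_more)+
    moreover have "distinct [b,c,d,e,f]" using dist by simp
    ultimately have "(b,c,d,e,f) \<in> set pair_tails"
      using pair_tails_complete less unfolding list_all_iff by blast
    then show ?thesis using pair_tails_in_labels unfolding list_all_iff by blast
  qed
  have first: "pairs_label 1 b c d e f \<in> set labels" if eq: "{1,b,c,d,e,f} = {1..6}" for b c d e f
  proof -
    have "c \<noteq> d" "e \<noteq> f" using label_indices_distinct[OF eq] by auto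
    then consider "c < d" "e < f" | "d < c" "e < f" | "c < d" "f < e" | "d < c" "f < e"
      by (meson linorder_neqE_nat)
    then show ?thesis
    proof cases
      case 1 then show ?thesis using ordered eq by blast
    next
      case 2
      have "{1,b,d,c,e,f} = {1..6}" unfolding eq[symmetric] by blast
      from ordered[OF this 2] show ?thesis using swap2 by metis
    next
      case 3
      have "{1,b,c,d,f,e} = {1..6}" unfolding eq[symmetric] by blast
      from ordered[OF this 3] show ?thesis using swap3 by metis
    next
      case 4
      have "{1,b,d,c,f,e} = {1..6}" unfolding eq[symmetric] by blast
      from ordered[OF this 4] show ?thesis using swap2 swap3 by metis
    qed
  qed
  have second: "pairs_label a b c d e f \<in> set labels"
    if eq: "{a,b,c,d,e,f} = {1..6}" and 1: "1 \<in> {a,b}" for a b c d e f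
  proof (cases "a = 1")
    case True then show ?thesis using first eq by blast
  next
    case False
    then have b: "b = 1" using 1 by blast
    have "{1,a,c,d,e,f} = {1..6}" unfolding eq[symmetric] b by blast
    from first[OF this] show ?thesis unfolding b using swap1 by metis
  qed
  have "1 \<in> {a,b,c,d,e,f}" unfolding eq by simp
  then consider "1 \<in> {a,b}" | "1 \<in> {c,d}" | "1 \<in> {e,f}" by blast
  then show ?thesis
  proof cases
    case 1 then show ?thesis using second eq by blast
  next
    case 2
    have "{c,d,e,f,a,b} = {1..6}" unfolding eq[symmetric] by blast
    from second[OF this 2] show ?thesis using rot by metis
  next
    case 3
    have "{e,f,a,b,c,d} = {1..6}" unfolding eq[symmetric] by blast
    from second[OF this 3] show ?thesis using rot by metis
  qed
qed

lemma ordered_three: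
  fixes x y z :: nat
  assumes "distinct [x,y,z]"
  obtains x' y' z' where "{x,y,z} = {x',y',z'}" "x' < y'" "y' < z'"
proof -
  have "finite {x,y,z}" "card {x,y,z} = 3" using assms by auto
  then have "length (sorted_list_of_set {x,y,z}) = 3"
    by (simp only: sorted_list_of_set.length_sorted_key_list_of_set)
  moreover have "\<exists>x' y' z'. l = [x',y',z']" if "length l = 3" for l :: "nat list"
    using that by (auto simp: numeral_3_eq_3 length_Suc_conv)
  ultimately obtain x' y' z' where l: "sorted_list_of_set {x,y,z} = [x',y',z']" by metis
  have "set (sorted_list_of_set {x,y,z}) = {x,y,z}" by (rule set_sorted_list_of_set) simp
  moreover have "sorted_wrt (<) (sorted_list_of_set {x,y,z})" by (rule strict_sorted_list_of_set)
  ultimately show ?thesis using that[of x' y' z'] unfolding l by auto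
qed

lemma triples_label_in_labels:
  assumes eq: "{a,b,c,d,e,f} = {1..6}"
  shows "triples_label a b c d e f \<in> set labels"
proof -
  let ?S = "set [2..<7::nat]"
  have sub: "x \<in> ?S" if "x \<in> {1..6}" "x \<noteq> 1" for x :: nat using that by auto
  have cong: "triples_label a b c d e f = triples_label a' b' c' d' e' f'"
    if "{a,b,c} = {a',b',c'}" "{d,e,f} = {d',e',f'}" for a b c d e f a' b' c' d' e' f'
    using that by (simp add: triples_label_def pre_triples_def)
  have first: "triples_label a b c d e f \<in> set labels"
    if eq: "{a,b,c,d,e,f} = {1..6}" and 1: "1 \<in> {a,b,c}" for a b c d e f
  proof -
    have dist: "distinct [a,b,c,d,e,f]" by (rule label_indices_distinct[OF eq])
    obtain x b' c' where abc: "{a,b,c} = {x,b',c'}" "x < b'" "b' < c'"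
      using ordered_three[of a b c] dist by auto
    have "{a,b,c} \<subseteq> {1..6}" unfolding eq[symmetric] by blast
    then have "1 \<le> x" "1 \<in> {x,b',c'}" using 1 abc by auto
    then have x: "x = 1" using abc by auto
    obtain d' e' f' where def: "{d,e,f} = {d',e',f'}" "d' < e'" "e' < f'"
      using ordered_three[of d e f] dist by auto
    have "{1,b',c',d',e',f'} = {a,b,c} \<union> {d,e,f}" using abc def x by auto
    then have all: "{1,b',c',d',e',f'} = {1..6}" unfolding eq[symmetric] by blast
    have dist: "distinct [1,b',c',d',e',f']" by (rule label_indices_distinct[OF all])
    have "b' \<in> {1..6}" "c' \<in> {1..6}" "d' \<in> {1..6}" "e' \<in> {1..6}" "f' \<in> {1..6}"
      unfolding all[symmetric] by blast+
    then have "b' \<in> ?S" "c' \<in> ?S" "d' \<in> ?S" "e' \<in> ?S" "f' \<in> ?S"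
      using sub dist by (metis distinct_length_2_or_more)+
    moreover have "distinct [b',c',d',e',f']" using dist by simp
    ultimately have "(b',c',d',e',f') \<in> set triple_tails"
      using triple_tails_complete abc(3) def(2,3) unfolding list_all_iff by blast
    then have "triples_label 1 b' c' d' e' f' \<in> set labels"
      using triple_tails_in_labels unfolding list_all_iff by blast
    then show ?thesis using cong[OF abc(1) def(1)] x by simp
  qed
  have "1 \<in> {a,b,c,d,e,f}" unfolding eq by simp
  then consider "1 \<in> {a,b,c}" | "1 \<in> {d,e,f}" by blast
  then show ?thesis
  proof cases
    case 1 then show ?thesis using first eq by blast
  next
    case 2
    have "{d,e,f,a,b,c} = {1..6}" unfolding eq[symmetric] by blast
    from first[OF this 2] show ?thesis
      by (simp add: triples_label_def pre_triples_def insert_commute)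
  qed
qed

text \<open>
  Every label has a representative that starts with \<open>1\<close> and is increasing wherever entries may be
  interchanged; the two lists of tails enumerate these representatives.
\<close>
lemma labels_complete: "\<alpha> \<in> set labels"
proof -
  obtain a b c d e f where eq: "{a,b,c,d,e,f} = {1..6}"
    and rep: "rep_label \<alpha> = pre_triples a b c d e f \<or> rep_label \<alpha> = pre_pairs a b c d e f"
    using rep_label[of \<alpha>] by blast
  have "\<alpha> = triples_label a b c d e f \<or> \<alpha> = pairs_label a b c d e f"
    using rep rep_label_inverse[of \<alpha>] unfolding triples_label_def pairs_label_def by metis
  then show ?thesis using pairs_label_in_labels[OF eq] triples_label_in_labels[OF eq] by metis
qed

lemma lab_surj: "\<exists>i<40. \<alpha> = lab i"
  using labels_complete[of \<alpha>] unfolding lab_def in_set_conv_nth length_labels by metis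

text \<open>
  This reduces the geometric action on labels to the table of permutations.
\<close>
lemma act_label_gen:
  assumes "j < 6" "i < 40"
  shows "act_label (gen j) (lab i) = lab (perm j i)"
  unfolding act_label_def
proof (rule the_equality)
  show "A2_triple (lab (perm j i)) = (\<lambda>A. gen j ` A) ` A2_triple (lab i)"
    by (rule A2_triple_perm[OF assms])
next
  fix \<beta> assume "A2_triple \<beta> = (\<lambda>A. gen j ` A) ` A2_triple (lab i)"
  then have "A2_triple \<beta> = A2_triple (lab (perm j i))" using A2_triple_perm[OF assms] by simp
  moreover obtain k where "k < 40" "\<beta> = lab k" using lab_surj by blast
  ultimately show "\<beta> = lab (perm j i)" using A2_triple_lab_inj perm_less[OF assms] by blast
qed

section \<open>The signed action on coordinates and the orbit of the equations\<close>

definition coords :: "complex^label \<Rightarrow> nat \<Rightarrow> complex" where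
  "coords y i = y $ lab i"

lemma coords_eqI:
  assumes "\<And>i. i < 40 \<Longrightarrow> coords y i = coords z i"
  shows "y = z"
  unfolding vec_eq_iff
proof
  fix \<alpha>
  obtain i where "i < 40" "\<alpha> = lab i" using lab_surj by blast
  then show "y $ \<alpha> = z $ \<alpha>" using assms[of i] by (simp add: coords_def)
qed

text \<open>
  The substitution of coordinates by which a generator acts on forms.
\<close>
definition signed_perm :: "nat \<Rightarrow> complex^label \<Rightarrow> complex^label" where
  "signed_perm j y = (\<chi> \<alpha>. if act_label (gen j) \<alpha> = \<alpha> then y $ \<alpha> else - y $ act_label (gen j) \<alpha>)"

lemma gen_act_gen: "gen_act (gen j) F = F \<circ> signed_perm j"
  by (simp add: gen_act_def signed_perm_def fun_eq_iff)

lemma coords_signed_perm: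
  assumes "j < 6" "i < 40"
  shows "coords (signed_perm j y) i = (if perm j i = i then coords y i else - coords y (perm j i))"
  using assms by (simp add: coords_def signed_perm_def act_label_gen lab_inject perm_less)

lemma perm_involution:
  assumes "j < 6" "i < 40"
  shows "perm j (perm j i) = i"
proof -
  have "list_all (\<lambda>\<pi>. map ((!) \<pi>) \<pi> = [0..<40]) label_perms"
    by (simp add: label_perms_def upt_rec)
  moreover have "label_perms ! j \<in> set label_perms" using assms by (intro nth_mem) (simp add: label_perms_def)
  ultimately have *: "map ((!) (label_perms ! j)) (label_perms ! j) = [0..<40]" by (simp add: list_all_iff)
  have "length (label_perms ! j) = 40" using arg_cong[OF *, of length] by simp
  then have "map ((!) (label_perms ! j)) (label_perms ! j) ! i = label_perms ! j ! (label_perms ! j ! i)"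
    using assms by simp
  then show ?thesis using assms by (simp add: perm_def *)
qed

lemma signed_perm_involution: "j < 6 \<Longrightarrow> signed_perm j (signed_perm j y) = y"
  by (rule coords_eqI) (auto simp: coords_signed_perm perm_less perm_involution)

lemma signed_perm_scale: "signed_perm j (c *s y) = c *s signed_perm j y"
  by (simp add: signed_perm_def vec_eq_iff)

lemma continuous_signed_perm: "continuous_on S (signed_perm j)"
  unfolding signed_perm_def
proof (rule continuous_on_vec_lambda)
  fix \<alpha>
  show "continuous_on S (\<lambda>y. if act_label (gen j) \<alpha> = \<alpha> then y $ \<alpha> else - y $ act_label (gen j) \<alpha>)"
    by (cases "act_label (gen j) \<alpha> = \<alpha>") (auto intro!: continuous_intros)
qed

text \<open>
  The affine cone over \<open>V\<close>, together with the origin.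
\<close>
definition equation_cone :: "(complex^label) set" where
  "equation_cone = {y. \<forall>F \<in> G_orbit linear_eq \<union> G_orbit cubic_eq. F y = 0}"

lemma signed_perm_cone:
  assumes "j < 6" "y \<in> equation_cone"
  shows "signed_perm j y \<in> equation_cone"
proof -
  have "F (signed_perm j y) = 0" if F: "F \<in> G_orbit F0" and F0: "F0 \<in> {linear_eq, cubic_eq}" for F F0
  proof -
    obtain g T where "F = T F0" "g \<in> G" "G_acts g T" using F by (auto simp: G_orbit_def)
    moreover have s: "gen j \<in> gens" using assms(1) by (simp add: gens_eq)
    ultimately have "(gen_act (gen j) \<circ> T) F0 \<in> G_orbit F0"
      unfolding G_orbit_def using G.mult[OF s] G_acts.mult[OF s] by blast
    then have "gen_act (gen j) F \<in> G_orbit linear_eq \<union> G_orbit cubic_eq"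
      using F0 \<open>F = T F0\<close> by auto
    then have "gen_act (gen j) F y = 0" using assms(2) by (simp add: equation_cone_def)
    then show ?thesis by (simp add: gen_act_gen)
  qed
  then show ?thesis unfolding equation_cone_def by blast
qed

type_synonym form = "(int \<times> nat list) list"

text \<open>
  Sparse integral forms in the \<open>40\<close> numbered coordinates. Members of the two orbits that are needed
  later are obtained by letting words in the generators act on such lists.
\<close>
definition eval_form :: "form \<Rightarrow> (nat \<Rightarrow> complex) \<Rightarrow> complex" where
  "eval_form r Y = (\<Sum>(c, m)\<leftarrow>r. of_int c * (\<Prod>i\<leftarrow>m. Y i))"

definition act_form :: "nat \<Rightarrow> form \<Rightarrow> form" where
  "act_form j r = map (\<lambda>(c, m). (c * (\<Prod>i\<leftarrow>m. if perm j i = i then 1 else - 1), map (perm j) m)) r"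

lemma eval_act_form:
  assumes "j < 6" "\<forall>(c, m) \<in> set r. \<forall>i \<in> set m. i < 40"
  shows "eval_form (act_form j r) (coords y) = eval_form r (coords (signed_perm j y))"
proof -
  have "(\<Prod>i\<leftarrow>m. coords (signed_perm j y) i) =
      of_int (\<Prod>i\<leftarrow>m. if perm j i = i then 1 else - 1) * (\<Prod>i\<leftarrow>map (perm j) m. coords y i)"
    if "\<forall>i \<in> set m. i < 40" for m
    using that
    by (induction m) (auto simp: coords_signed_perm[OF assms(1)])
  then show ?thesis
    using assms(2) by (induction r) (auto simp: eval_form_def act_form_def mult.assoc)
qed

lemma act_form_indices:
  "j < 6 \<Longrightarrow> \<forall>(c, m) \<in> set r. \<forall>i \<in> set m. i < 40 \<Longrightarrow> \<forall>(c, m) \<in> set (act_form j r). \<forall>i \<in> set m. i < 40"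
  by (force simp: act_form_def perm_less)

text \<open>
  Acting on a form and acting on a point amount to the same, and the cone is stable under the action.
\<close>
lemma cone_orbit_forms:
  assumes "set w \<subseteq> {..<6}" "\<forall>(c, m) \<in> set r. \<forall>i \<in> set m. i < 40"
    and base: "\<And>y. y \<in> equation_cone \<Longrightarrow> eval_form r (coords y) = 0" and y: "y \<in> equation_cone"
  shows "eval_form (foldr act_form w r) (coords y) = 0"
proof -
  have "(\<forall>(c, m) \<in> set (foldr act_form w r). \<forall>i \<in> set m. i < 40) \<and>
    (\<forall>y\<in>equation_cone. eval_form (foldr act_form w r) (coords y) = 0)"
    using assms(1)
  proof (induction w)
    case Nil then show ?case using assms(2) base by simp
  next
    case (Cons j w)
    then have "j < 6" "\<forall>(c, m) \<in> set (foldr act_form w r). \<forall>i \<in> set m. i < 40" by auto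
    then show ?case
      using Cons act_form_indices eval_act_form[of j "foldr act_form w r"] signed_perm_cone by auto
  qed
  then show ?thesis using y by blast
qed

definition linear_form :: form where
  "linear_form = [(1, [1]), (- 1, [7]), (1, [8]), (- 1, [4])]"

definition cubic_form :: form where
  "cubic_form = [(1, [1, 28, 18]), (-1, [7, 21, 11])]"

lemma linear_eq_form: "linear_eq y = eval_form linear_form (coords y)"
  by (simp add: linear_eq_def eval_form_def linear_form_def coords_def lab_def labels_def)

lemma cubic_eq_form: "cubic_eq y = eval_form cubic_form (coords y)"
  by (simp add: cubic_eq_def eval_form_def cubic_form_def coords_def lab_def labels_def)

lemma G_orbit_self: "F \<in> G_orbit F"
  unfolding G_orbit_def using G.one G_acts.one by (metis (mono_tags, lifting) id_apply mem_Collect_eq)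

lemma cone_base:
  assumes "y \<in> equation_cone"
  shows "eval_form linear_form (coords y) = 0" "eval_form cubic_form (coords y) = 0"
  using assms G_orbit_self by (auto simp: equation_cone_def simp flip: linear_eq_form cubic_eq_form)

text \<open>
  The words are chosen such that each resulting linear relation contains exactly one coordinate that
  does not occur in the earlier ones or in the ten coordinates from which the chart is built.
\<close>
definition linear_words :: "nat list list" where
  "linear_words =
   [[0], [3], [1, 0], [],
    [2], [5, 2, 3, 1, 2, 5, 0], [2, 3, 0, 1, 2, 5, 2], [1, 2, 5, 2, 0],
    [0, 1, 2, 5, 0], [3, 2, 5, 2], [3, 1, 2, 5], [3, 2, 5, 3, 0],
    [3, 2, 5, 1, 0], [3, 2, 5, 0], [5, 3], [5, 2, 0],
    [3, 2, 5], [0, 1, 2, 5, 2], [2, 5, 3], [2, 5, 0],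
    [5], [5, 0], [5, 1, 0], [2, 5, 2],
    [2, 5], [2, 5, 1, 0], [1, 2, 5, 0], [1, 2, 5, 3],
    [0, 1, 2, 5], [4, 3, 2, 5]]"

text \<open>
  The words lead to the \<open>36\<close> cubic relations with the coordinate \<open>0\<close>: first the \<open>18\<close> relations for
  \<open>p\<close>, ordered by permutations of \<open>{1,2,3}\<close> and a further index, then those for \<open>q\<close>.
\<close>
definition cubic_words :: "nat list list" where
  "cubic_words =
   [[1, 2], [3, 4, 2, 0], [5, 4, 0, 1, 2], [4, 2],
    [3, 0, 1, 2], [2, 5, 3, 4, 1], [3, 4, 3, 0, 1, 2], [4, 1, 2, 0],
    [3, 2], [5, 4, 2], [0, 1, 2, 0], [3, 4, 1, 2],
    [2, 3, 4, 0, 1, 0], [4, 3, 1, 2], [2, 0], [5, 1, 2],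
    [3, 4, 3, 2], [4, 0, 1, 2], [4, 1, 2], [5, 3, 4, 2],
    [5, 0, 1, 2], [2], [4, 3, 0, 1, 2], [2, 3, 4, 1, 0],
    [3, 4, 0, 1, 2], [1, 2, 0], [4, 3, 2], [5, 2],
    [4, 0, 1, 2, 0], [3, 4, 3, 1, 2], [2, 5, 3, 4, 0, 1], [3, 1, 2],
    [4, 2, 0], [5, 4, 1, 2], [3, 4, 2], [0, 1, 2]]"

definition linear_forms :: "form list" where
  "linear_forms =
   [[(1, [1]), (1, [6]), (-1, [5]), (1, [9])],
    [(-1, [2]), (-1, [7]), (-1, [9]), (1, [5])],
    [(-1, [4]), (-1, [3]), (1, [2]), (1, [9])],
    [(1, [1]), (-1, [7]), (1, [8]), (-1, [4])],
    [(-1, [0]), (1, [5]), (-1, [6]), (-1, [4])],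
    [(-1, [38]), (1, [8]), (1, [35]), (1, [3])],
    [(1, [6]), (-1, [36]), (-1, [17]), (1, [26])],
    [(-1, [4]), (1, [30]), (-1, [36]), (-1, [15])],
    [(-1, [27]), (1, [29]), (-1, [35]), (-1, [15])],
    [(-1, [2]), (-1, [29]), (1, [30]), (1, [28])],
    [(-1, [17]), (-1, [35]), (1, [24]), (1, [28])],
    [(-1, [13]), (-1, [30]), (-1, [28]), (1, [26])],
    [(1, [28]), (1, [15]), (1, [13]), (-1, [20])],
    [(1, [11]), (-1, [30]), (1, [29]), (-1, [20])],
    [(1, [11]), (1, [39]), (1, [27]), (-1, [17])],
    [(-1, [0]), (1, [33]), (-1, [39]), (-1, [27])],
    [(1, [11]), (1, [37]), (-1, [26]), (1, [28])],
    [(1, [9]), (1, [35]), (-1, [29]), (1, [21])],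
    [(-1, [13]), (-1, [38]), (-1, [21]), (1, [23])],
    [(-1, [10]), (1, [24]), (-1, [23]), (1, [21])],
    [(-1, [10]), (1, [39]), (-1, [33]), (1, [16])],
    [(-1, [10]), (-1, [18]), (1, [17]), (-1, [27])],
    [(1, [16]), (1, [12]), (-1, [11]), (-1, [27])],
    [(1, [1]), (1, [23]), (-1, [24]), (-1, [22])],
    [(-1, [10]), (-1, [38]), (1, [32]), (-1, [22])],
    [(-1, [22]), (-1, [14]), (1, [13]), (1, [21])],
    [(1, [16]), (-1, [26]), (1, [25]), (-1, [15])],
    [(1, [19]), (1, [36]), (1, [15]), (-1, [25])],
    [(-1, [27]), (-1, [31]), (1, [37]), (1, [21])],
    [(-1, [12]), (-1, [31]), (1, [25]), (-1, [34])]]"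

definition cubic_forms :: "form list" where
  "cubic_forms =
   [[(-1, [0, 31, 26]), (1, [2, 27, 19])],
    [(-1, [0, 31, 26]), (1, [7, 17, 15])],
    [(-1, [0, 26, 31]), (1, [12, 4, 28])],
    [(-1, [0, 35, 23]), (1, [6, 27, 14])],
    [(-1, [0, 35, 23]), (1, [1, 17, 34])],
    [(-1, [23, 35, 0]), (1, [21, 12, 8])],
    [(-1, [0, 23, 30]), (1, [2, 18, 22])],
    [(-1, [0, 23, 30]), (1, [7, 10, 20])],
    [(-1, [0, 23, 30]), (1, [4, 33, 13])],
    [(-1, [0, 31, 38]), (1, [18, 9, 14])],
    [(-1, [0, 38, 31]), (1, [5, 10, 34])],
    [(-1, [0, 38, 31]), (1, [3, 33, 21])],
    [(-1, [6, 11, 22]), (1, [0, 26, 38])],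
    [(-1, [0, 26, 38]), (1, [1, 39, 20])],
    [(-1, [0, 26, 38]), (1, [8, 16, 13])],
    [(-1, [0, 35, 30]), (1, [11, 9, 19])],
    [(-1, [0, 30, 35]), (1, [5, 39, 15])],
    [(-1, [0, 30, 35]), (1, [3, 16, 28])],
    [(-1, [0, 37, 25]), (1, [3, 27, 20])],
    [(-1, [0, 25, 37]), (1, [18, 8, 15])],
    [(-1, [0, 25, 37]), (1, [11, 4, 34])],
    [(-1, [0, 29, 24]), (1, [5, 27, 13])],
    [(-1, [0, 29, 24]), (1, [1, 18, 28])],
    [(-1, [7, 11, 21]), (1, [0, 29, 24])],
    [(-1, [0, 24, 36]), (1, [3, 17, 22])],
    [(-1, [0, 24, 36]), (1, [8, 10, 19])],
    [(-1, [0, 24, 36]), (1, [4, 39, 14])],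
    [(-1, [0, 37, 32]), (1, [17, 9, 13])],
    [(-1, [0, 32, 37]), (1, [6, 10, 28])],
    [(-1, [0, 32, 37]), (1, [2, 39, 21])],
    [(-1, [32, 25, 0]), (1, [22, 12, 5])],
    [(-1, [0, 25, 32]), (1, [1, 33, 19])],
    [(-1, [0, 25, 32]), (1, [7, 16, 14])],
    [(-1, [0, 29, 36]), (1, [12, 9, 20])],
    [(-1, [0, 36, 29]), (1, [6, 33, 15])],
    [(-1, [0, 36, 29]), (1, [2, 16, 34])]]"

lemma linear_forms_orbit: "map (\<lambda>w. foldr act_form w linear_form) linear_words = linear_forms"
  by (simp add: linear_words_def linear_forms_def linear_form_def act_form_def perm_def label_perms_def)

lemma cubic_forms_orbit: "map (\<lambda>w. foldr act_form w cubic_form) cubic_words = cubic_forms"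
  by (simp add: cubic_words_def cubic_forms_def cubic_form_def act_form_def perm_def label_perms_def)

lemma cone_linear_forms:
  assumes "y \<in> equation_cone"
  shows "list_all (\<lambda>r. eval_form r (coords y) = 0) linear_forms"
  unfolding list_all_iff
proof
  fix r assume "r \<in> set linear_forms"
  then obtain w where w: "w \<in> set linear_words" "r = foldr act_form w linear_form"
    by (auto simp flip: linear_forms_orbit)
  have "\<forall>w\<in>set linear_words. set w \<subseteq> {..<6}" by (simp add: linear_words_def)
  with w show "eval_form r (coords y) = 0"
    using cone_orbit_forms[OF _ _ cone_base(1) assms, of w] by (simp add: linear_form_def)
qed

lemma cone_cubic_forms:
  assumes "y \<in> equation_cone"
  shows "list_all (\<lambda>r. eval_form r (coords y) = 0) cubic_forms"
  unfolding list_all_iff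
proof
  fix r assume "r \<in> set cubic_forms"
  then obtain w where w: "w \<in> set cubic_words" "r = foldr act_form w cubic_form"
    by (auto simp flip: cubic_forms_orbit)
  have "\<forall>w\<in>set cubic_words. set w \<subseteq> {..<6}" by (simp add: cubic_words_def)
  with w show "eval_form r (coords y) = 0"
    using cone_orbit_forms[OF _ _ cone_base(2) assms, of w] by (simp add: cubic_form_def)
qed

section \<open>The toric fourfold and its closure\<close>

type_synonym trihedral_coords = "(complex^3) \<times> (complex^3) \<times> (complex^3) \<times> (complex^3)"

definition coord_sum :: "complex^3 \<Rightarrow> complex" where
  "coord_sum p = (\<Sum>i\<in>UNIV. p $ i)"

definition coord_prod :: "complex^3 \<Rightarrow> complex" where
  "coord_prod p = (\<Prod>i\<in>UNIV. p $ i)"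

definition cofactors :: "complex^3 \<Rightarrow> complex^3" where
  "cofactors p = (\<chi> i. \<Prod>j\<in>UNIV - {i}. p $ j)"

text \<open>
  The value at \<open>(p, q)\<close>, scaled by \<open>c\<close>, of the parametrisation by the fourfold \<open>\<Prod>p = \<Prod>q\<close>, written in
  the coordinates \<open>(p, q, A, B)\<close> of the chart.
\<close>
definition toric :: "complex \<Rightarrow> complex^3 \<Rightarrow> complex^3 \<Rightarrow> trihedral_coords" where
  "toric c p q =
    ((c * (coord_sum (cofactors p) - coord_sum (cofactors q))) *s p,
     (c * (coord_sum (cofactors p) - coord_sum (cofactors q))) *s q,
     (c * (coord_sum p - coord_sum q)) *s cofactors p,
     (c * (coord_sum p - coord_sum q)) *s cofactors q)"

definition toric_closure :: "trihedral_coords set" where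
  "toric_closure = closure {toric c p q | c p q. c \<noteq> 0 \<and> coord_prod p = coord_prod q \<and> coord_prod p \<noteq> 0}"

lemma UNIV_distinct: "distinct [i, j, k :: 3] \<Longrightarrow> UNIV = {i, j, k}"
  by (rule sym, rule card_subset_eq) auto

lemma distinct_extend2: "i \<noteq> (j::3) \<Longrightarrow> \<exists>k. distinct [i, j, k]"
proof -
  assume "i \<noteq> j"
  have "card {i, j} < card (UNIV :: 3 set)" by (rule le_less_trans[OF card_insert_le_m1]) auto
  then obtain k where "k \<notin> {i, j}" by (metis UNIV_eq_I less_irrefl)
  with \<open>i \<noteq> j\<close> show ?thesis by auto
qed

lemma distinct_extend1: "\<exists>j k. distinct [i::3, j, k]"
proof -
  have "card {i} < card (UNIV :: 3 set)" by simp
  then obtain j where "j \<notin> {i}" by (metis UNIV_eq_I less_irrefl)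
  then show ?thesis using distinct_extend2[of i j] by auto
qed

lemma coord_sum_distinct: "distinct [i, j, k] \<Longrightarrow> coord_sum p = p $ i + p $ j + p $ k"
  by (simp add: coord_sum_def UNIV_distinct add.assoc)

lemma coord_prod_distinct: "distinct [i, j, k] \<Longrightarrow> coord_prod p = p $ i * p $ j * p $ k"
  by (simp add: coord_prod_def UNIV_distinct mult.assoc)

lemma cofactors_distinct: "distinct [i, j, k] \<Longrightarrow> cofactors p $ i = p $ j * p $ k"
proof -
  assume d: "distinct [i, j, k]"
  then have "UNIV - {i} = {j, k}" using UNIV_distinct[OF d] by auto
  then show ?thesis using d by (simp add: cofactors_def)
qed

lemma cofactors_mult: "p $ i * cofactors p $ i = coord_prod p"
proof -
  obtain j k where "distinct [i,j,k]" using distinct_extend1 by blast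
  then show ?thesis by (simp add: cofactors_distinct[of i j k] coord_prod_distinct[of i j k])
qed

text \<open>
  Finitely many exceptional parameters on a complex line do not matter for the closure.
\<close>
lemma closure_of_cofinite:
  fixes f :: "complex \<Rightarrow> 'b::topological_space"
  assumes "continuous_on UNIV f" "finite S" "\<And>t. t \<notin> S \<Longrightarrow> f t \<in> X"
  shows "f a \<in> closure X"
proof -
  have "closure (- S) = (UNIV :: complex set)"
    using assms(2) by (simp add: closure_complement empty_interior_finite)
  then have "f a \<in> f ` closure (- S)" by simp
  also have "\<dots> \<subseteq> closure X"
    using assms by (intro image_closure_subset) (auto intro: closure_subset[THEN subsetD] continuous_on_subset)
  finally show ?thesis .
qed

lemma in_toric_closure:
  "c \<noteq> 0 \<Longrightarrow> coord_prod p = coord_prod q \<Longrightarrow> coord_prod p \<noteq> 0 \<Longrightarrow> toric c p q \<in> toric_closure"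
  unfolding toric_closure_def by (intro closure_subset[THEN subsetD]) blast

lemma toric_closure_image:
  assumes "continuous_on UNIV f"
    and "\<And>c p q. c \<noteq> 0 \<Longrightarrow> coord_prod p = coord_prod q \<Longrightarrow> coord_prod p \<noteq> 0 \<Longrightarrow> f (toric c p q) \<in> toric_closure"
    and "z \<in> toric_closure"
  shows "f z \<in> toric_closure"
proof -
  have "f ` toric_closure \<subseteq> toric_closure"
    unfolding toric_closure_def
    by (rule image_closure_subset) (use assms in \<open>auto simp: toric_closure_def intro: continuous_on_subset\<close>)
  then show ?thesis using assms(3) by blast
qed

lemma toric_closure_swap_pq:
  assumes "(p, q, A, B) \<in> toric_closure"
  shows "(q, p, B, A) \<in> toric_closure"
proof -
  let ?f = "\<lambda>(p, q, A, B). (q, p, B, A) :: trihedral_coords"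
  have "?f (p, q, A, B) \<in> toric_closure"
  proof (rule toric_closure_image[OF _ _ assms])
    show "continuous_on UNIV ?f"
      unfolding case_prod_unfold by (intro continuous_intros)
    fix c :: complex and p q :: "complex^3"
    assume *: "c \<noteq> 0" "coord_prod p = coord_prod q" "coord_prod p \<noteq> 0"
    have "?f (toric c p q) = toric (- c) q p"
      by (simp add: toric_def vec_eq_iff algebra_simps)
    then show "?f (toric c p q) \<in> toric_closure"
      using * by (simp add: in_toric_closure)
  qed
  then show ?thesis by simp
qed

lemma cofactors_cofactors: "cofactors (cofactors p) = coord_prod p *s p"
proof (simp add: vec_eq_iff, intro allI)
  fix i :: 3
  obtain j k where d: "distinct [i,j,k]" using distinct_extend1 by blast
  then have d': "distinct [j,i,k]" "distinct [k,i,j]" by auto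
  show "cofactors (cofactors p) $ i = coord_prod p * p $ i"
    unfolding cofactors_distinct[OF d] cofactors_distinct[OF d'(1)] cofactors_distinct[OF d'(2)] coord_prod_distinct[OF d]
    by simp
qed

lemma coord_sum_scale: "coord_sum (c *s p) = c * coord_sum p"
  by (simp add: coord_sum_def sum_distrib_left)

lemma coord_prod_cofactors: "coord_prod (cofactors p) = coord_prod p ^ 2"
proof -
  have d: "distinct [1,2,3::3]" "distinct [2,1,3::3]" "distinct [3,1,2::3]" by simp_all
  show ?thesis
    unfolding coord_prod_distinct[OF d(1)] cofactors_distinct[OF d(1)] cofactors_distinct[OF d(2)] cofactors_distinct[OF d(3)]
    by (simp add: power2_eq_square)
qed

text \<open>
  The involution of the fourfold that replaces each vector by its pairwise products is inverse to
  itself up to scaling; it exchanges \<open>Q\<close> with \<open>\<delta>\<close>, and hence the two halves of the parametrisation.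
\<close>
lemma toric_closure_swap_pA:
  assumes "(p, q, A, B) \<in> toric_closure"
  shows "(A, B, p, q) \<in> toric_closure"
proof -
  let ?f = "\<lambda>(p, q, A, B). (A, B, p, q) :: trihedral_coords"
  have "?f (p, q, A, B) \<in> toric_closure"
  proof (rule toric_closure_image[OF _ _ assms])
    show "continuous_on UNIV ?f"
      unfolding case_prod_unfold by (intro continuous_intros)
    fix c :: complex and p q :: "complex^3"
    assume *: "c \<noteq> 0" "coord_prod p = coord_prod q" "coord_prod p \<noteq> 0"
    have "?f (toric c p q) = toric (c / coord_prod p) (cofactors p) (cofactors q)"
      using * by (simp add: toric_def cofactors_cofactors coord_sum_scale flip: right_diff_distrib)
    then show "?f (toric c p q) \<in> toric_closure"
      using * by (simp add: in_toric_closure coord_prod_cofactors)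
  qed
  then show ?thesis by simp
qed

lemma continuous_cofactors: "continuous_on S f \<Longrightarrow> continuous_on S (\<lambda>x. cofactors (f x))"
  unfolding cofactors_def by (intro continuous_intros)

lemma continuous_coord_sum: "continuous_on S f \<Longrightarrow> continuous_on S (\<lambda>x. coord_sum (f x))"
  unfolding coord_sum_def by (intro continuous_intros)

lemma continuous_scale:
  fixes f :: "_ \<Rightarrow> complex^'n"
  shows "continuous_on S g \<Longrightarrow> continuous_on S f \<Longrightarrow> continuous_on S (\<lambda>x. g x *s f x)"
  unfolding vector_scalar_mult_def by (intro continuous_intros)

lemma continuous_toric:
  "continuous_on S p \<Longrightarrow> continuous_on S q \<Longrightarrow> continuous_on S (\<lambda>x. toric c (p x) (q x))"
  unfolding toric_def by (intro continuous_intros continuous_scale continuous_coord_sum continuous_cofactors)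

text \<open>
  The fourfold is the image of \<open>3 \<times> 3\<close> matrices under row and column products. Even a point with
  vanishing products is of this form, and adding \<open>t\<close> to all matrix entries makes the products nonzero.
\<close>
lemma toric_in_closure:
  assumes c: "c \<noteq> 0" and eq: "coord_prod p = coord_prod q"
  shows "toric c p q \<in> toric_closure"
proof (cases "coord_prod p = 0")
  case False then show ?thesis using assms by (intro in_toric_closure)
next
  case True
  have "\<exists>i. p $ i = 0" "\<exists>j. q $ j = 0"
    using True eq unfolding coord_prod_def by (metis finite prod_zero_iff)+
  then obtain i j where i: "p $ i = 0" and j: "q $ j = 0" by blast
  \<comment> \<open>a zero at \<open>(i, j)\<close>, the remaining entries of \<open>q\<close> in its row and of \<open>p\<close> in its column, ones elsewhere\<close>
  define C where "C a b = (if a = i then if b = j then 0 else q $ b else if b = j then p $ a else 1)" for a b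
  have row: "p = (\<chi> a. \<Prod>b\<in>UNIV. C a b)"
  proof (simp add: vec_eq_iff, intro allI)
    fix a show "p $ a = prod (C a) UNIV"
    proof (cases "a = i")
      case True then show ?thesis using i by (simp add: C_def prod_zero_iff) metis
    next
      case False
      then have "C a = (\<lambda>b. if b = j then p $ a else 1)" by (auto simp: C_def)
      then show ?thesis by simp
    qed
  qed
  have col: "q = (\<chi> b. \<Prod>a\<in>UNIV. C a b)"
  proof (simp add: vec_eq_iff, intro allI)
    fix b show "q $ b = (\<Prod>a\<in>UNIV. C a b)"
    proof (cases "b = j")
      case True then show ?thesis using j by (simp add: C_def) metis
    next
      case False
      then have "(\<Prod>a\<in>UNIV. C a b) = (\<Prod>a\<in>UNIV. if a = i then q $ b else 1)"
        by (intro prod.cong refl) (simp add: C_def)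
      then show ?thesis by simp
    qed
  qed
  let ?p = "\<lambda>t. \<chi> a. \<Prod>b\<in>UNIV. C a b + t" and ?q = "\<lambda>t. \<chi> b. \<Prod>a\<in>UNIV. C a b + t"
  have "toric c (?p 0) (?q 0) \<in> closure toric_closure"
  proof (rule closure_of_cofinite[where S = "\<Union>a. range (\<lambda>b. - C a b)"])
    show "continuous_on UNIV (\<lambda>t. toric c (?p t) (?q t))"
      by (intro continuous_toric continuous_intros)
    show "finite (\<Union>a. range (\<lambda>b. - C a b))" by simp
    fix t assume t: "t \<notin> (\<Union>a. range (\<lambda>b. - C a b))"
    have "C a b + t \<noteq> 0" for a b
    proof
      assume "C a b + t = 0"
      then have "t = - C a b" by (simp add: eq_neg_iff_add_eq_0 add.commute)
      then show False using t by blast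
    qed
    moreover have "coord_prod (?p t) = coord_prod (?q t)"
      unfolding coord_prod_def by (simp, rule prod.swap)
    ultimately show "toric c (?p t) (?q t) \<in> toric_closure"
      using c by (intro in_toric_closure) (simp_all add: coord_prod_def prod_zero_iff)
  qed
  then show ?thesis using row col by (simp add: toric_closure_def)
qed

lemma toric_closure_curve:
  fixes F :: "complex \<Rightarrow> trihedral_coords" and p q :: "complex \<Rightarrow> complex^3"
  assumes F: "continuous_on UNIV F"
    and p: "\<And>t. t \<noteq> 0 \<Longrightarrow> coord_prod (p t) = coord_prod (q t)"
    and c: "\<And>t. t \<noteq> 0 \<Longrightarrow> c t \<noteq> 0 \<and> F t = toric (c t) (p t) (q t)"
  shows "F 0 \<in> toric_closure"
proof -
  have "F 0 \<in> closure toric_closure"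
    by (rule closure_of_cofinite[OF F, of "{0}"]) (use p c toric_in_closure in auto)
  then show ?thesis by (simp add: toric_closure_def)
qed

lemma continuous_axis: "continuous_on S f \<Longrightarrow> continuous_on S (\<lambda>x. axis i (f x) :: complex^3)"
  unfolding axis_def
proof (rule continuous_on_vec_lambda)
  fix j assume "continuous_on S f"
  then show "continuous_on S (\<lambda>x. if j = i then f x else 0)" by (cases "j = i") simp_all
qed

text \<open>
  Along the curve \<open>p = x e\<^sub>i + w e\<^sub>k\<close>, \<open>q = y e\<^sub>j + z e\<^sub>l\<close> the pairwise products are supported at the third
  indices and are proportional to the same function \<open>s\<close>, and so is \<open>Q\<close>. Dividing by \<open>s\<close> gives a limit
  in which \<open>A\<close> and \<open>B\<close> survive although the pairwise products of \<open>p\<close> and \<open>q\<close> vanish.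
\<close>
lemma toric_closure_boundary:
  fixes x w y z s :: "complex \<Rightarrow> complex"
  assumes cont: "continuous_on UNIV x" "continuous_on UNIV w" "continuous_on UNIV y" "continuous_on UNIV z"
    and prods: "\<And>t. x t * w t = s t * a" "\<And>t. y t * z t = s t * b" "\<And>t. t \<noteq> 0 \<Longrightarrow> s t \<noteq> 0"
    and zero: "w 0 = 0" "z 0 = 0" and \<delta>: "x 0 - y 0 = \<delta>" "a - b = \<delta>" "\<delta> \<noteq> 0"
    and i: "distinct [i, i', k]" and j: "distinct [j, j', l]"
  shows "(axis i (x 0), axis j (y 0), axis i' a, axis j' b) \<in> toric_closure"
proof -
  define p where "p t = axis i (x t) + axis k (w t)" for t
  define q where "q t = axis j (y t) + axis l (z t)" for t
  define F where "F t = (p t, q t, ((x t + w t - y t - z t) / \<delta>) *s axis i' a, ((x t + w t - y t - z t) / \<delta>) *s axis j' b)" for t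
  have tp: "coord_sum (p t) = x t + w t" and cp: "cofactors (p t) = s t *s axis i' a" and np: "coord_prod (p t) = 0" for t
  proof -
    have perms: "distinct [i', i, k]" "distinct [k, i, i']" using i by auto
    show "coord_sum (p t) = x t + w t" "coord_prod (p t) = 0"
      using i by (auto simp: coord_sum_distinct[OF i] coord_prod_distinct[OF i] p_def axis_def)
    show "cofactors (p t) = s t *s axis i' a"
      unfolding vec_eq_iff
    proof
      fix m
      have "m \<in> {i, i', k}" using UNIV_distinct[OF i] by auto
      then show "cofactors (p t) $ m = (s t *s axis i' a) $ m"
        using i prods(1)[of t]
        by (auto simp: cofactors_distinct[OF i] cofactors_distinct[OF perms(1)] cofactors_distinct[OF perms(2)] p_def axis_def)
    qed
  qed
  have tq: "coord_sum (q t) = y t + z t" and cq: "cofactors (q t) = s t *s axis j' b" and nq: "coord_prod (q t) = 0" for t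
  proof -
    have perms: "distinct [j', j, l]" "distinct [l, j, j']" using j by auto
    show "coord_sum (q t) = y t + z t" "coord_prod (q t) = 0"
      using j by (auto simp: coord_sum_distinct[OF j] coord_prod_distinct[OF j] q_def axis_def)
    show "cofactors (q t) = s t *s axis j' b"
      unfolding vec_eq_iff
    proof
      fix m
      have "m \<in> {j, j', l}" using UNIV_distinct[OF j] by auto
      then show "cofactors (q t) $ m = (s t *s axis j' b) $ m"
        using j prods(2)[of t]
        by (auto simp: cofactors_distinct[OF j] cofactors_distinct[OF perms(1)] cofactors_distinct[OF perms(2)] q_def axis_def)
    qed
  qed
  have coord_sum_axis: "coord_sum (axis m c) = c" for m c
    by (simp add: coord_sum_def axis_def)
  have "F 0 \<in> toric_closure"
  proof (rule toric_closure_curve[where p = p and q = q and c = "\<lambda>t. 1 / (s t * \<delta>)"])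
    show "continuous_on UNIV F"
      unfolding F_def p_def q_def
      by (intro continuous_intros continuous_scale continuous_axis cont) (use \<delta> in auto)
    fix t :: complex assume t: "t \<noteq> 0"
    show "coord_prod (p t) = coord_prod (q t)" by (simp add: np nq)
    have "s t * a - s t * b = s t * \<delta>" using \<delta> by (simp flip: right_diff_distrib)
    then have "toric (1 / (s t * \<delta>)) (p t) (q t) = F t"
      using prods(3)[OF t] \<delta>(3)
      by (simp add: toric_def F_def tp tq cp cq coord_sum_scale coord_sum_axis vector_smult_assoc)
    then show "1 / (s t * \<delta>) \<noteq> 0 \<and> F t = toric (1 / (s t * \<delta>)) (p t) (q t)"
      using prods(3)[OF t] \<delta>(3) by simp
  qed
  moreover have "F 0 = (axis i (x 0), axis j (y 0), axis i' a, axis j' b)"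
    using zero \<delta> by (simp add: F_def p_def q_def vec_eq_iff axis_def)
  ultimately show ?thesis by simp
qed

text \<open>
  If \<open>y \<noteq> 0\<close>, both curves are linear. If \<open>y = 0\<close>, the vector \<open>q\<close> has to tend to zero slower than its
  pairwise product, which is why a square root of the parameter appears.
\<close>
lemma toric_closure_axes:
  assumes \<delta>: "x - y = a - b" "x \<noteq> y" and "x \<noteq> 0"
    and i: "distinct [i, i', k]" and j: "distinct [j, j', l]"
  shows "(axis i x, axis j y, axis i' a, axis j' b) \<in> toric_closure"
proof (cases "y = 0")
  case False
  show ?thesis
    by (rule toric_closure_boundary[where x = "\<lambda>_. x" and y = "\<lambda>_. y" and w = "\<lambda>t. t * a / x"
          and z = "\<lambda>t. t * b / y" and s = "\<lambda>t. t" and \<delta> = "x - y", OF _ _ _ _ _ _ _ _ _ _ _ _ i j])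
      (use assms False in \<open>auto intro!: continuous_intros\<close>)
next
  case True
  show ?thesis
    unfolding True
    by (rule toric_closure_boundary[where x = "\<lambda>_. x" and y = "\<lambda>t. t" and w = "\<lambda>t. t ^ 2 * a / x"
          and z = "\<lambda>t. t * b" and s = "\<lambda>t. t ^ 2" and \<delta> = x, OF _ _ _ _ _ _ _ _ _ _ _ _ i j])
      (use assms True in \<open>auto intro!: continuous_intros simp: power2_eq_square\<close>)
qed

text \<open>
  The equations of \<open>V\<close> in the chart: each cubic relation with the coordinate \<open>\<delta> = y\<^bsub>(123,456)\<^esub>\<close> equates
  \<open>\<delta>\<close> times two coordinates with a product of one coordinate of each of the types \<open>p\<^sub>a - q\<^sub>b\<close>, \<open>A\<^sub>a - B\<^sub>b\<close>
  and \<open>\<delta> - (p\<^sub>a - q\<^sub>b) - (A\<^sub>a - B\<^sub>b)\<close>. The condition on the dot products normalises the common additive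
  constant of the four vectors.
\<close>
definition trihedral :: "complex^3 \<Rightarrow> complex^3 \<Rightarrow> complex^3 \<Rightarrow> complex^3 \<Rightarrow> bool" where
  "trihedral p q A B \<longleftrightarrow>
    coord_sum p \<noteq> coord_sum q \<and> coord_sum A - coord_sum B = coord_sum p - coord_sum q \<and>
    (\<Sum>i\<in>UNIV. p $ i * A $ i) = (\<Sum>i\<in>UNIV. q $ i * B $ i) \<and>
    (\<forall>i j k b. distinct [i, j, k] \<longrightarrow>
      (coord_sum p - coord_sum q) * (p $ j - A $ i) * (p $ k - A $ j) +
      (p $ k - q $ b) * (A $ i - B $ b) * (coord_sum p - coord_sum q - (p $ j - q $ b) - (A $ j - B $ b)) = 0) \<and>
    (\<forall>i j k a. distinct [i, j, k] \<longrightarrow>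
      (coord_sum p - coord_sum q) * (q $ j - B $ i) * (q $ k - B $ j) +
      (p $ a - q $ k) * (A $ a - B $ i) * (coord_sum p - coord_sum q - (p $ a - q $ j) - (A $ a - B $ j)) = 0)"

lemma trihedral_swap_pA:
  assumes "trihedral p q A B" shows "trihedral A B p q"
  unfolding trihedral_def
proof (intro conjI allI impI)
  note T = assms[unfolded trihedral_def]
  have \<delta>: "coord_sum A - coord_sum B = coord_sum p - coord_sum q" using T by simp
  show "coord_sum A \<noteq> coord_sum B" using T by (metis right_minus_eq)
  show "coord_sum p - coord_sum q = coord_sum A - coord_sum B" using \<delta> by simp
  show "(\<Sum>i\<in>UNIV. A $ i * p $ i) = (\<Sum>i\<in>UNIV. B $ i * q $ i)" using T by (simp add: mult.commute)
  fix i j k b :: 3 assume "distinct [i, j, k]"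
  then have d: "distinct [k, j, i]" by auto
  have "(coord_sum p - coord_sum q) * (p $ j - A $ k) * (p $ i - A $ j) +
      (p $ i - q $ b) * (A $ k - B $ b) * (coord_sum p - coord_sum q - (p $ j - q $ b) - (A $ j - B $ b)) = 0"
    using T d by blast
  then show "(coord_sum A - coord_sum B) * (A $ j - p $ i) * (A $ k - p $ j) +
      (A $ k - B $ b) * (p $ i - q $ b) * (coord_sum A - coord_sum B - (A $ j - B $ b) - (p $ j - q $ b)) = 0"
    unfolding \<delta> by algebra
  have "(coord_sum p - coord_sum q) * (q $ j - B $ k) * (q $ i - B $ j) +
      (p $ b - q $ i) * (A $ b - B $ k) * (coord_sum p - coord_sum q - (p $ b - q $ j) - (A $ b - B $ j)) = 0"
    using T d by blast
  then show "(coord_sum A - coord_sum B) * (B $ j - q $ i) * (B $ k - q $ j) +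
      (A $ b - B $ k) * (p $ b - q $ i) * (coord_sum A - coord_sum B - (A $ b - B $ j) - (p $ b - q $ j)) = 0"
    unfolding \<delta> by algebra
qed

text \<open>
  The four relations that contain a fixed coordinate \<open>\<delta> - (p\<^sub>a - q\<^sub>b) - (A\<^sub>a - B\<^sub>b)\<close> combine with the
  dot product condition.
\<close>
lemma products_equal_identity:
  fixes pa pi pk qb qj ql Aa Ai Ak Bb Bj Bl \<delta> :: complex
  assumes \<delta>: "\<delta> = pa + pi + pk - qb - qj - ql" and S: "Aa + Ai + Ak - Bb - Bj - Bl = \<delta>"
    and J: "pa * Aa + pi * Ai + pk * Ak = qb * Bb + qj * Bj + ql * Bl"
    and E1: "\<delta> * (pa - Ai) * (pk - Aa) + (pk - qb) * (Ai - Bb) * (\<delta> - (pa - qb) - (Aa - Bb)) = 0"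
    and E2: "\<delta> * (pa - Ak) * (pi - Aa) + (pi - qb) * (Ak - Bb) * (\<delta> - (pa - qb) - (Aa - Bb)) = 0"
    and E3: "\<delta> * (qb - Bj) * (ql - Bb) + (pa - ql) * (Aa - Bj) * (\<delta> - (pa - qb) - (Aa - Bb)) = 0"
    and E4: "\<delta> * (qb - Bl) * (qj - Bb) + (pa - qj) * (Aa - Bl) * (\<delta> - (pa - qb) - (Aa - Bb)) = 0"
  shows "\<delta> * (pa * Aa - qb * Bb) = 0"
proof -
  have Bl: "Bl = Aa + Ai + Ak - Bb - Bj - \<delta>" using S by (simp add: algebra_simps)
  \<comment> \<open>the coefficient of the dot product relation is \<open>\<delta>\<close> minus the common coordinate\<close>
  have "2 * (\<delta> * (pa * Aa - qb * Bb)) =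
    (pa + Aa - qb - Bb) * (pa * Aa + pi * Ai + pk * Ak - (qb * Bb + qj * Bj + ql * Bl))
    - (\<delta> * (pa - Ai) * (pk - Aa) + (pk - qb) * (Ai - Bb) * (\<delta> - (pa - qb) - (Aa - Bb)))
    - (\<delta> * (pa - Ak) * (pi - Aa) + (pi - qb) * (Ak - Bb) * (\<delta> - (pa - qb) - (Aa - Bb)))
    + (\<delta> * (qb - Bj) * (ql - Bb) + (pa - ql) * (Aa - Bj) * (\<delta> - (pa - qb) - (Aa - Bb)))
    + (\<delta> * (qb - Bl) * (qj - Bb) + (pa - qj) * (Aa - Bl) * (\<delta> - (pa - qb) - (Aa - Bb)))"
    unfolding Bl \<delta> by algebra
  then show ?thesis using E1 E2 E3 E4 J by simp
qed

text \<open>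
  The four relations that contain a fixed coordinate \<open>A\<^sub>a - B\<^sub>b\<close>, once all products \<open>p\<^sub>i A\<^sub>i\<close> and \<open>q\<^sub>j B\<^sub>j\<close>
  are known to agree.
\<close>
lemma cofactor_identity:
  fixes pa pi pk qb qj ql Aa Ai Ak Bb Bj Bl \<delta> Q r :: complex
  assumes \<delta>: "\<delta> = pa + pi + pk - qb - qj - ql" and S: "Aa + Ai + Ak - Bb - Bj - Bl = \<delta>"
    and Q: "Q = pi * pk + pa * pk + pa * pi - qj * ql - qb * ql - qb * qj"
    and r: "pa * Aa = r" "pi * Ai = r" "pk * Ak = r" "qb * Bb = r" "qj * Bj = r" "ql * Bl = r"
    and E1: "\<delta> * (pi - Aa) * (pk - Ai) + (pk - qb) * (Aa - Bb) * (\<delta> - (pi - qb) - (Ai - Bb)) = 0"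
    and E2: "\<delta> * (pk - Aa) * (pi - Ak) + (pi - qb) * (Aa - Bb) * (\<delta> - (pk - qb) - (Ak - Bb)) = 0"
    and E3: "\<delta> * (qj - Bb) * (ql - Bj) + (pa - ql) * (Aa - Bb) * (\<delta> - (pa - qj) - (Aa - Bj)) = 0"
    and E4: "\<delta> * (ql - Bb) * (qj - Bl) + (pa - qj) * (Aa - Bb) * (\<delta> - (pa - ql) - (Aa - Bl)) = 0"
  shows "Q * (Aa - Bb) = \<delta> * (pi * pk - qj * ql)"
proof -
  have Bl: "Bl = Aa + Ai + Ak - Bb - Bj - \<delta>" using S by (simp add: algebra_simps)
  have "2 * (Q * (Aa - Bb) - \<delta> * (pi * pk - qj * ql)) =
    (\<delta> - (Aa - Bb)) * ((pa * Aa - pi * Ai) + (pa * Aa - pk * Ak) - (pa * Aa - qj * Bj) - (pa * Aa - ql * Bl))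
    + (\<delta> + (Aa - Bb)) * (pa * Aa - qb * Bb)
    - (\<delta> * (pi - Aa) * (pk - Ai) + (pk - qb) * (Aa - Bb) * (\<delta> - (pi - qb) - (Ai - Bb)))
    - (\<delta> * (pk - Aa) * (pi - Ak) + (pi - qb) * (Aa - Bb) * (\<delta> - (pk - qb) - (Ak - Bb)))
    + (\<delta> * (qj - Bb) * (ql - Bj) + (pa - ql) * (Aa - Bb) * (\<delta> - (pa - qj) - (Aa - Bj)))
    + (\<delta> * (ql - Bb) * (qj - Bl) + (pa - qj) * (Aa - Bb) * (\<delta> - (pa - ql) - (Aa - Bl)))"
    unfolding Bl \<delta> Q by algebra
  then show ?thesis using E1 E2 E3 E4 r by simp
qed

context
  fixes p q A B :: "complex^3"
  assumes T: "trihedral p q A B"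
begin

lemma trihedral_coord_sums: "coord_sum p - coord_sum q \<noteq> 0" "coord_sum A - coord_sum B = coord_sum p - coord_sum q"
  using T by (simp_all add: trihedral_def)

lemma trihedral_dot: "(\<Sum>i\<in>UNIV. p $ i * A $ i) = (\<Sum>i\<in>UNIV. q $ i * B $ i)"
  using T unfolding trihedral_def by blast

lemma trihedral_p:
  "distinct [i, j, k] \<Longrightarrow> (coord_sum p - coord_sum q) * (p $ j - A $ i) * (p $ k - A $ j) +
    (p $ k - q $ b) * (A $ i - B $ b) * (coord_sum p - coord_sum q - (p $ j - q $ b) - (A $ j - B $ b)) = 0"
  using T unfolding trihedral_def by blast

lemma trihedral_q:
  "distinct [i, j, k] \<Longrightarrow> (coord_sum p - coord_sum q) * (q $ j - B $ i) * (q $ k - B $ j) +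
    (p $ a - q $ k) * (A $ a - B $ i) * (coord_sum p - coord_sum q - (p $ a - q $ j) - (A $ a - B $ j)) = 0"
  using T unfolding trihedral_def by blast

lemma trihedral_products: "p $ a * A $ a = q $ b * B $ b"
proof -
  obtain i k where a: "distinct [a, i, k]" using distinct_extend1 by blast
  obtain j l where b: "distinct [b, j, l]" using distinct_extend1 by blast
  have perms: "distinct [i, a, k]" "distinct [k, a, i]" "distinct [j, b, l]" "distinct [l, b, j]"
    using a b by auto
  have sum_a: "(\<Sum>i\<in>UNIV. f i) = f a + f i + f k" for f :: "3 \<Rightarrow> complex"
    using a by (simp add: UNIV_distinct[OF a])
  have sum_b: "(\<Sum>i\<in>UNIV. f i) = f b + f j + f l" for f :: "3 \<Rightarrow> complex"
    using b by (simp add: UNIV_distinct[OF b])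
  let ?\<delta> = "coord_sum p - coord_sum q"
  have "?\<delta> * (p $ a * A $ a - q $ b * B $ b) = 0"
  proof (rule products_equal_identity)
    show "?\<delta> = p $ a + p $ i + p $ k - q $ b - q $ j - q $ l"
      using coord_sum_distinct[OF a, of p] coord_sum_distinct[OF b, of q] by simp
    show "A $ a + A $ i + A $ k - B $ b - B $ j - B $ l = ?\<delta>"
      using trihedral_coord_sums(2) unfolding coord_sum_distinct[OF a, of A] coord_sum_distinct[OF b, of B] by (simp only: diff_diff_eq)
    show "p $ a * A $ a + p $ i * A $ i + p $ k * A $ k = q $ b * B $ b + q $ j * B $ j + q $ l * B $ l"
      using trihedral_dot unfolding sum_a[of "\<lambda>i. p $ i * A $ i"] sum_b[of "\<lambda>i. q $ i * B $ i"] .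
  qed (rule trihedral_p perms trihedral_q)+
  then show ?thesis using trihedral_coord_sums by simp
qed

lemma trihedral_cofactors:
  "(coord_sum (cofactors p) - coord_sum (cofactors q)) * (A $ a - B $ b) = (coord_sum p - coord_sum q) * (cofactors p $ a - cofactors q $ b)"
proof -
  obtain i k where a: "distinct [a, i, k]" using distinct_extend1 by blast
  obtain j l where b: "distinct [b, j, l]" using distinct_extend1 by blast
  have perms: "distinct [a, k, i]" "distinct [b, l, j]" "distinct [i, a, k]" "distinct [k, a, i]"
    "distinct [j, b, l]" "distinct [l, b, j]"
    using a b by auto
  show ?thesis
    unfolding cofactors_distinct[OF a] cofactors_distinct[OF b]
  proof (rule cofactor_identity)
    show "coord_sum p - coord_sum q = p $ a + p $ i + p $ k - q $ b - q $ j - q $ l"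
      using coord_sum_distinct[OF a, of p] coord_sum_distinct[OF b, of q] by simp
    show "A $ a + A $ i + A $ k - B $ b - B $ j - B $ l = coord_sum p - coord_sum q"
      using trihedral_coord_sums(2) unfolding coord_sum_distinct[OF a, of A] coord_sum_distinct[OF b, of B] by (simp only: diff_diff_eq)
    show "coord_sum (cofactors p) - coord_sum (cofactors q) =
      p $ i * p $ k + p $ a * p $ k + p $ a * p $ i - q $ j * q $ l - q $ b * q $ l - q $ b * q $ j"
    proof -
      have "coord_sum (cofactors p) = p $ i * p $ k + p $ a * p $ k + p $ a * p $ i"
        using coord_sum_distinct[OF a, of "cofactors p"]
        by (simp add: cofactors_distinct[OF a] cofactors_distinct[OF perms(3)] cofactors_distinct[OF perms(4)])
      moreover have "coord_sum (cofactors q) = q $ j * q $ l + q $ b * q $ l + q $ b * q $ j"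
        using coord_sum_distinct[OF b, of "cofactors q"]
        by (simp add: cofactors_distinct[OF b] cofactors_distinct[OF perms(5)] cofactors_distinct[OF perms(6)])
      ultimately show ?thesis by simp
    qed
    show "p $ a * A $ a = q $ b * B $ b" "p $ i * A $ i = q $ b * B $ b" "p $ k * A $ k = q $ b * B $ b"
      "q $ b * B $ b = q $ b * B $ b" "q $ j * B $ j = q $ b * B $ b" "q $ l * B $ l = q $ b * B $ b"
      using trihedral_products by metis+
  qed (rule trihedral_p a b perms trihedral_q)+
qed

text \<open>
  The previous identity separates the indices: \<open>Q A\<^sub>a - \<delta> \<pi>\<^sub>a\<close> and \<open>Q B\<^sub>b - \<delta> \<kappa>\<^sub>b\<close> are one and the same
  constant \<open>g\<close>. Multiplying by \<open>p\<^sub>a\<close> and \<open>q\<^sub>b\<close> relates it to the two full products.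
\<close>
lemma trihedral_offset:
  obtains g where
    "\<And>a. (coord_sum (cofactors p) - coord_sum (cofactors q)) * A $ a = (coord_sum p - coord_sum q) * cofactors p $ a + g"
    "\<And>b. (coord_sum (cofactors p) - coord_sum (cofactors q)) * B $ b = (coord_sum p - coord_sum q) * cofactors q $ b + g"
    "\<And>a b. g * p $ a + (coord_sum p - coord_sum q) * coord_prod p = g * q $ b + (coord_sum p - coord_sum q) * coord_prod q"
proof
  let ?Q = "coord_sum (cofactors p) - coord_sum (cofactors q)" and ?\<delta> = "coord_sum p - coord_sum q"
  let ?g = "?Q * B $ 1 - ?\<delta> * cofactors q $ 1"
  show A: "?Q * A $ a = ?\<delta> * cofactors p $ a + ?g" for a
    using trihedral_cofactors[of a 1] by algebra
  show B: "?Q * B $ b = ?\<delta> * cofactors q $ b + ?g" for b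
    using trihedral_cofactors[of 1 b] trihedral_cofactors[of 1 1] by algebra
  show "?g * p $ a + ?\<delta> * coord_prod p = ?g * q $ b + ?\<delta> * coord_prod q" for a b
  proof -
    have "?g * p $ a + ?\<delta> * coord_prod p = p $ a * (?\<delta> * cofactors p $ a + ?g)"
      by (simp add: algebra_simps flip: cofactors_mult[of p a])
    also have "\<dots> = ?Q * (p $ a * A $ a)" unfolding A[symmetric] by (simp add: mult.left_commute)
    also have "\<dots> = ?Q * (q $ b * B $ b)" by (simp add: trihedral_products[of a b])
    also have "\<dots> = q $ b * (?\<delta> * cofactors q $ b + ?g)" unfolding B[symmetric] by (simp add: mult.left_commute)
    also have "\<dots> = ?g * q $ b + ?\<delta> * coord_prod q"
      by (simp add: algebra_simps flip: cofactors_mult[of q b])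
    finally show ?thesis .
  qed
qed

text \<open>
  If the constant \<open>g\<close> vanishes, this is immediate. Otherwise \<open>p\<close> and \<open>q\<close> are constant vectors with
  entries \<open>x \<noteq> y\<close>, then so are \<open>A\<close> and \<open>B\<close> with entries \<open>-y\<close> and \<open>-x\<close>, and one cubic relation becomes
  \<open>x\<^sup>2 + x y + y\<^sup>2 = 0\<close>, so that the full products \<open>x\<^sup>3\<close> and \<open>y\<^sup>3\<close> agree.
\<close>
lemma trihedral_coord_prod: "coord_prod p = coord_prod q"
proof -
  let ?Q = "coord_sum (cofactors p) - coord_sum (cofactors q)" and ?\<delta> = "coord_sum p - coord_sum q"
  obtain g where A: "\<And>a. ?Q * A $ a = ?\<delta> * cofactors p $ a + g"
    and B: "\<And>b. ?Q * B $ b = ?\<delta> * cofactors q $ b + g"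
    and g: "\<And>a b. g * p $ a + ?\<delta> * coord_prod p = g * q $ b + ?\<delta> * coord_prod q"
    using trihedral_offset by blast
  show ?thesis
  proof (cases "g = 0")
    case True then show ?thesis using g trihedral_coord_sums by simp
  next
    case False
    have d: "distinct [1,2,3::3]" "distinct [2,1,3::3]" "distinct [3,1,2::3]" by simp_all
    define x where "x = p $ 1"
    define y where "y = q $ 1"
    have px: "p $ a = x" for a using g[of a 1] g[of 1 1] False by (metis add_right_cancel mult_left_cancel x_def)
    have qy: "q $ b = y" for b using g[of 1 b] g[of 1 1] False by (metis add_right_cancel mult_left_cancel y_def)
    have \<delta>: "?\<delta> = 3 * (x - y)" by (simp add: coord_sum_distinct[OF d(1)] px qy)
    then have xy: "x \<noteq> y" using trihedral_coord_sums by auto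
    have Q: "?Q = 3 * (x ^ 2 - y ^ 2)"
      by (simp add: coord_sum_distinct[OF d(1)] cofactors_distinct[OF d(1)] cofactors_distinct[OF d(2)]
        cofactors_distinct[OF d(3)] px qy power2_eq_square algebra_simps)
    have cof: "cofactors p $ a = x ^ 2" "cofactors q $ a = y ^ 2" for a
      using distinct_extend1[of a] by (auto simp: cofactors_distinct px qy power2_eq_square)
    have Aeq: "A $ a = A $ 1" for a
    proof (rule ccontr)
      assume *: "A $ a \<noteq> A $ 1"
      have "?Q * (A $ a - A $ 1) = 0" unfolding right_diff_distrib A cof by simp
      then have "?Q = 0" using * by simp
      moreover have "x * A $ a = x * A $ 1"
        using trihedral_products[of a 1] trihedral_products[of 1 1] unfolding px by metis
      ultimately have "x = 0" "y = 0" using * Q by auto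
      then show False using xy by simp
    qed
    have Beq: "B $ b = B $ 1" for b
    proof (rule ccontr)
      assume *: "B $ b \<noteq> B $ 1"
      have "?Q * (B $ b - B $ 1) = 0" unfolding right_diff_distrib B cof by simp
      then have "?Q = 0" using * by simp
      moreover have "y * B $ b = y * B $ 1"
        using trihedral_products[of 1 b] trihedral_products[of 1 1] unfolding qy by metis
      ultimately have "y = 0" "x = 0" using * Q by auto
      then show False using xy by simp
    qed
    have "3 * (A $ 1 - B $ 1) = 3 * (x - y)"
      using trihedral_coord_sums(2) \<delta> unfolding coord_sum_distinct[OF d(1), of A] coord_sum_distinct[OF d(1), of B]
        Aeq[of 2] Aeq[of 3] Beq[of 2] Beq[of 3] by simp
    then have "A $ 1 - B $ 1 = x - y" by (simp only: mult_cancel_left) simp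
    then have B1: "B $ 1 = A $ 1 - x + y" by algebra
    have "x * A $ 1 = y * B $ 1" using trihedral_products[of 1 1] by (simp add: px qy)
    then have "(x - y) * (A $ 1 + y) = 0" unfolding B1 by (simp add: algebra_simps)
    then have A1: "A $ 1 = - y" using xy by (simp add: eq_neg_iff_add_eq_0)
    \<comment> \<open>the relation for the indices \<open>1, 2, 3\<close> and \<open>b = 1\<close>\<close>
    have "3 * (x - y) * (x + y) * (x + y) + (x - y) * (x - y) * (3 * (x - y) - (x - y) - (x - y)) = 0"
      using trihedral_p[OF d(1), of 1] unfolding \<delta> px qy Aeq[of 2] B1 A1 by simp
    then have "4 * (x - y) * (x ^ 2 + x * y + y ^ 2) = 0" by algebra
    then have "x ^ 2 + x * y + y ^ 2 = 0" using xy by simp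
    then have "x * x * x = y * y * y" by algebra
    then show ?thesis by (simp add: coord_prod_distinct[OF d(1)] px qy)
  qed
qed

lemma trihedral_cofactors_eq:
  "(coord_sum (cofactors p) - coord_sum (cofactors q)) *s A = (coord_sum p - coord_sum q) *s cofactors p"
  "(coord_sum (cofactors p) - coord_sum (cofactors q)) *s B = (coord_sum p - coord_sum q) *s cofactors q"
proof -
  let ?Q = "coord_sum (cofactors p) - coord_sum (cofactors q)" and ?\<delta> = "coord_sum p - coord_sum q"
  obtain g where A: "\<And>a. ?Q * A $ a = ?\<delta> * cofactors p $ a + g"
    and B: "\<And>b. ?Q * B $ b = ?\<delta> * cofactors q $ b + g"
    and g: "\<And>a b. g * p $ a + ?\<delta> * coord_prod p = g * q $ b + ?\<delta> * coord_prod q"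
    using trihedral_offset by blast
  have "g = 0"
  proof (rule ccontr)
    assume "g \<noteq> 0"
    then have "p $ a = q $ a" for a using g[of a a] trihedral_coord_prod by simp
    then show False using trihedral_coord_sums(1) by (simp add: coord_sum_def)
  qed
  then show "?Q *s A = ?\<delta> *s cofactors p" "?Q *s B = ?\<delta> *s cofactors q"
    unfolding vec_eq_iff vector_smult_component using A B by (metis add.right_neutral)+
qed

lemma trihedral_generic:
  assumes "coord_sum (cofactors p) \<noteq> coord_sum (cofactors q)"
  shows "(p, q, A, B) \<in> toric_closure"
proof -
  let ?Q = "coord_sum (cofactors p) - coord_sum (cofactors q)" and ?\<delta> = "coord_sum p - coord_sum q"
  have "?Q \<noteq> 0" using assms by simp
  then have "A = (?\<delta> / ?Q) *s cofactors p" "B = (?\<delta> / ?Q) *s cofactors q"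
    using trihedral_cofactors_eq by (simp_all add: vec_eq_iff field_simps)
  then have "toric (1 / ?Q) p q = (p, q, A, B)"
    using \<open>?Q \<noteq> 0\<close> by (simp add: toric_def)
  then show ?thesis
    using toric_in_closure[OF _ trihedral_coord_prod, of "1 / ?Q"] \<open>?Q \<noteq> 0\<close> by simp
qed

end

lemma cofactors_zero_axis:
  assumes "cofactors v = 0"
  obtains i where "v = axis i (v $ i)"
proof (cases "v = 0")
  case True then show ?thesis using that[of 1] by (simp add: vec_eq_iff axis_def)
next
  case False
  then obtain i where i: "v $ i \<noteq> 0" by (auto simp: vec_eq_iff)
  have "v $ k = 0" if "k \<noteq> i" for k
  proof -
    obtain j where "distinct [i, k, j]" using distinct_extend2[of i k] \<open>k \<noteq> i\<close> by blast
    then have "distinct [j, i, k]" by auto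
    then have "v $ i * v $ k = 0" using cofactors_distinct[of j i k v] assms by simp
    then show ?thesis using i by simp
  qed
  then show ?thesis using that[of i] by (auto simp: vec_eq_iff axis_def)
qed

lemma axis_pair_distinct:
  fixes v w :: "complex^3"
  assumes v: "v = axis i (v $ i)" and w: "w = axis i' (w $ i')" and vw: "\<And>a. v $ a * w $ a = 0"
  obtains i i' where "i \<noteq> i'" "v = axis i (v $ i)" "w = axis i' (w $ i')"
proof (cases "i = i'")
  case False then show ?thesis using that v w by blast
next
  case True
  obtain k where k: "k \<noteq> i" using distinct_extend1[of i] by (metis distinct_length_2_or_more)
  show ?thesis
  proof (cases "v $ i = 0")
    case True
    then have "v = 0" using v by (simp add: vec_eq_iff axis_def)
    then have "v = axis k (v $ k)" by (simp add: vec_eq_iff axis_def)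
    then show ?thesis using that[of k i'] k w \<open>i = i'\<close> by blast
  next
    case False
    then have "w $ i' = 0" using vw[of i] \<open>i = i'\<close> by simp
    then have "w = 0" using w by (simp add: vec_eq_iff axis_def)
    then have "w = axis k (w $ k)" by (simp add: vec_eq_iff axis_def)
    then show ?thesis using that[of i k] k v by metis
  qed
qed

text \<open>
  When \<open>Q = Q' = 0\<close>, all pairwise products vanish, so each vector is supported at one index; since
  \<open>p\<^sub>a A\<^sub>a = 0\<close>, the supports of \<open>p\<close> and \<open>A\<close> can be taken at different indices, and likewise for \<open>q\<close>, \<open>B\<close>.
\<close>
theorem trihedral_in_toric_closure:
  assumes T: "trihedral p q A B"
  shows "(p, q, A, B) \<in> toric_closure"
proof (cases "coord_sum (cofactors p) \<noteq> coord_sum (cofactors q) \<or> coord_sum (cofactors A) \<noteq> coord_sum (cofactors B)")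
  case True
  then show ?thesis
  proof
    assume "coord_sum (cofactors p) \<noteq> coord_sum (cofactors q)"
    then show ?thesis by (rule trihedral_generic[OF T])
  next
    assume "coord_sum (cofactors A) \<noteq> coord_sum (cofactors B)"
    then show ?thesis by (rule toric_closure_swap_pA[OF trihedral_generic[OF trihedral_swap_pA[OF T]]])
  qed
next
  case False
  have cof: "cofactors p = 0" "cofactors q = 0"
    if "trihedral p q A B" "coord_sum (cofactors p) = coord_sum (cofactors q)" for p q A B
    using trihedral_cofactors_eq[OF that(1)] trihedral_coord_sums(1)[OF that(1)] that(2)
    by (simp_all add: vec_eq_iff)
  have zero: "cofactors p = 0" "cofactors q = 0" "cofactors A = 0" "cofactors B = 0"
    by (rule cof[OF T] cof[OF trihedral_swap_pA[OF T]]; use False in blast)+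
  obtain a where a: "p = axis a (p $ a)" using cofactors_zero_axis[OF zero(1)] .
  obtain a' where a': "A = axis a' (A $ a')" using cofactors_zero_axis[OF zero(3)] .
  obtain b where b: "q = axis b (q $ b)" using cofactors_zero_axis[OF zero(2)] .
  obtain b' where b': "B = axis b' (B $ b')" using cofactors_zero_axis[OF zero(4)] .
  obtain m where m: "m \<notin> {a, a'}"
  proof -
    have "card {a, a'} < card (UNIV :: 3 set)" by (rule le_less_trans[OF card_insert_le_m1]) auto
    then show ?thesis using that by (metis UNIV_eq_I less_irrefl)
  qed
  have "p $ m = 0" by (subst a) (use m in \<open>simp add: axis_def\<close>)
  then have prods: "p $ c * A $ c = 0" "q $ c * B $ c = 0" for c
    using trihedral_products[OF T, of c 1] trihedral_products[OF T, of m 1] trihedral_products[OF T, of m c]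
    by simp_all
  obtain i i' where i: "i \<noteq> i'" "p = axis i (p $ i)" "A = axis i' (A $ i')"
    using axis_pair_distinct[OF a a' prods(1)] .
  obtain j j' where j: "j \<noteq> j'" "q = axis j (q $ j)" "B = axis j' (B $ j')"
    using axis_pair_distinct[OF b b' prods(2)] .
  obtain k where k: "distinct [i, i', k]" using distinct_extend2[OF i(1)] by blast
  obtain l where l: "distinct [j, j', l]" using distinct_extend2[OF j(1)] by blast
  have coord_sum_axis: "coord_sum (axis m c) = c" for m c by (simp add: coord_sum_def axis_def)
  have \<delta>: "p $ i \<noteq> q $ j" "p $ i - q $ j = A $ i' - B $ j'"
  proof -
    have "coord_sum p = p $ i" "coord_sum q = q $ j" "coord_sum A = A $ i'" "coord_sum B = B $ j'"
      using arg_cong[OF i(2), of coord_sum] arg_cong[OF i(3), of coord_sum]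
        arg_cong[OF j(2), of coord_sum] arg_cong[OF j(3), of coord_sum]
      by (simp_all only: coord_sum_axis)
    then show "p $ i \<noteq> q $ j" "p $ i - q $ j = A $ i' - B $ j'"
      using trihedral_coord_sums[OF T] by simp_all
  qed
  show ?thesis
  proof (cases "p $ i = 0")
    case False
    from toric_closure_axes[OF \<delta>(2) \<delta>(1) this k l] show ?thesis
      unfolding i(2,3)[symmetric] j(2,3)[symmetric] .
  next
    case True
    then have "q $ j \<noteq> 0" using \<delta> by simp
    moreover have "q $ j - p $ i = B $ j' - A $ i'" using \<delta>(2) by (metis minus_diff_eq)
    ultimately have "(axis j (q $ j), axis i (p $ i), axis j' (B $ j'), axis i' (A $ i')) \<in> toric_closure"
      using \<delta>(1) by (intro toric_closure_axes[OF _ _ _ l k]) auto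
    from toric_closure_swap_pq[OF this] show ?thesis
      unfolding i(2,3)[symmetric] j(2,3)[symmetric] .
  qed
qed

section \<open>The chart where the coordinate of (123,456) does not vanish\<close>

text \<open>
  The general solution of the linear equations. The coordinates of type \<open>(abc,def)\<close> are the first ten;
  the order and the signs are those of the list of labels.
\<close>
definition trihedral_coordinates :: "complex^3 \<Rightarrow> complex^3 \<Rightarrow> complex^3 \<Rightarrow> complex^3 \<Rightarrow> complex list" where
  "trihedral_coordinates p q A B = (let d = coord_sum p - coord_sum q in
   [d, p$2 - q$2, - (p$3 - q$1), p$1 - q$3,
    - (p$3 - q$3), p$1 - q$2, - (p$2 - q$1), p$3 - q$2,
    - (p$2 - q$3), p$1 - q$1, - (A$2 - B$2), A$3 - B$1,
    - (A$1 - B$3), d - (p$1 - q$3) - (A$1 - B$3), - (d - (p$3 - q$1) - (A$3 - B$1)), d - (p$2 - q$2) - (A$2 - B$2),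
    A$3 - B$3, - (A$1 - B$2), A$2 - B$1, - (d - (p$2 - q$1) - (A$2 - B$1)),
    d - (p$1 - q$2) - (A$1 - B$2), - (d - (p$3 - q$3) - (A$3 - B$3)), d - (p$1 - q$1) - (A$1 - B$1), p$3 - A$1,
    q$3 - B$1, q$2 - B$1, p$2 - A$1, - (A$1 - B$1),
    - (d - (p$2 - q$3) - (A$2 - B$3)), q$2 - B$3, p$1 - A$2, p$3 - A$2,
    q$1 - B$3, A$2 - B$3, d - (p$3 - q$2) - (A$3 - B$2), p$2 - A$3,
    q$1 - B$2, q$3 - B$2, p$1 - A$3, - (A$3 - B$2)])"

lemma cone_linear_relations:
  assumes "y \<in> equation_cone"
  shows
    "coords y 1 + coords y 6 - coords y 5 + coords y 9 = 0"
    "- coords y 2 - coords y 7 - coords y 9 + coords y 5 = 0"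
    "- coords y 4 - coords y 3 + coords y 2 + coords y 9 = 0"
    "coords y 1 - coords y 7 + coords y 8 - coords y 4 = 0"
    "- coords y 0 + coords y 5 - coords y 6 - coords y 4 = 0"
    "- coords y 38 + coords y 8 + coords y 35 + coords y 3 = 0"
    "coords y 6 - coords y 36 - coords y 17 + coords y 26 = 0"
    "- coords y 4 + coords y 30 - coords y 36 - coords y 15 = 0"
    "- coords y 27 + coords y 29 - coords y 35 - coords y 15 = 0"
    "- coords y 2 - coords y 29 + coords y 30 + coords y 28 = 0"
    "- coords y 17 - coords y 35 + coords y 24 + coords y 28 = 0"
    "- coords y 13 - coords y 30 - coords y 28 + coords y 26 = 0"
    "coords y 28 + coords y 15 + coords y 13 - coords y 20 = 0"
    "coords y 11 - coords y 30 + coords y 29 - coords y 20 = 0"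
    "coords y 11 + coords y 39 + coords y 27 - coords y 17 = 0"
    "- coords y 0 + coords y 33 - coords y 39 - coords y 27 = 0"
    "coords y 11 + coords y 37 - coords y 26 + coords y 28 = 0"
    "coords y 9 + coords y 35 - coords y 29 + coords y 21 = 0"
    "- coords y 13 - coords y 38 - coords y 21 + coords y 23 = 0"
    "- coords y 10 + coords y 24 - coords y 23 + coords y 21 = 0"
    "- coords y 10 + coords y 39 - coords y 33 + coords y 16 = 0"
    "- coords y 10 - coords y 18 + coords y 17 - coords y 27 = 0"
    "coords y 16 + coords y 12 - coords y 11 - coords y 27 = 0"
    "coords y 1 + coords y 23 - coords y 24 - coords y 22 = 0"
    "- coords y 10 - coords y 38 + coords y 32 - coords y 22 = 0"
    "- coords y 22 - coords y 14 + coords y 13 + coords y 21 = 0"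
    "coords y 16 - coords y 26 + coords y 25 - coords y 15 = 0"
    "coords y 19 + coords y 36 + coords y 15 - coords y 25 = 0"
    "- coords y 27 - coords y 31 + coords y 37 + coords y 21 = 0"
    "- coords y 12 - coords y 31 + coords y 25 - coords y 34 = 0"
  using cone_linear_forms[OF assms]
  by (simp_all only: linear_forms_def list.pred_inject eval_form_def list.map sum_list.Cons sum_list.Nil
    prod_list.Cons prod_list.Nil prod.case of_int_1 of_int_minus mult_minus_left mult_1 mult_1_right add_0_right
    diff_conv_add_uminus add.assoc mult.assoc)

lemma cone_cubic_relations:
  assumes "y \<in> equation_cone"
  shows
    "- coords y 0 * coords y 31 * coords y 26 + coords y 2 * coords y 27 * coords y 19 = 0"
    "- coords y 0 * coords y 31 * coords y 26 + coords y 7 * coords y 17 * coords y 15 = 0"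
    "- coords y 0 * coords y 26 * coords y 31 + coords y 12 * coords y 4 * coords y 28 = 0"
    "- coords y 0 * coords y 35 * coords y 23 + coords y 6 * coords y 27 * coords y 14 = 0"
    "- coords y 0 * coords y 35 * coords y 23 + coords y 1 * coords y 17 * coords y 34 = 0"
    "- coords y 23 * coords y 35 * coords y 0 + coords y 21 * coords y 12 * coords y 8 = 0"
    "- coords y 0 * coords y 23 * coords y 30 + coords y 2 * coords y 18 * coords y 22 = 0"
    "- coords y 0 * coords y 23 * coords y 30 + coords y 7 * coords y 10 * coords y 20 = 0"
    "- coords y 0 * coords y 23 * coords y 30 + coords y 4 * coords y 33 * coords y 13 = 0"
    "- coords y 0 * coords y 31 * coords y 38 + coords y 18 * coords y 9 * coords y 14 = 0"
    "- coords y 0 * coords y 38 * coords y 31 + coords y 5 * coords y 10 * coords y 34 = 0"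
    "- coords y 0 * coords y 38 * coords y 31 + coords y 3 * coords y 33 * coords y 21 = 0"
    "- coords y 6 * coords y 11 * coords y 22 + coords y 0 * coords y 26 * coords y 38 = 0"
    "- coords y 0 * coords y 26 * coords y 38 + coords y 1 * coords y 39 * coords y 20 = 0"
    "- coords y 0 * coords y 26 * coords y 38 + coords y 8 * coords y 16 * coords y 13 = 0"
    "- coords y 0 * coords y 35 * coords y 30 + coords y 11 * coords y 9 * coords y 19 = 0"
    "- coords y 0 * coords y 30 * coords y 35 + coords y 5 * coords y 39 * coords y 15 = 0"
    "- coords y 0 * coords y 30 * coords y 35 + coords y 3 * coords y 16 * coords y 28 = 0"
    "- coords y 0 * coords y 37 * coords y 25 + coords y 3 * coords y 27 * coords y 20 = 0"
    "- coords y 0 * coords y 25 * coords y 37 + coords y 18 * coords y 8 * coords y 15 = 0"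
    "- coords y 0 * coords y 25 * coords y 37 + coords y 11 * coords y 4 * coords y 34 = 0"
    "- coords y 0 * coords y 29 * coords y 24 + coords y 5 * coords y 27 * coords y 13 = 0"
    "- coords y 0 * coords y 29 * coords y 24 + coords y 1 * coords y 18 * coords y 28 = 0"
    "- coords y 7 * coords y 11 * coords y 21 + coords y 0 * coords y 29 * coords y 24 = 0"
    "- coords y 0 * coords y 24 * coords y 36 + coords y 3 * coords y 17 * coords y 22 = 0"
    "- coords y 0 * coords y 24 * coords y 36 + coords y 8 * coords y 10 * coords y 19 = 0"
    "- coords y 0 * coords y 24 * coords y 36 + coords y 4 * coords y 39 * coords y 14 = 0"
    "- coords y 0 * coords y 37 * coords y 32 + coords y 17 * coords y 9 * coords y 13 = 0"
    "- coords y 0 * coords y 32 * coords y 37 + coords y 6 * coords y 10 * coords y 28 = 0"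
    "- coords y 0 * coords y 32 * coords y 37 + coords y 2 * coords y 39 * coords y 21 = 0"
    "- coords y 32 * coords y 25 * coords y 0 + coords y 22 * coords y 12 * coords y 5 = 0"
    "- coords y 0 * coords y 25 * coords y 32 + coords y 1 * coords y 33 * coords y 19 = 0"
    "- coords y 0 * coords y 25 * coords y 32 + coords y 7 * coords y 16 * coords y 14 = 0"
    "- coords y 0 * coords y 29 * coords y 36 + coords y 12 * coords y 9 * coords y 20 = 0"
    "- coords y 0 * coords y 36 * coords y 29 + coords y 6 * coords y 33 * coords y 15 = 0"
    "- coords y 0 * coords y 36 * coords y 29 + coords y 2 * coords y 16 * coords y 34 = 0"
  using cone_cubic_forms[OF assms]
  by (simp_all only: cubic_forms_def list.pred_inject eval_form_def list.map sum_list.Cons sum_list.Nil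
    prod_list.Cons prod_list.Nil prod.case of_int_1 of_int_minus mult_minus_left mult_1 mult_1_right add_0_right
    diff_conv_add_uminus add.assoc mult.assoc)

text \<open>
  Ten coordinates determine the four vectors once \<open>q\<^sub>1 = 0\<close> and the sum condition are imposed. Each
  linear relation then yields one further coordinate.
\<close>
lemma cone_trihedral_coordinates:
  assumes "y \<in> equation_cone"
  obtains p q A B where "coord_sum A - coord_sum B = coord_sum p - coord_sum q"
    and "\<forall>i<40. coords y i = trihedral_coordinates p q A B ! i"
proof -
  define Y where "Y = coords y"
  note rel = cone_linear_relations[OF assms, folded Y_def]
  define p1 p2 p3 where "p1 = Y 9" and "p2 = - Y 6" and "p3 = - Y 2"
  define q1 q2 q3 where "q1 = (0 :: complex)" and "q2 = p1 - Y 5" and "q3 = p1 - Y 3"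
  define A1 A2 A3 where "A1 = p2 - Y 26" and "A2 = p1 - Y 30" and "A3 = p1 - Y 38"
  define B1 B2 B3 where "B1 = A1 + Y 27" and "B2 = A1 + Y 17" and "B3 = A1 + A2 + A3 - B1 - B2 - (p1 + p2 + p3 - q1 - q2 - q3)"
  define d where "d = p1 + p2 + p3 - q1 - q2 - q3"
  have S: "A1 + A2 + A3 - B1 - B2 - B3 = d" by (simp add: B3_def d_def)
  have e9: "Y 9 = p1 - q1"
    by (simp add: p1_def p2_def p3_def q1_def q2_def q3_def A1_def A2_def A3_def B1_def B2_def)
  have e5: "Y 5 = p1 - q2"
    by (simp add: p1_def p2_def p3_def q1_def q2_def q3_def A1_def A2_def A3_def B1_def B2_def)
  have e3: "Y 3 = p1 - q3"
    by (simp add: p1_def p2_def p3_def q1_def q2_def q3_def A1_def A2_def A3_def B1_def B2_def)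
  have e6: "Y 6 = - (p2 - q1)"
    by (simp add: p1_def p2_def p3_def q1_def q2_def q3_def A1_def A2_def A3_def B1_def B2_def)
  have e2: "Y 2 = - (p3 - q1)"
    by (simp add: p1_def p2_def p3_def q1_def q2_def q3_def A1_def A2_def A3_def B1_def B2_def)
  have e26: "Y 26 = p2 - A1"
    by (simp add: p1_def p2_def p3_def q1_def q2_def q3_def A1_def A2_def A3_def B1_def B2_def)
  have e30: "Y 30 = p1 - A2"
    by (simp add: p1_def p2_def p3_def q1_def q2_def q3_def A1_def A2_def A3_def B1_def B2_def)
  have e38: "Y 38 = p1 - A3"
    by (simp add: p1_def p2_def p3_def q1_def q2_def q3_def A1_def A2_def A3_def B1_def B2_def)
  have e27: "Y 27 = - (A1 - B1)"
    by (simp add: p1_def p2_def p3_def q1_def q2_def q3_def A1_def A2_def A3_def B1_def B2_def)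
  have e17: "Y 17 = - (A1 - B2)"
    by (simp add: p1_def p2_def p3_def q1_def q2_def q3_def A1_def A2_def A3_def B1_def B2_def)
  have e1: "Y 1 = p2 - q2"
    using rel(1) e6 e5 e9 S d_def by algebra
  have e7: "Y 7 = p3 - q2"
    using rel(2) e2 e9 e5 S d_def by algebra
  have e4: "Y 4 = - (p3 - q3)"
    using rel(3) e3 e2 e9 S d_def by algebra
  have e8: "Y 8 = - (p2 - q3)"
    using rel(4) e1 e7 e4 S d_def by algebra
  have e0: "Y 0 = d"
    using rel(5) e5 e6 e4 S d_def by algebra
  have e35: "Y 35 = p2 - A3"
    using rel(6) e38 e8 e3 S d_def by algebra
  have e36: "Y 36 = q1 - B2"
    using rel(7) e6 e17 e26 S d_def by algebra
  have e15: "Y 15 = d - (p2 - q2) - (A2 - B2)"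
    using rel(8) e4 e30 e36 S d_def by algebra
  have e29: "Y 29 = q2 - B3"
    using rel(9) e27 e35 e15 S d_def by algebra
  have e28: "Y 28 = - (d - (p2 - q3) - (A2 - B3))"
    using rel(10) e2 e29 e30 S d_def by algebra
  have e24: "Y 24 = q3 - B1"
    using rel(11) e17 e35 e28 S d_def by algebra
  have e13: "Y 13 = d - (p1 - q3) - (A1 - B3)"
    using rel(12) e30 e28 e26 S d_def by algebra
  have e20: "Y 20 = d - (p1 - q2) - (A1 - B2)"
    using rel(13) e28 e15 e13 S d_def by algebra
  have e11: "Y 11 = A3 - B1"
    using rel(14) e30 e29 e20 S d_def by algebra
  have e39: "Y 39 = - (A3 - B2)"
    using rel(15) e11 e27 e17 S d_def by algebra
  have e33: "Y 33 = A2 - B3"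
    using rel(16) e0 e39 e27 S d_def by algebra
  have e37: "Y 37 = q3 - B2"
    using rel(17) e11 e26 e28 S d_def by algebra
  have e21: "Y 21 = - (d - (p3 - q3) - (A3 - B3))"
    using rel(18) e9 e35 e29 S d_def by algebra
  have e23: "Y 23 = p3 - A1"
    using rel(19) e13 e38 e21 S d_def by algebra
  have e10: "Y 10 = - (A2 - B2)"
    using rel(20) e24 e23 e21 S d_def by algebra
  have e16: "Y 16 = A3 - B3"
    using rel(21) e10 e39 e33 S d_def by algebra
  have e18: "Y 18 = A2 - B1"
    using rel(22) e10 e17 e27 S d_def by algebra
  have e12: "Y 12 = - (A1 - B3)"
    using rel(23) e16 e11 e27 S d_def by algebra
  have e22: "Y 22 = d - (p1 - q1) - (A1 - B1)"
    using rel(24) e1 e23 e24 S d_def by algebra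
  have e32: "Y 32 = q1 - B3"
    using rel(25) e10 e38 e22 S d_def by algebra
  have e14: "Y 14 = - (d - (p3 - q1) - (A3 - B1))"
    using rel(26) e22 e13 e21 S d_def by algebra
  have e25: "Y 25 = q2 - B1"
    using rel(27) e16 e26 e15 S d_def by algebra
  have e19: "Y 19 = - (d - (p2 - q1) - (A2 - B1))"
    using rel(28) e36 e15 e25 S d_def by algebra
  have e31: "Y 31 = p3 - A2"
    using rel(29) e27 e37 e21 S d_def by algebra
  have e34: "Y 34 = d - (p3 - q2) - (A3 - B2)"
    using rel(30) e12 e31 e25 S d_def by algebra
  let ?p = "vector [p1, p2, p3] :: complex^3" and ?q = "vector [q1, q2, q3] :: complex^3"
    and ?A = "vector [A1, A2, A3] :: complex^3" and ?B = "vector [B1, B2, B3] :: complex^3"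
  have tot: "coord_sum (vector [x1, x2, x3]) = x1 + x2 + x3" for x1 x2 x3
    by (simp add: coord_sum_distinct[of 1 2 3])
  have d: "coord_sum ?p - coord_sum ?q = d" by (simp add: tot d_def)
  have "map Y [0, 1, 2, 3, 4, 5, 6, 7, 8, 9, 10, 11, 12, 13, 14, 15, 16, 17, 18, 19, 20, 21, 22, 23, 24, 25, 26, 27, 28, 29, 30, 31, 32, 33, 34, 35, 36, 37, 38, 39] = trihedral_coordinates ?p ?q ?A ?B"
    unfolding trihedral_coordinates_def d Let_def
    by (simp add: e0 e1[unfolded One_nat_def] e2 e3 e4 e5 e6 e7 e8 e9 e10 e11 e12 e13 e14 e15 e16 e17 e18 e19 e20 e21 e22 e23 e24 e25 e26 e27 e28 e29 e30 e31 e32 e33 e34 e35 e36 e37 e38 e39)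
  moreover have "[0, 1, 2, 3, 4, 5, 6, 7, 8, 9, 10, 11, 12, 13, 14, 15, 16, 17, 18, 19, 20, 21, 22, 23, 24, 25, 26, 27, 28, 29, 30, 31, 32, 33, 34, 35, 36, 37, 38, 39] = [0..<40]" by (simp add: upt_rec)
  ultimately have "map Y [0..<40] = trihedral_coordinates ?p ?q ?A ?B" by metis
  then have "Y i = trihedral_coordinates ?p ?q ?A ?B ! i" if "i < 40" for i
    using that by (metis add_0 diff_zero nth_map_upt)
  moreover have "coord_sum ?A - coord_sum ?B = d" unfolding tot using S by (simp only: diff_diff_eq)
  then have "coord_sum ?A - coord_sum ?B = coord_sum ?p - coord_sum ?q" using d by simp
  ultimately show ?thesis using that unfolding Y_def by blast
qed

lemma trihedral_coordinates_shift:
  "trihedral_coordinates (\<chi> i. p $ i + t) (\<chi> i. q $ i + t) (\<chi> i. A $ i + t) (\<chi> i. B $ i + t) =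
    trihedral_coordinates p q A B"
proof -
  have "coord_sum (\<chi> i. v $ i + t) = coord_sum v + 3 * t" for v by (simp add: coord_sum_distinct[of 1 2 3])
  then show ?thesis by (simp add: trihedral_coordinates_def Let_def)
qed

text \<open>
  Adding \<open>t\<close> to all entries changes the difference of the dot products by \<open>2 t \<delta>\<close>.
\<close>
lemma trihedral_gauge:
  fixes p q A B :: "complex^3"
  assumes tot: "coord_sum A - coord_sum B = coord_sum p - coord_sum q" and d: "coord_sum p \<noteq> coord_sum q"
  obtains t where "(\<Sum>i\<in>UNIV. (p $ i + t) * (A $ i + t)) = (\<Sum>i\<in>UNIV. (q $ i + t) * (B $ i + t))"
proof
  let ?s = "(\<Sum>i\<in>UNIV. p $ i * A $ i) - (\<Sum>i\<in>UNIV. q $ i * B $ i)"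
  let ?d = "coord_sum p - coord_sum q"
  \<comment> \<open>the unique solution of a linear equation in \<open>t\<close>\<close>
  let ?t = "- ?s / (2 * ?d)"
  have expand: "(\<Sum>i\<in>UNIV. (v $ i + t) * (w $ i + t)) =
      (\<Sum>i\<in>UNIV. v $ i * w $ i) + t * (coord_sum v + coord_sum w) + 3 * t ^ 2" for t and v w :: "complex^3"
    by (simp add: sum_3 coord_sum_distinct[of 1 2 3] algebra_simps power2_eq_square)
  have "?t * (2 * ?d) = - ?s" using d by simp
  moreover have "coord_sum p + coord_sum A - (coord_sum q + coord_sum B) = 2 * ?d" using tot by algebra
  ultimately show "(\<Sum>i\<in>UNIV. (p $ i + ?t) * (A $ i + ?t)) = (\<Sum>i\<in>UNIV. (q $ i + ?t) * (B $ i + ?t))"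
    unfolding expand by algebra
qed

lemma trihedral_values:
  assumes "\<forall>i<40. y i = trihedral_coordinates p q A B ! i" and "coord_sum p - coord_sum q = d"
  shows
    "y 0 = d"
    "y 1 = p$2 - q$2"
    "y 2 = - (p$3 - q$1)"
    "y 3 = p$1 - q$3"
    "y 4 = - (p$3 - q$3)"
    "y 5 = p$1 - q$2"
    "y 6 = - (p$2 - q$1)"
    "y 7 = p$3 - q$2"
    "y 8 = - (p$2 - q$3)"
    "y 9 = p$1 - q$1"
    "y 10 = - (A$2 - B$2)"
    "y 11 = A$3 - B$1"
    "y 12 = - (A$1 - B$3)"
    "y 13 = d - (p$1 - q$3) - (A$1 - B$3)"
    "y 14 = - (d - (p$3 - q$1) - (A$3 - B$1))"
    "y 15 = d - (p$2 - q$2) - (A$2 - B$2)"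
    "y 16 = A$3 - B$3"
    "y 17 = - (A$1 - B$2)"
    "y 18 = A$2 - B$1"
    "y 19 = - (d - (p$2 - q$1) - (A$2 - B$1))"
    "y 20 = d - (p$1 - q$2) - (A$1 - B$2)"
    "y 21 = - (d - (p$3 - q$3) - (A$3 - B$3))"
    "y 22 = d - (p$1 - q$1) - (A$1 - B$1)"
    "y 23 = p$3 - A$1"
    "y 24 = q$3 - B$1"
    "y 25 = q$2 - B$1"
    "y 26 = p$2 - A$1"
    "y 27 = - (A$1 - B$1)"
    "y 28 = - (d - (p$2 - q$3) - (A$2 - B$3))"
    "y 29 = q$2 - B$3"
    "y 30 = p$1 - A$2"
    "y 31 = p$3 - A$2"
    "y 32 = q$1 - B$3"
    "y 33 = A$2 - B$3"
    "y 34 = d - (p$3 - q$2) - (A$3 - B$2)"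
    "y 35 = p$2 - A$3"
    "y 36 = q$1 - B$2"
    "y 37 = q$3 - B$2"
    "y 38 = p$1 - A$3"
    "y 39 = - (A$3 - B$2)"
  using assms by (simp_all add: trihedral_coordinates_def Let_def)

text \<open>
  The gauge freedom provides the dot product condition. The \<open>36\<close> cubic relations
  with the coordinate \<open>0\<close> turn up to sign into the two families that define \<open>trihedral\<close>.
\<close>
lemma cone_trihedral:
  assumes y: "y \<in> equation_cone" and y0: "coords y 0 \<noteq> 0"
  obtains p q A B where "trihedral p q A B"
    and "\<forall>i<40. coords y i = trihedral_coordinates p q A B ! i"
proof -
  obtain p' q' A' B' where tot': "coord_sum A' - coord_sum B' = coord_sum p' - coord_sum q'"
    and coords': "\<forall>i<40. coords y i = trihedral_coordinates p' q' A' B' ! i"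
    using cone_trihedral_coordinates[OF y] by metis
  define d where "d = coord_sum p' - coord_sum q'"
  have "coords y 0 = coord_sum p' - coord_sum q'"
    by (rule trihedral_values(1)[OF coords' refl])
  then have pq': "coord_sum p' \<noteq> coord_sum q'" and d0: "d \<noteq> 0" using y0 by (simp_all add: d_def)
  obtain t where t: "(\<Sum>i\<in>UNIV. (p' $ i + t) * (A' $ i + t)) = (\<Sum>i\<in>UNIV. (q' $ i + t) * (B' $ i + t))"
    using trihedral_gauge[OF tot' pq'] by blast
  define p where "p = (\<chi> i. p' $ i + t)"
  define q where "q = (\<chi> i. q' $ i + t)"
  define A where "A = (\<chi> i. A' $ i + t)"
  define B where "B = (\<chi> i. B' $ i + t)"
  have shift: "coord_sum (\<chi> i. v $ i + t) = coord_sum v + 3 * t" for v by (simp add: coord_sum_distinct[of 1 2 3])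
  have dpq: "coord_sum p - coord_sum q = d"
    unfolding p_def q_def shift d_def by (rule add_diff_cancel_right)
  have dAB: "coord_sum A - coord_sum B = d"
    unfolding A_def B_def shift d_def tot'[symmetric] by (rule add_diff_cancel_right)
  have coords: "\<forall>i<40. coords y i = trihedral_coordinates p q A B ! i"
    using coords' unfolding p_def q_def A_def B_def trihedral_coordinates_shift .
  have dot: "(\<Sum>i\<in>UNIV. p $ i * A $ i) = (\<Sum>i\<in>UNIV. q $ i * B $ i)"
    using t unfolding p_def q_def A_def B_def vec_lambda_beta .
  note c = trihedral_values[OF coords dpq] and cub = cone_cubic_relations[OF y]
  have t0: "d * (p $ 2 - A $ 1) * (p $ 3 - A $ 2) + (p $ 3 - q $ 1) * (A $ 1 - B $ 1) * (d - (p $ 2 - q $ 1) - (A $ 2 - B $ 1)) = 0"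
    using cub(1) unfolding c by algebra
  have t1: "d * (p $ 2 - A $ 1) * (p $ 3 - A $ 2) + (p $ 3 - q $ 2) * (A $ 1 - B $ 2) * (d - (p $ 2 - q $ 2) - (A $ 2 - B $ 2)) = 0"
    using cub(2) unfolding c by algebra
  have t2: "d * (p $ 2 - A $ 1) * (p $ 3 - A $ 2) + (p $ 3 - q $ 3) * (A $ 1 - B $ 3) * (d - (p $ 2 - q $ 3) - (A $ 2 - B $ 3)) = 0"
    using cub(3) unfolding c by algebra
  have t3: "d * (p $ 3 - A $ 1) * (p $ 2 - A $ 3) + (p $ 2 - q $ 1) * (A $ 1 - B $ 1) * (d - (p $ 3 - q $ 1) - (A $ 3 - B $ 1)) = 0"
    using cub(4) unfolding c by algebra
  have t4: "d * (p $ 3 - A $ 1) * (p $ 2 - A $ 3) + (p $ 2 - q $ 2) * (A $ 1 - B $ 2) * (d - (p $ 3 - q $ 2) - (A $ 3 - B $ 2)) = 0"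
    using cub(5) unfolding c by algebra
  have t5: "d * (p $ 3 - A $ 1) * (p $ 2 - A $ 3) + (p $ 2 - q $ 3) * (A $ 1 - B $ 3) * (d - (p $ 3 - q $ 3) - (A $ 3 - B $ 3)) = 0"
    using cub(6) unfolding c by algebra
  have t6: "d * (p $ 1 - A $ 2) * (p $ 3 - A $ 1) + (p $ 3 - q $ 1) * (A $ 2 - B $ 1) * (d - (p $ 1 - q $ 1) - (A $ 1 - B $ 1)) = 0"
    using cub(7) unfolding c by algebra
  have t7: "d * (p $ 1 - A $ 2) * (p $ 3 - A $ 1) + (p $ 3 - q $ 2) * (A $ 2 - B $ 2) * (d - (p $ 1 - q $ 2) - (A $ 1 - B $ 2)) = 0"
    using cub(8) unfolding c by algebra
  have t8: "d * (p $ 1 - A $ 2) * (p $ 3 - A $ 1) + (p $ 3 - q $ 3) * (A $ 2 - B $ 3) * (d - (p $ 1 - q $ 3) - (A $ 1 - B $ 3)) = 0"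
    using cub(9) unfolding c by algebra
  have t9: "d * (p $ 3 - A $ 2) * (p $ 1 - A $ 3) + (p $ 1 - q $ 1) * (A $ 2 - B $ 1) * (d - (p $ 3 - q $ 1) - (A $ 3 - B $ 1)) = 0"
    using cub(10) unfolding c by algebra
  have t10: "d * (p $ 3 - A $ 2) * (p $ 1 - A $ 3) + (p $ 1 - q $ 2) * (A $ 2 - B $ 2) * (d - (p $ 3 - q $ 2) - (A $ 3 - B $ 2)) = 0"
    using cub(11) unfolding c by algebra
  have t11: "d * (p $ 3 - A $ 2) * (p $ 1 - A $ 3) + (p $ 1 - q $ 3) * (A $ 2 - B $ 3) * (d - (p $ 3 - q $ 3) - (A $ 3 - B $ 3)) = 0"
    using cub(12) unfolding c by algebra
  have t12: "d * (p $ 1 - A $ 3) * (p $ 2 - A $ 1) + (p $ 2 - q $ 1) * (A $ 3 - B $ 1) * (d - (p $ 1 - q $ 1) - (A $ 1 - B $ 1)) = 0"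
    using cub(13) unfolding c by algebra
  have t13: "d * (p $ 1 - A $ 3) * (p $ 2 - A $ 1) + (p $ 2 - q $ 2) * (A $ 3 - B $ 2) * (d - (p $ 1 - q $ 2) - (A $ 1 - B $ 2)) = 0"
    using cub(14) unfolding c by algebra
  have t14: "d * (p $ 1 - A $ 3) * (p $ 2 - A $ 1) + (p $ 2 - q $ 3) * (A $ 3 - B $ 3) * (d - (p $ 1 - q $ 3) - (A $ 1 - B $ 3)) = 0"
    using cub(15) unfolding c by algebra
  have t15: "d * (p $ 2 - A $ 3) * (p $ 1 - A $ 2) + (p $ 1 - q $ 1) * (A $ 3 - B $ 1) * (d - (p $ 2 - q $ 1) - (A $ 2 - B $ 1)) = 0"
    using cub(16) unfolding c by algebra
  have t16: "d * (p $ 2 - A $ 3) * (p $ 1 - A $ 2) + (p $ 1 - q $ 2) * (A $ 3 - B $ 2) * (d - (p $ 2 - q $ 2) - (A $ 2 - B $ 2)) = 0"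
    using cub(17) unfolding c by algebra
  have t17: "d * (p $ 2 - A $ 3) * (p $ 1 - A $ 2) + (p $ 1 - q $ 3) * (A $ 3 - B $ 3) * (d - (p $ 2 - q $ 3) - (A $ 2 - B $ 3)) = 0"
    using cub(18) unfolding c by algebra
  have t18: "d * (q $ 2 - B $ 1) * (q $ 3 - B $ 2) + (p $ 1 - q $ 3) * (A $ 1 - B $ 1) * (d - (p $ 1 - q $ 2) - (A $ 1 - B $ 2)) = 0"
    using cub(19) unfolding c by algebra
  have t19: "d * (q $ 2 - B $ 1) * (q $ 3 - B $ 2) + (p $ 2 - q $ 3) * (A $ 2 - B $ 1) * (d - (p $ 2 - q $ 2) - (A $ 2 - B $ 2)) = 0"
    using cub(20) unfolding c by algebra
  have t20: "d * (q $ 2 - B $ 1) * (q $ 3 - B $ 2) + (p $ 3 - q $ 3) * (A $ 3 - B $ 1) * (d - (p $ 3 - q $ 2) - (A $ 3 - B $ 2)) = 0"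
    using cub(21) unfolding c by algebra
  have t21: "d * (q $ 3 - B $ 1) * (q $ 2 - B $ 3) + (p $ 1 - q $ 2) * (A $ 1 - B $ 1) * (d - (p $ 1 - q $ 3) - (A $ 1 - B $ 3)) = 0"
    using cub(22) unfolding c by algebra
  have t22: "d * (q $ 3 - B $ 1) * (q $ 2 - B $ 3) + (p $ 2 - q $ 2) * (A $ 2 - B $ 1) * (d - (p $ 2 - q $ 3) - (A $ 2 - B $ 3)) = 0"
    using cub(23) unfolding c by algebra
  have t23: "d * (q $ 3 - B $ 1) * (q $ 2 - B $ 3) + (p $ 3 - q $ 2) * (A $ 3 - B $ 1) * (d - (p $ 3 - q $ 3) - (A $ 3 - B $ 3)) = 0"
    using cub(24) unfolding c by algebra
  have t24: "d * (q $ 1 - B $ 2) * (q $ 3 - B $ 1) + (p $ 1 - q $ 3) * (A $ 1 - B $ 2) * (d - (p $ 1 - q $ 1) - (A $ 1 - B $ 1)) = 0"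
    using cub(25) unfolding c by algebra
  have t25: "d * (q $ 1 - B $ 2) * (q $ 3 - B $ 1) + (p $ 2 - q $ 3) * (A $ 2 - B $ 2) * (d - (p $ 2 - q $ 1) - (A $ 2 - B $ 1)) = 0"
    using cub(26) unfolding c by algebra
  have t26: "d * (q $ 1 - B $ 2) * (q $ 3 - B $ 1) + (p $ 3 - q $ 3) * (A $ 3 - B $ 2) * (d - (p $ 3 - q $ 1) - (A $ 3 - B $ 1)) = 0"
    using cub(27) unfolding c by algebra
  have t27: "d * (q $ 3 - B $ 2) * (q $ 1 - B $ 3) + (p $ 1 - q $ 1) * (A $ 1 - B $ 2) * (d - (p $ 1 - q $ 3) - (A $ 1 - B $ 3)) = 0"
    using cub(28) unfolding c by algebra
  have t28: "d * (q $ 3 - B $ 2) * (q $ 1 - B $ 3) + (p $ 2 - q $ 1) * (A $ 2 - B $ 2) * (d - (p $ 2 - q $ 3) - (A $ 2 - B $ 3)) = 0"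
    using cub(29) unfolding c by algebra
  have t29: "d * (q $ 3 - B $ 2) * (q $ 1 - B $ 3) + (p $ 3 - q $ 1) * (A $ 3 - B $ 2) * (d - (p $ 3 - q $ 3) - (A $ 3 - B $ 3)) = 0"
    using cub(30) unfolding c by algebra
  have t30: "d * (q $ 1 - B $ 3) * (q $ 2 - B $ 1) + (p $ 1 - q $ 2) * (A $ 1 - B $ 3) * (d - (p $ 1 - q $ 1) - (A $ 1 - B $ 1)) = 0"
    using cub(31) unfolding c by algebra
  have t31: "d * (q $ 1 - B $ 3) * (q $ 2 - B $ 1) + (p $ 2 - q $ 2) * (A $ 2 - B $ 3) * (d - (p $ 2 - q $ 1) - (A $ 2 - B $ 1)) = 0"
    using cub(32) unfolding c by algebra
  have t32: "d * (q $ 1 - B $ 3) * (q $ 2 - B $ 1) + (p $ 3 - q $ 2) * (A $ 3 - B $ 3) * (d - (p $ 3 - q $ 1) - (A $ 3 - B $ 1)) = 0"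
    using cub(33) unfolding c by algebra
  have t33: "d * (q $ 2 - B $ 3) * (q $ 1 - B $ 2) + (p $ 1 - q $ 1) * (A $ 1 - B $ 3) * (d - (p $ 1 - q $ 2) - (A $ 1 - B $ 2)) = 0"
    using cub(34) unfolding c by algebra
  have t34: "d * (q $ 2 - B $ 3) * (q $ 1 - B $ 2) + (p $ 2 - q $ 1) * (A $ 2 - B $ 3) * (d - (p $ 2 - q $ 2) - (A $ 2 - B $ 2)) = 0"
    using cub(35) unfolding c by algebra
  have t35: "d * (q $ 2 - B $ 3) * (q $ 1 - B $ 2) + (p $ 3 - q $ 1) * (A $ 3 - B $ 3) * (d - (p $ 3 - q $ 2) - (A $ 3 - B $ 2)) = 0"
    using cub(36) unfolding c by algebra
  have tp: "\<forall>i j k b. distinct [i, j, k] \<longrightarrow> d * (p $ j - A $ i) * (p $ k - A $ j) + (p $ k - q $ b) * (A $ i - B $ b) * (d - (p $ j - q $ b) - (A $ j - B $ b)) = 0"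
    unfolding forall_3 by (intro conjI impI) (rule t0 t1 t2 t3 t4 t5 t6 t7 t8 t9 t10 t11 t12 t13 t14 t15 t16 t17 | simp)+
  have tq: "\<forall>i j k a. distinct [i, j, k] \<longrightarrow> d * (q $ j - B $ i) * (q $ k - B $ j) + (p $ a - q $ k) * (A $ a - B $ i) * (d - (p $ a - q $ j) - (A $ a - B $ j)) = 0"
    unfolding forall_3 by (intro conjI impI) (rule t18 t19 t20 t21 t22 t23 t24 t25 t26 t27 t28 t29 t30 t31 t32 t33 t34 t35 | simp)+
  have "trihedral p q A B"
    unfolding trihedral_def dpq dAB
  proof (intro conjI)
    show "coord_sum p \<noteq> coord_sum q" using d0 dpq by auto
    show "d = d" ..
  qed (fact dot tp tq)+
  then show ?thesis using coords by (rule that)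
qed

section \<open>The coordinates of the map and the birational action on markings\<close>

text \<open>
  The factors of the discriminant. All minors and the conic determinant of the normalised matrix are
  among them up to sign, or are \<open>\<plusminus>1\<close>, so the coordinates of the map are monomials in these factors.
\<close>
definition marking_factors :: "complex^4 \<Rightarrow> complex list" where
  "marking_factors x = (let a = x $ 1; b = x $ 2; c = x $ 3; d = x $ 4 in
    [a, b, c, d, a - 1, b - 1, c - 1, d - 1, a - b, a - c, b - d, c - d,
     a * d - b * c, a * d - d + b - b * c + c - a,
     - a * b * c - b * c * d + b * c + a * b * d + a * c * d - a * d])"

definition coordinate_monomials :: "complex list \<Rightarrow> complex list" where
  "coordinate_monomials f =
   [- (f ! 13 * f ! 14), f ! 8 * f ! 14, - (f ! 2 * f ! 5 * f ! 14),
    - (f ! 3 * f ! 4 * f ! 14), f ! 11 * f ! 14, - (f ! 0 * f ! 7 * f ! 14),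
    - (f ! 1 * f ! 6 * f ! 14), f ! 9 * f ! 14, f ! 10 * f ! 14,
    - (f ! 12 * f ! 14), f ! 8 * f ! 13 * f ! 2 * f ! 3, - (f ! 0 * f ! 5 * f ! 13 * f ! 3),
    - (f ! 1 * f ! 4 * f ! 13 * f ! 2), - (f ! 9 * f ! 6 * f ! 5 * f ! 8 * f ! 3), - (f ! 10 * f ! 7 * f ! 4 * f ! 8 * f ! 2),
    f ! 12 * f ! 11 * f ! 4 * f ! 5, f ! 11 * f ! 13 * f ! 0 * f ! 1, - (f ! 2 * f ! 7 * f ! 13 * f ! 1),
    - (f ! 3 * f ! 6 * f ! 13 * f ! 0), - (f ! 9 * f ! 4 * f ! 7 * f ! 11 * f ! 1), - (f ! 10 * f ! 5 * f ! 6 * f ! 11 * f ! 0),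
    f ! 12 * f ! 8 * f ! 6 * f ! 7, - (f ! 11 * f ! 8 * f ! 9 * f ! 10), f ! 2 * f ! 6 * f ! 8 * f ! 10,
    f ! 3 * f ! 7 * f ! 8 * f ! 9, f ! 0 * f ! 4 * f ! 11 * f ! 10, f ! 1 * f ! 5 * f ! 11 * f ! 9,
    - (f ! 12 * f ! 13), f ! 7 * f ! 5 * f ! 9 * f ! 12, f ! 6 * f ! 5 * f ! 0 * f ! 12,
    f ! 3 * f ! 11 * f ! 5 * f ! 0 * f ! 9, f ! 4 * f ! 7 * f ! 2 * f ! 12, f ! 1 * f ! 8 * f ! 7 * f ! 2 * f ! 9,
    f ! 10 * f ! 13 * f ! 2 * f ! 0, f ! 6 * f ! 4 * f ! 10 * f ! 12, f ! 7 * f ! 4 * f ! 1 * f ! 12,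
    f ! 2 * f ! 11 * f ! 4 * f ! 1 * f ! 10, f ! 5 * f ! 6 * f ! 3 * f ! 12, f ! 0 * f ! 8 * f ! 6 * f ! 3 * f ! 10,
    f ! 9 * f ! 13 * f ! 3 * f ! 1]"

lemma disc_factors: "disc x = prod_list (marking_factors x)"
  by (simp add: disc_def marking_factors_def Let_def mult.assoc)

lemma vector_6:
  "(vector [a, b, c, d, e, f] :: 'a^6) $ 1 = a" "(vector [a, b, c, d, e, f] :: ('a::zero)^6) $ 2 = b"
  "(vector [a, b, c, d, e, f] :: 'a^6) $ 3 = c" "(vector [a, b, c, d, e, f] :: 'a^6) $ 4 = d"
  "(vector [a, b, c, d, e, f] :: 'a^6) $ 5 = e" "(vector [a, b, c, d, e, f] :: 'a^6) $ 6 = f"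
  unfolding vector_def by simp_all

lemma vector_4:
  "(vector [a, b, c, d] :: ('a::zero)^4) $ 1 = a" "(vector [a, b, c, d] :: 'a^4) $ 2 = b"
  "(vector [a, b, c, d] :: 'a^4) $ 3 = c" "(vector [a, b, c, d] :: 'a^4) $ 4 = d"
  unfolding vector_def by simp_all

lemma minor_sorted:
  assumes "i < j" "j < k"
  shows "minor X {i, j, k} =
    X $ 1 $ of_nat i * (X $ 2 $ of_nat j * X $ 3 $ of_nat k - X $ 2 $ of_nat k * X $ 3 $ of_nat j)
    - X $ 1 $ of_nat j * (X $ 2 $ of_nat i * X $ 3 $ of_nat k - X $ 2 $ of_nat k * X $ 3 $ of_nat i)
    + X $ 1 $ of_nat k * (X $ 2 $ of_nat i * X $ 3 $ of_nat j - X $ 2 $ of_nat j * X $ 3 $ of_nat i)"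
proof -
  have "sorted_list_of_set {i, j, k} = [i, j, k]"
    using assms by (intro sorted_list_of_set_unique[THEN iffD1]) auto
  then show ?thesis
    unfolding minor_def by (simp add: det_3 column_def transpose_def algebra_simps)
qed

text \<open>
  The moves on normalised matrices: the five transpositions of consecutive columns, followed by
  renormalisation, and the standard quadratic transformation, which inverts the entries.
\<close>
definition marking_move :: "nat \<Rightarrow> complex^4 \<Rightarrow> complex^4" where
  "marking_move j x = (let a = x $ 1; b = x $ 2; c = x $ 3; d = x $ 4 in
    [vector [1 / a, 1 / b, c / a, d / b],
     vector [c, d, a, b],
     vector [(c - a) / (c - 1), (d - b) / (d - 1), c / (c - 1), d / (d - 1)],
     vector [1 / a, b / a, 1 / c, d / c],
     vector [b, a, d, c],
     vector [1 / a, 1 / b, 1 / c, 1 / d]] ! j)"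

definition move_scale :: "nat \<Rightarrow> complex list \<Rightarrow> complex" where
  "move_scale j f = 1 / ([f ! 0 * f ! 0 * f ! 0 * f ! 1 * f ! 1 * f ! 1, 1, f ! 6 * f ! 6 * f ! 6 * f ! 7 * f ! 7 * f ! 7, f ! 0 * f ! 0 * f ! 0 * f ! 2 * f ! 2 * f ! 2, 1, f ! 0 * f ! 0 * f ! 1 * f ! 1 * f ! 2 * f ! 2 * f ! 3 * f ! 3] ! j)"

definition moved_factors :: "nat \<Rightarrow> complex list \<Rightarrow> complex list" where
  "moved_factors j f = [[1 / f ! 0, 1 / f ! 1, f ! 2 / f ! 0, f ! 3 / f ! 1, - (f ! 4 / f ! 0), - (f ! 5 / f ! 1), - (f ! 9 / f ! 0), - (f ! 10 / f ! 1), - (f ! 8 / (f ! 0 * f ! 1)), - (f ! 6 / f ! 0), - (f ! 7 / f ! 1), - (f ! 12 / (f ! 0 * f ! 1)), - (f ! 11 / (f ! 0 * f ! 1)), - (f ! 13 / (f ! 0 * f ! 1)), - (f ! 14 / (f ! 0 * f ! 0 * f ! 1 * f ! 1))],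
     [f ! 2, f ! 3, f ! 0, f ! 1, f ! 6, f ! 7, f ! 4, f ! 5, f ! 11, - (f ! 9), - (f ! 10), f ! 8, - (f ! 12), - (f ! 13), - (f ! 14)],
     [- (f ! 9 / f ! 6), - (f ! 10 / f ! 7), f ! 2 / f ! 6, f ! 3 / f ! 7, - (f ! 4 / f ! 6), - (f ! 5 / f ! 7), 1 / f ! 6, 1 / f ! 7, - (f ! 13 / (f ! 6 * f ! 7)), - (f ! 0 / f ! 6), - (f ! 1 / f ! 7), - (f ! 11 / (f ! 6 * f ! 7)), - (f ! 12 / (f ! 6 * f ! 7)), - (f ! 8 / (f ! 6 * f ! 7)), - (f ! 14 / (f ! 6 * f ! 6 * f ! 7 * f ! 7))],
     [1 / f ! 0, f ! 1 / f ! 0, 1 / f ! 2, f ! 3 / f ! 2, - (f ! 4 / f ! 0), - (f ! 8 / f ! 0), - (f ! 6 / f ! 2), - (f ! 11 / f ! 2), - (f ! 5 / f ! 0), - (f ! 9 / (f ! 0 * f ! 2)), - (f ! 12 / (f ! 0 * f ! 2)), - (f ! 7 / f ! 2), - (f ! 10 / (f ! 0 * f ! 2)), - (f ! 13 / (f ! 0 * f ! 2)), - (f ! 14 / (f ! 0 * f ! 0 * f ! 2 * f ! 2))],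
     [f ! 1, f ! 0, f ! 3, f ! 2, f ! 5, f ! 4, f ! 7, f ! 6, - (f ! 8), f ! 10, f ! 9, - (f ! 11), - (f ! 12), - (f ! 13), - (f ! 14)],
     [1 / f ! 0, 1 / f ! 1, 1 / f ! 2, 1 / f ! 3, - (f ! 4 / f ! 0), - (f ! 5 / f ! 1), - (f ! 6 / f ! 2), - (f ! 7 / f ! 3), - (f ! 8 / (f ! 0 * f ! 1)), - (f ! 9 / (f ! 0 * f ! 2)), - (f ! 10 / (f ! 1 * f ! 3)), - (f ! 11 / (f ! 2 * f ! 3)), - (f ! 12 / (f ! 0 * f ! 1 * f ! 2 * f ! 3)), f ! 14 / (f ! 0 * f ! 1 * f ! 2 * f ! 3), f ! 13 / (f ! 0 * f ! 1 * f ! 2 * f ! 3)]] ! j"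

lemma marking_factors_move:
  assumes "j < 6" "disc x \<noteq> 0"
  shows "marking_factors (marking_move j x) = moved_factors j (marking_factors x)"
proof -
  have nz: "x $ 1 \<noteq> 0" "x $ 2 \<noteq> 0" "x $ 3 \<noteq> 0" "x $ 4 \<noteq> 0" "x $ 3 - 1 \<noteq> 0" "x $ 4 - 1 \<noteq> 0"
    using assms(2) unfolding disc_factors marking_factors_def Let_def by simp_all
  have "j \<in> {0, 1, 2, 3, 4, 5}" using assms(1) by auto
  then show ?thesis
    unfolding insert_iff
  proof (elim disjE)
    assume [simp]: "j = 0"
    show ?thesis
      using nz by (simp add: marking_move_def marking_factors_def moved_factors_def Let_def vector_4 divide_simps)
        (simp add: algebra_simps)?
  next
    assume [simp]: "j = 1"
    show ?thesis
      using nz by (simp add: marking_move_def marking_factors_def moved_factors_def Let_def vector_4 divide_simps)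
        (simp add: algebra_simps)?
  next
    assume [simp]: "j = 2"
    show ?thesis
      using nz by (simp add: marking_move_def marking_factors_def moved_factors_def Let_def vector_4 divide_simps)
        (simp add: algebra_simps)?
  next
    assume [simp]: "j = 3"
    show ?thesis
      using nz by (simp add: marking_move_def marking_factors_def moved_factors_def Let_def vector_4 divide_simps)
        (simp add: algebra_simps)?
  next
    assume [simp]: "j = 4"
    show ?thesis
      using nz by (simp add: marking_move_def marking_factors_def moved_factors_def Let_def vector_4 divide_simps)
        (simp add: algebra_simps)?
  next
    assume [simp]: "j = 5"
    show ?thesis
      using nz by (simp add: marking_move_def marking_factors_def moved_factors_def Let_def vector_4 divide_simps)
        (simp add: algebra_simps)?
  qed simp
qed

text \<open>
  The factors are permuted by a move up to signs and quotients by other factors, hence the comparison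
  of coordinates is one of monomials.
\<close>
lemma coordinate_monomials_move:
  assumes "j < 6" "length f = 15" "prod_list f \<noteq> 0"
  shows "coordinate_monomials (moved_factors j f) =
    map (\<lambda>i. move_scale j f * (if perm j i = i then coordinate_monomials f ! i else - coordinate_monomials f ! perm j i)) [0..<40]"
proof -
  obtain a0 a1 a2 a3 a4 a5 a6 a7 a8 a9 a10 a11 a12 a13 a14 where
    f: "f = [a0, a1, a2, a3, a4, a5, a6, a7, a8, a9, a10, a11, a12, a13, a14]"
    using assms(2) by (auto simp: length_Suc_conv numeral_eq_Suc)
  have nz: "a0 \<noteq> 0" "a1 \<noteq> 0" "a2 \<noteq> 0" "a3 \<noteq> 0" "a6 \<noteq> 0" "a7 \<noteq> 0"
    using assms(3) unfolding f by simp_all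
  have upt: "[0..<40] = [0,1,2,3,4,5,6,7,8,9,10,11,12,13,14,15,16,17,18,19,20,21,22,23,24,25,26,27,28,29,30,31,32,33,34,35,36,37,38,39::nat]"
    by (simp add: upt_rec)
  have "j \<in> {0, 1, 2, 3, 4, 5}" using assms(1) by auto
  then show ?thesis
    unfolding insert_iff
  proof (elim disjE)
    assume [simp]: "j = 0"
    show ?thesis
      unfolding f upt using nz
      by (simp add: coordinate_monomials_def moved_factors_def move_scale_def perm_def label_perms_def)
        (simp add: field_simps)?
  next
    assume [simp]: "j = 1"
    show ?thesis
      unfolding f upt using nz
      by (simp add: coordinate_monomials_def moved_factors_def move_scale_def perm_def label_perms_def)
        (simp add: field_simps)?
  next
    assume [simp]: "j = 2"
    show ?thesis
      unfolding f upt using nz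
      by (simp add: coordinate_monomials_def moved_factors_def move_scale_def perm_def label_perms_def)
        (simp add: field_simps)?
  next
    assume [simp]: "j = 3"
    show ?thesis
      unfolding f upt using nz
      by (simp add: coordinate_monomials_def moved_factors_def move_scale_def perm_def label_perms_def)
        (simp add: field_simps)?
  next
    assume [simp]: "j = 4"
    show ?thesis
      unfolding f upt using nz
      by (simp add: coordinate_monomials_def moved_factors_def move_scale_def perm_def label_perms_def)
        (simp add: field_simps)?
  next
    assume [simp]: "j = 5"
    show ?thesis
      unfolding f upt using nz
      by (simp add: coordinate_monomials_def moved_factors_def move_scale_def perm_def label_perms_def)
        (simp add: field_simps)?
  qed simp
qed

lemma exhaust_6: "(x :: 6) = 1 \<or> x = 2 \<or> x = 3 \<or> x = 4 \<or> x = 5 \<or> x = 6"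
proof (induct x)
  case (of_int z)
  then have "0 \<le> z" "z < 6" by simp_all
  then have "z = 0 \<or> z = 1 \<or> z = 2 \<or> z = 3 \<or> z = 4 \<or> z = 5" by arith
  then show ?case by auto
qed

text \<open>
  Only permutations that fix the first three indices contribute to the Leibniz expansion.
\<close>
lemma det_identity_block:
  fixes A :: "complex^6^6"
  assumes "\<And>i j. i \<in> {1, 2, 3} \<Longrightarrow> A $ i $ j = (if j = i then 1 else 0)"
  shows "det A = A$4$4 * A$5$5 * A$6$6 + A$4$5 * A$5$6 * A$6$4 + A$4$6 * A$5$4 * A$6$5
    - A$4$4 * A$5$6 * A$6$5 - A$4$5 * A$5$4 * A$6$6 - A$4$6 * A$5$5 * A$6$4"
proof -
  have UNIV6: "UNIV = {1, 2, 3, 4, 5, 6 :: 6}" using exhaust_6 by auto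
  let ?t = "\<lambda>p. of_int (sign p) * (\<Prod>i\<in>UNIV. A $ i $ p i)"
  have "det A = sum ?t {p. p permutes {4, 5, 6}}"
    unfolding det_def
  proof (rule sum.mono_neutral_right)
    show "finite {p. p permutes (UNIV :: 6 set)}" by (rule finite_permutations) simp
    show "{p. p permutes {4, 5, 6}} \<subseteq> {p. p permutes (UNIV :: 6 set)}"
      by (auto intro: permutes_subset)
    show "\<forall>p \<in> {p. p permutes UNIV} - {p. p permutes {4, 5, 6}}. ?t p = 0"
    proof
      fix p :: "6 \<Rightarrow> 6" assume p: "p \<in> {p. p permutes UNIV} - {p. p permutes {4, 5, 6}}"
      have "\<exists>i \<in> {1, 2, 3}. p i \<noteq> i"
      proof (rule ccontr)
        assume *: "\<not> (\<exists>i \<in> {1, 2, 3}. p i \<noteq> i)"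
        have "p x = x" if "x \<notin> {4, 5, 6}" for x
          using * that exhaust_6[of x] by auto
        then have "p permutes {4, 5, 6}" using p by (auto simp: permutes_def)
        then show False using p by simp
      qed
      then obtain i where "i \<in> {1, 2, 3}" "p i \<noteq> i" by blast
      then have "A $ i $ p i = 0" using assms by simp
      then show "?t p = 0" by (metis (no_types, lifting) UNIV_I finite mult_zero_right prod_zero)
    qed
  qed
  also have "\<dots> = (\<Sum>p | p permutes {4, 5, 6}. of_int (sign p) * (A$4$p 4 * A$5$p 5 * A$6$p 6))"
  proof (rule sum.cong[OF refl])
    fix p :: "6 \<Rightarrow> 6" assume "p \<in> {p. p permutes {4, 5, 6}}"
    then have "p 1 = 1" "p 2 = 2" "p 3 = 3" by (auto simp: permutes_def)
    then show "?t p = of_int (sign p) * (A$4$p 4 * A$5$p 5 * A$6$p 6)"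
      unfolding UNIV6 using assms by (simp add: mult.assoc)
  qed
  also have "\<dots> = A$4$4 * A$5$5 * A$6$6 + A$4$5 * A$5$6 * A$6$4 + A$4$6 * A$5$4 * A$6$5
    - A$4$4 * A$5$6 * A$6$5 - A$4$5 * A$5$4 * A$6$6 - A$4$6 * A$5$5 * A$6$4"
  proof -
    have f456: "finite {5::6, 6}" "4 \<notin> {5::6, 6}" and f56: "finite {6::6}" "5 \<notin> {6::6}" by auto
    show ?thesis
      unfolding sum_over_permutations_insert[OF f456] sum_over_permutations_insert[OF f56] permutes_sing
      by (simp add: sign_swap_id permutation_swap_id sign_compose sign_id swap_id_eq algebra_simps)
  qed
  finally show ?thesis .
qed

text \<open>
  When the first three points are the coordinate points, exchanging the square monomials with the mixed
  ones puts the matrix of the conic condition into block form.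
\<close>
lemma conic_det_columns:
  fixes X :: "complex^6^3"
  assumes "column 1 X = vector [1, 0, 0]" "column 2 X = vector [0, 1, 0]" "column 3 X = vector [0, 0, 1]"
  shows "conic_det X = -
    (let u = (\<lambda>j. X$1$j * X$2$j); v = (\<lambda>j. X$2$j * X$3$j); w = (\<lambda>j. X$3$j * X$1$j)
     in u 4 * v 5 * w 6 + v 4 * w 5 * u 6 + w 4 * u 5 * v 6 - u 4 * w 5 * v 6 - v 4 * u 5 * w 6 - w 4 * v 5 * u 6)"
proof -
  have col: "X$1$1 = 1" "X$2$1 = 0" "X$3$1 = 0" "X$1$2 = 0" "X$2$2 = 1" "X$3$2 = 0" "X$1$3 = 0" "X$2$3 = 0" "X$3$3 = 1"
    using assms by (simp_all add: column_def vec_eq_iff forall_3 vector_3)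
  define c where "c j = (vector [X$1$j * X$2$j, X$2$j * X$3$j, X$3$j * X$1$j, (X$1$j)\<^sup>2, (X$2$j)\<^sup>2, (X$3$j)\<^sup>2] :: complex^6)" for j
  define N :: "complex^6^6" where "N = (\<chi> i j. c i $ j)"
  define \<sigma> :: "6 \<Rightarrow> 6" where "\<sigma> = Transposition.transpose 1 4 \<circ> Transposition.transpose 2 5 \<circ> Transposition.transpose 3 6"
  have perm: "\<sigma> permutes UNIV" unfolding \<sigma>_def by (intro permutes_compose permutes_swap_id) auto
  have sgn: "sign \<sigma> = - 1" unfolding \<sigma>_def by (simp add: sign_compose permutation_compose permutation_swap_id sign_swap_id)
  have \<sigma>: "\<sigma> 1 = 4" "\<sigma> 2 = 5" "\<sigma> 3 = 6" "\<sigma> 4 = 1" "\<sigma> 5 = 2" "\<sigma> 6 = 3"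
    by (simp_all add: \<sigma>_def Transposition.transpose_def)
  have "conic_det X = det (Finite_Cartesian_Product.transpose N)"
    unfolding conic_det_def N_def c_def Finite_Cartesian_Product.transpose_def by simp
  also have "\<dots> = det N" by (rule det_transpose)
  also have "\<dots> = - det (\<chi> i j. N $ i $ \<sigma> j)"
    unfolding det_permute_columns[OF perm] sgn by simp
  also have "\<dots> = - (let u = (\<lambda>j. X$1$j * X$2$j); v = (\<lambda>j. X$2$j * X$3$j); w = (\<lambda>j. X$3$j * X$1$j)
     in u 4 * v 5 * w 6 + v 4 * w 5 * u 6 + w 4 * u 5 * v 6 - u 4 * w 5 * v 6 - v 4 * u 5 * w 6 - w 4 * v 5 * u 6)"
  proof (subst det_identity_block)
    fix i j :: 6 assume "i \<in> {1, 2, 3}"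
    then show "(\<chi> i j. N $ i $ \<sigma> j) $ i $ j = (if j = i then 1 else 0)"
      using exhaust_6[of j] by (auto simp: N_def c_def \<sigma> vector_6 col)
  qed (simp add: N_def c_def \<sigma> vector_6 Let_def)
  finally show ?thesis .
qed

lemma conic_det_mat36: "conic_det (mat36 x) = - marking_factors x ! 14"
proof -
  have "column 1 (mat36 x) = vector [1, 0, 0]" "column 2 (mat36 x) = vector [0, 1, 0]"
    "column 3 (mat36 x) = vector [0, 0, 1]"
    by (simp_all add: column_def mat36_def vec_eq_iff forall_3 vector_3 vector_6)
  from conic_det_columns[OF this] show ?thesis
    by (simp add: mat36_def vector_3 vector_6 marking_factors_def Let_def algebra_simps)
qed

definition phi_vec :: "complex^4 \<Rightarrow> complex^label" where
  "phi_vec x = (\<chi> \<alpha>. coord (mat36 x) \<alpha>)"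

lemma minors_mat36:
  fixes x defines "f \<equiv> marking_factors x" and "m \<equiv> minor (mat36 x)"
  shows
    "m {1, 2, 3} = 1"
    "m {1, 2, 4} = 1"
    "m {1, 2, 5} = f ! 2"
    "m {1, 2, 6} = f ! 3"
    "m {1, 3, 4} = - 1"
    "m {1, 3, 5} = - f ! 0"
    "m {1, 3, 6} = - f ! 1"
    "m {1, 4, 5} = - f ! 9"
    "m {1, 4, 6} = - f ! 10"
    "m {1, 5, 6} = f ! 12"
    "m {2, 3, 4} = 1"
    "m {2, 3, 5} = 1"
    "m {2, 3, 6} = 1"
    "m {2, 4, 5} = - f ! 6"
    "m {2, 4, 6} = - f ! 7"
    "m {2, 5, 6} = f ! 11"
    "m {3, 4, 5} = f ! 4"
    "m {3, 4, 6} = f ! 5"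
    "m {3, 5, 6} = - f ! 8"
    "m {4, 5, 6} = f ! 13"
  unfolding f_def m_def
  by (simp_all add: minor_sorted mat36_def marking_factors_def Let_def vector_6 vector_3 algebra_simps)

lemma coords_phi_vec_list: "map (coord (mat36 x)) labels = coordinate_monomials (marking_factors x)"
proof -
  have six: "{Suc 0..6} = {1,2,3,4,5,6::nat}" by auto
  note minors = minors_mat36[where x = x, simplified One_nat_def insert_commute]
  show ?thesis
    unfolding labels_def coordinate_monomials_def
    by (simp add: coord_triples_label coord_pairs_label six insert_commute minors conic_det_mat36 del: mult_eq_0_iff)
qed

lemma coords_phi_vec: "i < 40 \<Longrightarrow> coords (phi_vec x) i = coordinate_monomials (marking_factors x) ! i"
  unfolding coords_phi_vec_list[symmetric] by (simp add: coords_def phi_vec_def lab_def length_labels)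

lemma length_marking_factors: "length (marking_factors x) = 15"
  by (simp add: marking_factors_def Let_def)

lemma disc_move:
  assumes "j < 6" "disc x \<noteq> 0"
  shows "disc (marking_move j x) \<noteq> 0"
proof -
  obtain a0 a1 a2 a3 a4 a5 a6 a7 a8 a9 a10 a11 a12 a13 a14 where
    f: "marking_factors x = [a0, a1, a2, a3, a4, a5, a6, a7, a8, a9, a10, a11, a12, a13, a14]"
    using length_marking_factors[of x] by (auto simp: length_Suc_conv numeral_eq_Suc)
  have nz: "prod_list [a0, a1, a2, a3, a4, a5, a6, a7, a8, a9, a10, a11, a12, a13, a14] \<noteq> 0"
    using assms(2) unfolding disc_factors f .
  have "j \<in> {0, 1, 2, 3, 4, 5}" using assms(1) by auto
  then have "prod_list (moved_factors j (marking_factors x)) \<noteq> 0"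
    unfolding f using nz by (auto simp: moved_factors_def)
  then show ?thesis unfolding disc_factors marking_factors_move[OF assms] .
qed

lemma move_scale_nonzero:
  assumes "j < 6" "disc x \<noteq> 0"
  shows "move_scale j (marking_factors x) \<noteq> 0"
proof -
  obtain a0 a1 a2 a3 a4 a5 a6 a7 a8 a9 a10 a11 a12 a13 a14 where
    f: "marking_factors x = [a0, a1, a2, a3, a4, a5, a6, a7, a8, a9, a10, a11, a12, a13, a14]"
    using length_marking_factors[of x] by (auto simp: length_Suc_conv numeral_eq_Suc)
  have nz: "prod_list [a0, a1, a2, a3, a4, a5, a6, a7, a8, a9, a10, a11, a12, a13, a14] \<noteq> 0"
    using assms(2) unfolding disc_factors f .
  have "j \<in> {0, 1, 2, 3, 4, 5}" using assms(1) by auto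
  then show ?thesis
    unfolding f using nz by (auto simp: move_scale_def)
qed

lemma phi_vec_move:
  assumes "j < 6" "disc x \<noteq> 0"
  shows "phi_vec (marking_move j x) = move_scale j (marking_factors x) *s signed_perm j (phi_vec x)"
proof (rule coords_eqI)
  fix i :: nat assume i: "i < 40"
  have nz: "prod_list (marking_factors x) \<noteq> 0" using assms(2) by (simp add: disc_factors)
  have "coords (phi_vec (marking_move j x)) i = coordinate_monomials (moved_factors j (marking_factors x)) ! i"
    unfolding coords_phi_vec[OF i] marking_factors_move[OF assms] ..
  also have "\<dots> = move_scale j (marking_factors x) * coords (signed_perm j (phi_vec x)) i"
    unfolding coordinate_monomials_move[OF assms(1) length_marking_factors nz]
    using i perm_less[OF assms(1) i]
    by (simp add: coords_signed_perm[OF assms(1) i] coords_phi_vec)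
  finally show "coords (phi_vec (marking_move j x)) i = coords (move_scale j (marking_factors x) *s signed_perm j (phi_vec x)) i"
    by (simp add: coords_def)
qed

definition phi_cone :: "(complex^label) set" where
  "phi_cone = {c *s phi_vec x | c x. c \<noteq> 0 \<and> x \<in> M}"

lemma signed_perm_phi_cone:
  assumes "j < 6" "y \<in> phi_cone"
  shows "signed_perm j y \<in> phi_cone"
proof -
  obtain c x where y: "y = c *s phi_vec x" "c \<noteq> 0" and x: "disc x \<noteq> 0"
    using assms(2) by (auto simp: phi_cone_def M_def)
  let ?s = "move_scale j (marking_factors x)"
  have "signed_perm j y = (c / ?s) *s phi_vec (marking_move j x)"
    using move_scale_nonzero[OF assms(1) x]
    by (simp add: y signed_perm_scale phi_vec_move[OF assms(1) x] vector_smult_assoc)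
  moreover have "c / ?s \<noteq> 0" using move_scale_nonzero[OF assms(1) x] y by simp
  moreover have "marking_move j x \<in> M" using disc_move[OF assms(1) x] by (simp add: M_def)
  ultimately show ?thesis unfolding phi_cone_def by blast
qed

lemma base_forms_phi:
  "eval_form linear_form (coords (c *s phi_vec x)) = 0" "eval_form cubic_form (coords (c *s phi_vec x)) = 0"
proof -
  have c: "coords (c *s phi_vec x) i = c * coordinate_monomials (marking_factors x) ! i" if "i < 40" for i
    using coords_phi_vec[OF that] by (simp add: coords_def)
  show "eval_form linear_form (coords (c *s phi_vec x)) = 0"
    by (simp add: eval_form_def linear_form_def c coordinate_monomials_def marking_factors_def Let_def algebra_simps)
  show "eval_form cubic_form (coords (c *s phi_vec x)) = 0"
    by (simp add: eval_form_def cubic_form_def c coordinate_monomials_def)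
qed

lemma phi_cone_subset_cone: "phi_cone \<subseteq> equation_cone"
proof
  fix y assume y: "y \<in> phi_cone"
  have step: "\<forall>y\<in>phi_cone. T F y = 0" if "G_acts g T" "\<forall>y\<in>phi_cone. F y = 0" for g T F
    using that(1)
  proof induction
    case one then show ?case using that(2) by simp
  next
    case (mult s g T)
    obtain j where j: "j < 6" "s = gen j" using mult.hyps(1) by (auto simp: gens_eq)
    show ?case
      unfolding j(2) by (simp add: gen_act_gen mult.IH signed_perm_phi_cone[OF j(1)])
  qed
  have "\<forall>y\<in>phi_cone. linear_eq y = 0" "\<forall>y\<in>phi_cone. cubic_eq y = 0"
    by (auto simp: phi_cone_def linear_eq_form cubic_eq_form base_forms_phi)
  then have "F y = 0" if "F \<in> G_orbit linear_eq \<union> G_orbit cubic_eq" for F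
    using that step y unfolding G_orbit_def by blast
  then show "y \<in> equation_cone" unfolding equation_cone_def by blast
qed

lemma M_nonempty: "vector [2, 3, 5, 11] \<in> M"
  by (simp add: M_def disc_def vector_4 Let_def)

lemma continuous_phi_vec: "continuous_on S phi_vec"
  unfolding phi_vec_def
proof (rule continuous_on_vec_lambda)
  fix \<alpha>
  obtain i where i: "i < 40" "\<alpha> = lab i" using lab_surj by blast
  have eq: "coord (mat36 x) \<alpha> = coordinate_monomials (marking_factors x) ! i" for x
    using coords_phi_vec[OF i(1), of x] by (simp add: coords_def phi_vec_def i(2))
  have upt: "[0..<40] = [0,1,2,3,4,5,6,7,8,9,10,11,12,13,14,15,16,17,18,19,20,21,22,23,24,25,26,27,28,29,30,31,32,33,34,35,36,37,38,39::nat]"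
    by (simp add: upt_rec)
  have "\<forall>i\<in>set [0..<40]. continuous_on S (\<lambda>x. coordinate_monomials (marking_factors x) ! i)"
    unfolding upt by (simp add: coordinate_monomials_def marking_factors_def Let_def) (intro conjI continuous_intros)
  then show "continuous_on S (\<lambda>x. coord (mat36 x) \<alpha>)" unfolding eq using i by simp
qed

text \<open>
  The discriminant is a nonzero polynomial on the line through \<open>x\<close> and a point of \<open>M\<close>.
\<close>
lemma phi_vec_in_closure:
  assumes "c \<noteq> 0"
  shows "c *s phi_vec x \<in> closure phi_cone"
proof -
  define d :: "complex^4" where "d = vector [2, 3, 5, 11]"
  let ?x = "\<lambda>t. x + t *s (d - x)"
  define u where "u k = [:x $ k, d $ k - x $ k:]" for k
  define P where "P = (let x1 = u 1; x2 = u 2; x3 = u 3; x4 = u 4;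
         D1 = x1 * x4 - x2 * x3;
         D2 = x1 * x4 - x4 + x2 - x2 * x3 + x3 - x1;
         Q = - x1 * x2 * x3 - x2 * x3 * x4 + x2 * x3 + x1 * x2 * x4 + x1 * x3 * x4 - x1 * x4
     in x1 * x2 * x3 * x4 * (x1 - 1) * (x2 - 1) * (x3 - 1) * (x4 - 1) *
        (x1 - x2) * (x1 - x3) * (x2 - x4) * (x3 - x4) * D1 * D2 * Q)"
  have u: "poly (u k) t = ?x t $ k" for k t by (simp add: u_def algebra_simps)
  have P: "poly P t = disc (?x t)" for t
    unfolding P_def disc_def Let_def by (simp only: poly_mult poly_diff poly_add poly_minus poly_1 u)
  have "poly P 1 \<noteq> 0" unfolding P using M_nonempty by (simp add: d_def M_def)
  then have "P \<noteq> 0" by auto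
  have "c *s phi_vec (?x 0) \<in> closure phi_cone"
  proof (rule closure_of_cofinite[where S = "{t. poly P t = 0}"])
    show "continuous_on UNIV (\<lambda>t. c *s phi_vec (?x t))"
      by (intro continuous_scale continuous_on_compose2[OF continuous_phi_vec[of UNIV]] continuous_intros) auto
    show "finite {t. poly P t = 0}" using \<open>P \<noteq> 0\<close> by (rule poly_roots_finite)
    fix t assume "t \<notin> {t. poly P t = 0}"
    then have "?x t \<in> M" by (simp add: M_def P)
    then show "c *s phi_vec (?x t) \<in> phi_cone" using assms unfolding phi_cone_def by blast
  qed
  then show ?thesis by simp
qed

section \<open>From the toric fourfold to the cone over the image\<close>

definition trihedral_vector :: "trihedral_coords \<Rightarrow> complex^label" where
  "trihedral_vector z = (\<chi> \<alpha>. case z of (p, q, A, B) \<Rightarrow> trihedral_coordinates p q A B ! (LEAST i. \<alpha> = lab i))"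

lemma coords_trihedral_vector:
  assumes "i < 40"
  shows "coords (trihedral_vector (p, q, A, B)) i = trihedral_coordinates p q A B ! i"
proof -
  have "(LEAST k. lab i = lab k) = i"
  proof (rule Least_equality)
    fix k assume k: "lab i = lab k"
    show "i \<le> k"
    proof (rule ccontr)
      assume "\<not> i \<le> k"
      then show False using k assms lab_inject[of i k] by simp
    qed
  qed simp
  then show ?thesis by (simp add: coords_def trihedral_vector_def)
qed

lemma continuous_trihedral_vector: "continuous_on S trihedral_vector"
proof -
  have upt: "[0..<40] = [0,1,2,3,4,5,6,7,8,9,10,11,12,13,14,15,16,17,18,19,20,21,22,23,24,25,26,27,28,29,30,31,32,33,34,35,36,37,38,39::nat]"
    by (simp add: upt_rec)
  have c: "\<forall>i\<in>set [0..<40]. continuous_on S (\<lambda>z. trihedral_coordinates (fst z) (fst (snd z)) (fst (snd (snd z))) (snd (snd (snd z))) ! i)"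
    unfolding upt by (simp add: trihedral_coordinates_def Let_def) (intro conjI continuous_intros continuous_coord_sum)
  show ?thesis
    unfolding trihedral_vector_def case_prod_unfold
  proof (rule continuous_on_vec_lambda)
    fix \<alpha>
    obtain i where i: "i < 40" "\<alpha> = lab i" using lab_surj by blast
    then have "(LEAST i. \<alpha> = lab i) < 40" by (metis (mono_tags, lifting) Least_le le_less_trans)
    then show "continuous_on S (\<lambda>z. trihedral_coordinates (fst z) (fst (snd z)) (fst (snd (snd z))) (snd (snd (snd z))) ! (LEAST i. \<alpha> = lab i))"
      using c by simp
  qed
qed

lemma toric_scale: "toric c (r *s p) (r *s q) = toric (c * r ^ 3) p q"
proof -
  have "cofactors (r *s v) = r ^ 2 *s cofactors v" for v
    unfolding vec_eq_iff
  proof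
    fix i :: 3
    obtain j k where "distinct [i, j, k]" using distinct_extend1 by blast
    then show "cofactors (r *s v) $ i = (r ^ 2 *s cofactors v) $ i"
      by (simp add: cofactors_distinct power2_eq_square)
  qed
  then show ?thesis
    by (simp add: toric_def coord_sum_scale vector_smult_assoc power3_eq_cube power2_eq_square algebra_simps)
qed

text \<open>
  For a normalised matrix the even terms of the determinant \<open>D\<^sub>4\<^sub>5\<^sub>6\<close> are \<open>x\<^sub>1x\<^sub>4, x\<^sub>2, x\<^sub>3\<close> and the odd
  ones are \<open>x\<^sub>2x\<^sub>3, x\<^sub>1, x\<^sub>4\<close>. The sign comes from \<open>Q\<close> being the negative of the conic determinant.
\<close>
lemma trihedral_vector_marking:
  "trihedral_vector (toric c (vector [x $ 1 * x $ 4, x $ 2, x $ 3]) (vector [x $ 2 * x $ 3, x $ 1, x $ 4])) = (- c) *s phi_vec x"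
proof (rule coords_eqI)
  fix i :: nat assume i: "i < 40"
  let ?p = "vector [x $ 1 * x $ 4, x $ 2, x $ 3] :: complex^3" and ?q = "vector [x $ 2 * x $ 3, x $ 1, x $ 4] :: complex^3"
  obtain a b e d where x: "x $ 1 = a" "x $ 2 = b" "x $ 3 = e" "x $ 4 = d" by blast
  have d1: "distinct [1,2,3::3]" "distinct [2,1,3::3]" "distinct [3,1,2::3]" by simp_all
  have upt: "[0..<40] = [0,1,2,3,4,5,6,7,8,9,10,11,12,13,14,15,16,17,18,19,20,21,22,23,24,25,26,27,28,29,30,31,32,33,34,35,36,37,38,39::nat]"
    by (simp add: upt_rec)
  have tot: "coord_sum v = v $ 1 + v $ 2 + v $ 3" for v by (rule coord_sum_distinct[OF d1(1)])
  have cof: "cofactors v $ 1 = v $ 2 * v $ 3" "cofactors v $ 2 = v $ 1 * v $ 3" "cofactors v $ 3 = v $ 1 * v $ 2" for v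
    by (rule cofactors_distinct[OF d1(1)] cofactors_distinct[OF d1(2)] cofactors_distinct[OF d1(3)])+
  have "\<forall>i\<in>set [0..<40]. (case toric c ?p ?q of (p, q, A, B) \<Rightarrow> trihedral_coordinates p q A B) ! i = - c * coordinate_monomials (marking_factors x) ! i"
    unfolding upt
    by (simp add: toric_def trihedral_coordinates_def coordinate_monomials_def marking_factors_def Let_def tot cof vector_3 x)
      (intro conjI; algebra)
  then show "coords (trihedral_vector (toric c ?p ?q)) i = coords ((- c) *s phi_vec x) i"
    using i coords_trihedral_vector[OF i] coords_phi_vec[OF i, of x]
    by (simp add: coords_def split: prod.splits)
qed

text \<open>
  After scaling \<open>(p, q)\<close> such that \<open>p\<^sub>1 = q\<^sub>2 q\<^sub>3\<close>, the remaining entries are those of a normalised matrix.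
\<close>
lemma trihedral_vector_toric:
  assumes c: "c \<noteq> 0" and eq: "coord_prod p = coord_prod q" "coord_prod p \<noteq> 0"
  shows "trihedral_vector (toric c p q) \<in> closure phi_cone"
proof -
  have prods: "p $ 1 * p $ 2 * p $ 3 = q $ 1 * q $ 2 * q $ 3" "p $ 1 * p $ 2 * p $ 3 \<noteq> 0"
    using eq coord_prod_distinct[of 1 2 3] by simp_all
  then have nz: "p $ 1 \<noteq> 0" "q $ 2 \<noteq> 0" "q $ 3 \<noteq> 0" by auto
  define r where "r = q $ 2 * q $ 3 / p $ 1"
  have r: "r \<noteq> 0" using nz by (simp add: r_def)
  define x :: "complex^4" where "x = vector [q $ 2 / r, p $ 2 / r, p $ 3 / r, q $ 3 / r]"
  have "p = r *s vector [x $ 1 * x $ 4, x $ 2, x $ 3]"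
    using nz r by (simp add: vec_eq_iff forall_3 x_def vector_4 vector_3 r_def)
  moreover have "q = r *s vector [x $ 2 * x $ 3, x $ 1, x $ 4]"
  proof -
    have "r * (p $ 2 / r * (p $ 3 / r)) = q $ 1"
      using prods nz unfolding r_def by (simp add: field_simps)
    then show ?thesis using r by (simp add: vec_eq_iff forall_3 x_def vector_4 vector_3)
  qed
  ultimately have "trihedral_vector (toric c p q) = (- (c * r ^ 3)) *s phi_vec x"
    by (metis toric_scale trihedral_vector_marking)
  then show ?thesis using phi_vec_in_closure[of "- (c * r ^ 3)" x] c r by simp
qed

lemma toric_closure_in_closure:
  assumes "z \<in> toric_closure"
  shows "trihedral_vector z \<in> closure phi_cone"
proof -
  have "trihedral_vector ` closure {toric c p q | c p q. c \<noteq> 0 \<and> coord_prod p = coord_prod q \<and> coord_prod p \<noteq> 0} \<subseteq> closure phi_cone"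
    by (rule image_closure_subset) (use trihedral_vector_toric continuous_trihedral_vector in auto)
  then show ?thesis using assms unfolding toric_closure_def by blast
qed

lemma chart_in_closure:
  assumes y: "y \<in> equation_cone" and y0: "coords y 0 \<noteq> 0"
  shows "y \<in> closure phi_cone"
proof -
  obtain p q A B where T: "trihedral p q A B" and c: "\<forall>i<40. coords y i = trihedral_coordinates p q A B ! i"
    using cone_trihedral[OF y y0] by metis
  have "y = trihedral_vector (p, q, A, B)"
    using c coords_trihedral_vector by (intro coords_eqI) simp
  then show ?thesis using toric_closure_in_closure[OF trihedral_in_toric_closure[OF T]] by simp
qed

lemma signed_perm_closure:
  assumes "j < 6" "y \<in> closure phi_cone"
  shows "signed_perm j y \<in> closure phi_cone"
proof -
  have "signed_perm j ` closure phi_cone \<subseteq> closure phi_cone"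
    using signed_perm_phi_cone[OF assms(1)] closure_subset
    by (intro image_closure_subset continuous_signed_perm) auto
  then show ?thesis using assms(2) by blast
qed

text \<open>
  Words in the generators that carry the label \<open>0\<close> to all others.
\<close>
definition label_words :: "nat list list" where
  "label_words =
   [[], [2], [3, 2], [4, 3, 2], [1, 2],
    [3, 1, 2], [4, 3, 1, 2], [2, 3, 1, 2], [3, 0, 1, 2], [0, 1, 2],
    [5, 2], [5, 3, 2], [5, 4, 3, 2], [2, 5, 3, 2], [2, 5, 4, 3, 2],
    [1, 2, 5, 0, 1, 2], [5, 1, 2], [5, 3, 1, 2], [5, 4, 3, 1, 2], [1, 2, 5, 3, 2],
    [3, 2, 5, 0, 1, 2], [2, 5, 0, 1, 2], [2, 5, 1, 2], [2, 5, 3, 1, 2], [2, 5, 4, 3, 1, 2],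
    [1, 2, 5, 3, 1, 2], [3, 2, 5, 3, 0, 1, 2], [5, 0, 1, 2], [3, 2, 5, 1, 2], [3, 2, 5, 3, 1, 2],
    [1, 2, 5, 3, 0, 1, 2], [3, 1, 2, 5, 3, 1, 2], [2, 5, 3, 0, 1, 2], [5, 3, 0, 1, 2], [4, 3, 2, 5, 1, 2],
    [0, 1, 2, 5, 3, 1, 2], [1, 2, 5, 2, 3, 1, 2], [3, 2, 5, 2, 3, 1, 2], [2, 5, 2, 3, 1, 2], [5, 2, 3, 1, 2]]"

lemma label_words: "map (\<lambda>w. foldr perm w 0) label_words = [0..<40]"
  by (simp add: label_words_def perm_def label_perms_def upt_rec)

lemma cone_in_closure:
  assumes y: "y \<in> equation_cone" and nz: "y \<noteq> 0"
  shows "y \<in> closure phi_cone"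
proof -
  have words: "foldr perm w 0 < 40 \<and> (\<forall>y\<in>equation_cone. coords y (foldr perm w 0) \<noteq> 0 \<longrightarrow> y \<in> closure phi_cone)"
    if "set w \<subseteq> {..<6}" for w
    using that
  proof (induction w)
    case Nil
    show ?case using chart_in_closure by simp
  next
    case (Cons j w)
    then have j: "j < 6" and i: "foldr perm w 0 < 40"
      and IH: "\<forall>y\<in>equation_cone. coords y (foldr perm w 0) \<noteq> 0 \<longrightarrow> y \<in> closure phi_cone" by auto
    have "y \<in> closure phi_cone" if y: "y \<in> equation_cone" and nz: "coords y (foldr perm (j # w) 0) \<noteq> 0" for y
    proof -
      have "coords (signed_perm j y) (foldr perm w 0) \<noteq> 0"
        using nz unfolding coords_signed_perm[OF j i]
        by (cases "perm j (foldr perm w 0) = foldr perm w 0") simp_all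
      then have "signed_perm j y \<in> closure phi_cone"
        using IH signed_perm_cone[OF j y] by blast
      then show "y \<in> closure phi_cone"
        using signed_perm_closure[OF j] signed_perm_involution[OF j] by metis
    qed
    then show ?case using perm_less[OF j i] by simp
  qed
  obtain i where i: "i < 40" "coords y i \<noteq> 0"
    using nz coords_eqI[of y 0] by (auto simp: coords_def)
  have "i \<in> set (map (\<lambda>w. foldr perm w 0) label_words)" unfolding label_words using i by simp
  then obtain w where w: "w \<in> set label_words" "i = foldr perm w 0" by auto
  have "\<forall>w\<in>set label_words. set w \<subseteq> {..<6}" by (simp add: label_words_def)
  then show ?thesis using words[of w] w i y by blast
qed

section \<open>Homogeneity of the equations\<close>

lemma finite_exponents: "finite {m :: 'n::finite \<Rightarrow> nat. (\<Sum>i\<in>UNIV. m i) = d}"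
proof (rule finite_subset)
  show "{m :: 'n \<Rightarrow> nat. (\<Sum>i\<in>UNIV. m i) = d} \<subseteq> (UNIV :: 'n set) \<rightarrow>\<^sub>E {..d}"
    by (auto simp: PiE_def Pi_def intro!: member_le_sum)
  show "finite ((UNIV :: 'n set) \<rightarrow>\<^sub>E {..d})" by (intro finite_PiE) auto
qed

text \<open>
  Together with sums, such monomials account for both types of equations.
\<close>
lemma homogeneous_poly_monomial:
  fixes k :: "'n::finite \<Rightarrow> nat"
  assumes "(\<Sum>i\<in>UNIV. k i) = d"
  shows "homogeneous_poly d (\<lambda>v :: complex^'n. c * (\<Prod>i\<in>UNIV. (v $ i) ^ k i))"
  unfolding homogeneous_poly_def
proof (intro exI ext)
  fix v :: "complex^'n"
  have "(\<Sum>m | (\<Sum>i\<in>UNIV. m i) = d. (if m = k then c else 0) * (\<Prod>i\<in>UNIV. (v $ i) ^ m i)) =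
    (\<Sum>m | (\<Sum>i\<in>UNIV. m i) = d. if m = k then c * (\<Prod>i\<in>UNIV. (v $ i) ^ k i) else 0)"
    by (intro sum.cong) auto
  also have "\<dots> = c * (\<Prod>i\<in>UNIV. (v $ i) ^ k i)"
    using assms by (subst sum.delta[OF finite_exponents]) simp_all
  finally show "c * (\<Prod>i\<in>UNIV. (v $ i) ^ k i) = (\<Sum>m | (\<Sum>i\<in>UNIV. m i) = d. (if m = k then c else 0) * (\<Prod>i\<in>UNIV. (v $ i) ^ m i))"
    by simp
qed

lemma homogeneous_poly_add:
  assumes "homogeneous_poly d F" "homogeneous_poly d H"
  shows "homogeneous_poly d (\<lambda>v. F v + H v)"
proof -
  obtain a b where "F = (\<lambda>v. \<Sum>m | (\<Sum>i\<in>UNIV. m i) = d. a m * (\<Prod>i\<in>UNIV. (v $ i) ^ m i))"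
    "H = (\<lambda>v. \<Sum>m | (\<Sum>i\<in>UNIV. m i) = d. b m * (\<Prod>i\<in>UNIV. (v $ i) ^ m i))"
    using assms unfolding homogeneous_poly_def by blast
  then have "(\<lambda>v. F v + H v) = (\<lambda>v. \<Sum>m | (\<Sum>i\<in>UNIV. m i) = d. (a m + b m) * (\<Prod>i\<in>UNIV. (v $ i) ^ m i))"
    by (simp add: sum.distrib distrib_right fun_eq_iff)
  then show ?thesis unfolding homogeneous_poly_def by (intro exI)
qed

lemma homogeneous_poly_coord:
  fixes a :: "'n::finite"
  shows "homogeneous_poly 1 (\<lambda>v. c * v $ a)"
proof -
  have "(\<Prod>i\<in>UNIV. (v $ i) ^ (if i = a then 1 else 0 :: nat)) = v $ a" for v :: "complex^'n"
  proof -
    have "(\<Prod>i\<in>UNIV. (v $ i) ^ (if i = a then 1 else 0 :: nat)) = (\<Prod>i\<in>UNIV. if i = a then v $ i else 1)"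
      by (intro prod.cong) auto
    then show ?thesis by simp
  qed
  then show ?thesis
    using homogeneous_poly_monomial[of "\<lambda>i. if i = a then 1 else 0" 1 c] by simp
qed

lemma homogeneous_poly_coord3:
  fixes a1 a2 a3 :: "'n::finite"
  shows "homogeneous_poly 3 (\<lambda>v. c * (v $ a1 * v $ a2 * v $ a3))"
proof -
  let ?e = "\<lambda>(a::'n) i. if i = a then 1 else 0 :: nat"
  have "(\<Prod>i\<in>UNIV. (v $ i) ^ ?e a i) = v $ a" for v :: "complex^'n" and a :: 'n
  proof -
    have "(\<Prod>i\<in>UNIV. (v $ i) ^ ?e a i) = (\<Prod>i\<in>UNIV. if i = a then v $ i else 1)"
      by (intro prod.cong) auto
    then show ?thesis by simp
  qed
  then have "(\<Prod>i\<in>UNIV. (v $ i) ^ (?e a1 i + ?e a2 i + ?e a3 i)) = v $ a1 * v $ a2 * v $ a3" for v :: "complex^'n"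
    by (simp only: power_add prod.distrib)
  moreover have "(\<Sum>i\<in>UNIV. ?e a1 i + ?e a2 i + ?e a3 i) = 3" by (simp add: sum.distrib)
  ultimately show ?thesis
    using homogeneous_poly_monomial[of "\<lambda>i. ?e a1 i + ?e a2 i + ?e a3 i" 3 c] by simp
qed

lemma G_acts_monomial:
  assumes "G_acts g T"
  shows "\<exists>\<epsilon> \<sigma>. \<forall>F. T F = (\<lambda>y. F (\<chi> \<alpha>. \<epsilon> \<alpha> * y $ \<sigma> \<alpha>))"
  using assms
proof induction
  case one
  show ?case
    by (intro exI[of _ "\<lambda>_. 1"] exI[of _ id]) simp
next
  case (mult s g T)
  then obtain \<epsilon> \<sigma> where T: "\<And>F. T F = (\<lambda>y. F (\<chi> \<alpha>. \<epsilon> \<alpha> * y $ \<sigma> \<alpha>))" by blast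
  define \<delta> where "\<delta> \<alpha> = (if act_label s \<alpha> = \<alpha> then 1 else - 1 :: complex)" for \<alpha>
  have eq: "(gen_act s \<circ> T) F = (\<lambda>y. F (\<chi> \<alpha>. (\<epsilon> \<alpha> * \<delta> (\<sigma> \<alpha>)) * y $ act_label s (\<sigma> \<alpha>)))" for F
    unfolding o_apply gen_act_def T
    by (intro ext arg_cong[of _ _ F]) (simp add: vec_eq_iff \<delta>_def)
  show ?case
    by (rule exI, rule exI, rule allI, rule eq)
qed

lemma orbit_homogeneous:
  assumes "F \<in> G_orbit linear_eq \<union> G_orbit cubic_eq"
  shows "\<exists>d. homogeneous_poly d F"
proof -
  obtain g T F0 where T: "G_acts g T" "F = T F0" and F0: "F0 = linear_eq \<or> F0 = cubic_eq"
    using assms unfolding G_orbit_def by blast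
  obtain \<epsilon> \<sigma> where F: "F = (\<lambda>y. F0 (\<chi> \<alpha>. \<epsilon> \<alpha> * y $ \<sigma> \<alpha>))"
    using G_acts_monomial[OF T(1)] T(2) by blast
  show ?thesis
    using F0
  proof
    assume "F0 = linear_eq"
    let ?a = "triples_label 1 2 4 3 5 6" and ?b = "triples_label 1 4 5 2 3 6"
      and ?c = "triples_label 1 4 6 2 3 5" and ?d = "triples_label 1 3 4 2 5 6"
    have "F = (\<lambda>y. \<epsilon> ?a * y $ \<sigma> ?a + (- \<epsilon> ?b) * y $ \<sigma> ?b + \<epsilon> ?c * y $ \<sigma> ?c + (- \<epsilon> ?d) * y $ \<sigma> ?d)"
      unfolding F \<open>F0 = linear_eq\<close> linear_eq_def by (simp add: fun_eq_iff)
    moreover have "homogeneous_poly 1 \<dots>"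
      by (intro homogeneous_poly_add homogeneous_poly_coord)
    ultimately show ?thesis by auto
  next
    assume "F0 = cubic_eq"
    let ?a1 = "triples_label 1 2 4 3 5 6" and ?a2 = "pairs_label 1 5 2 3 4 6" and ?a3 = "pairs_label 1 3 2 6 4 5"
      and ?b1 = "triples_label 1 4 5 2 3 6" and ?b2 = "pairs_label 1 3 5 6 2 4" and ?b3 = "pairs_label 1 2 3 5 4 6"
    have "F = (\<lambda>y. (\<epsilon> ?a1 * \<epsilon> ?a2 * \<epsilon> ?a3) * (y $ \<sigma> ?a1 * y $ \<sigma> ?a2 * y $ \<sigma> ?a3) +
        (- (\<epsilon> ?b1 * \<epsilon> ?b2 * \<epsilon> ?b3)) * (y $ \<sigma> ?b1 * y $ \<sigma> ?b2 * y $ \<sigma> ?b3))"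
      unfolding F \<open>F0 = cubic_eq\<close> cubic_eq_def by (simp add: fun_eq_iff mult_ac)
    moreover have "homogeneous_poly 3 \<dots>"
      by (intro homogeneous_poly_add homogeneous_poly_coord3)
    ultimately show ?thesis by auto
  qed
qed

lemma continuous_homogeneous_poly:
  assumes "homogeneous_poly d F"
  shows "continuous_on S F"
proof -
  obtain a where "F = (\<lambda>v. \<Sum>m | (\<Sum>i\<in>UNIV. m i) = d. a m * (\<Prod>i\<in>UNIV. (v $ i) ^ m i))"
    using assms unfolding homogeneous_poly_def by blast
  then show ?thesis by (simp add: continuous_intros)
qed

section \<open>The closure of the image\<close>

lemma zariski_closed_V: "zariski_closed V"
  unfolding zariski_closed_def V_def using orbit_homogeneous by blast

lemma phi_vec_nonzero: "x \<in> M \<Longrightarrow> phi_vec x \<noteq> 0"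
proof
  assume x: "x \<in> M" and "phi_vec x = 0"
  then have "coords (phi_vec x) 0 = 0" by (simp add: coords_def)
  then have "disc x = 0"
    unfolding coords_phi_vec[of 0, simplified] by (auto simp: coordinate_monomials_def marking_factors_def disc_def Let_def)
  then show False using x by (simp add: M_def)
qed

lemma phi_image_subset_V: "\<phi> ` M \<subseteq> V"
proof
  fix p assume "p \<in> \<phi> ` M"
  then obtain x where x: "x \<in> M" "p = proj_point (phi_vec x)"
    by (auto simp: \<phi>_def phi_vec_def)
  have "p \<in> proj_space" using x phi_vec_nonzero[OF x(1)] by (auto simp: proj_space_def)
  moreover have "v \<in> equation_cone" if "v \<in> p" for v
    using that x phi_cone_subset_cone by (auto simp: proj_point_def phi_cone_def)
  ultimately show "p \<in> V" by (auto simp: V_def zero_locus_def equation_cone_def)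
qed

text \<open>
  A form that vanishes on the image vanishes on the Euclidean closure of the cone over it.
\<close>
lemma V_subset_closed:
  assumes "zariski_closed Z" "\<phi> ` M \<subseteq> Z"
  shows "V \<subseteq> Z"
proof
  fix p assume p: "p \<in> V"
  obtain \<F> where hom: "\<forall>F\<in>\<F>. \<exists>d. homogeneous_poly d F" and Z: "Z = zero_locus \<F>"
    using assms(1) unfolding zariski_closed_def by blast
  have proj: "p \<in> proj_space" using p by (simp add: V_def zero_locus_def)
  have "F v = 0" if F: "F \<in> \<F>" and v: "v \<in> p" for F v
  proof -
    obtain w where w: "w \<noteq> 0" "p = proj_point w" using proj by (auto simp: proj_space_def)
    then have "v \<noteq> 0" using v by (auto simp: proj_point_def)
    moreover have "v \<in> equation_cone" using p v by (simp add: V_def zero_locus_def equation_cone_def)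
    ultimately have "v \<in> closure phi_cone" by (intro cone_in_closure)
    moreover have "closure phi_cone \<subseteq> {v. F v = 0}"
    proof (rule closure_minimal)
      show "phi_cone \<subseteq> {v. F v = 0}"
      proof
        fix u assume "u \<in> phi_cone"
        then obtain c x where u: "u = c *s phi_vec x" "c \<noteq> 0" and x: "x \<in> M" by (auto simp: phi_cone_def)
        then have "u \<in> \<phi> x" by (auto simp: \<phi>_def phi_vec_def proj_point_def)
        moreover have "\<phi> x \<in> zero_locus \<F>" using assms(2) x Z by blast
        ultimately show "u \<in> {v. F v = 0}" using F by (auto simp: zero_locus_def)
      qed
      obtain d where "homogeneous_poly d F" using hom F by blast
      then show "closed {v. F v = 0}"
        using continuous_homogeneous_poly by (intro closed_Collect_eq) (auto intro: continuous_intros)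
    qed
    ultimately show ?thesis by blast
  qed
  then show "p \<in> Z" using proj by (simp add: Z zero_locus_def)
qed

theorem theorem4:
  shows "zariski_closure (\<phi> ` M) = V"
  unfolding zariski_closure_def
  by (rule hull_unique) (use phi_image_subset_V zariski_closed_V V_subset_closed in auto)

end
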